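(* Let $L_1,\dots,L_M\in\mathbb{N}$ and $q_1,\dots,q_M\in\mathbb{R}[x]$ with $\deg q_j<2L_j$, $q_j(0)=0$; let $P=\prod_{j=1}^M(y+q_j(x)+ix^{2L_j})$, $A=\tfrac12(P+\bar P)$, $B=\tfrac1{2i}(P-\bar P)$. Fix $1\le\mathfrak{p}<\infty$ and a proper $t\in\mathbb{R}$, so $A+tB=u\prod_{j}(y-a_j(x;t))$ with $-a_j(x;t)=q_j(x)+x^{2L_j}\psi_j(x;t)$. Then there is a relabeling of the indices $1,\dots,M$ (of the factors of $P$, together with the corresponding branches $a_j$) such that, with $F_k=(A+tB)/\prod_{j=1}^k(y-a_j(x;t))$, the following holds: every $Q\in\mathbb{C}\{x,y\}$ has a unique representative modulo $(P,\bar P)$ of the form $$Q\equiv\sum_{k=1}^Mc_k(x)F_k(x,y),\qquad c_k\in\mathbb{C}[x],\ \deg c_k<2L_k+\sum_{j\ne k}O_{jk},$$ and $Q/P\in L^{\mathfrak{p}}_{loc}$ if and only if for each $k=1,\dots,M$, $c_k$ vanishes at $0$ to order at least $$\bigl\lfloor(2L_k+1)(1-1/\mathfrak{p})\bigr\rfloor+\sum_{j<k}O_{jk}.$$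
   Context: $\bar P(x,y)=\overline{P(\bar x,\bar y)}$. $\mathbb{C}\{x,y\}$ are convergent power series at the origin and $(P,\bar P)$ the ideal they generate; $\mathbb{R}\{x\}$ are real-coefficient convergent series; a unit is a series nonvanishing at the origin; Ord is order of vanishing at $0$. $f\in L^{\mathfrak{p}}_{loc}$ means $f\in L^{\mathfrak{p}}(U)$ for some neighborhood $U$ of $(0,0)$ in $\mathbb{R}^2$. $O_{ij}=\min\{\mathrm{Ord}(q_j-q_i),2L_j,2L_i\}$. A real $t$ is called proper if there is a local factorization $A+tB=u(x,y;t)\prod_{j=1}^M(y+q_j(x)+x^{2L_j}\psi_j(x;t))$ with $u(\cdot,\cdot;t)$ a unit, $\psi_j(\cdot;t)\in\mathbb{R}\{x\}$, and $\mathrm{Ord}(q_j-q_i+x^{2L_j}\psi_j(x;t)-x^{2L_i}\psi_i(x;t))=O_{ij}$ for all $i\ne j$; all but finitely many real $t$ are proper. *)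

theory Defs
  imports "HOL-Analysis.Analysis" "HOL-Computational_Algebra.Polynomial"
begin

text \<open>Convergent power series in two complex variables (elements of C{x,y}),
represented by functions that agree near the origin with an absolutely
convergent double power series.\<close>
definition conv_ps2 :: "(complex \<Rightarrow> complex \<Rightarrow> complex) \<Rightarrow> bool" where
  "conv_ps2 Q \<longleftrightarrow> (\<exists>r>0. \<exists>c :: nat \<Rightarrow> nat \<Rightarrow> complex.
     \<forall>x y. norm x < r \<longrightarrow> norm y < r \<longrightarrow>
        ((\<lambda>(m,n). c m n * x ^ m * y ^ n) has_sum Q x y) UNIV)"

definition conv_ps1_real :: "(nat \<Rightarrow> real) \<Rightarrow> bool" where
  "conv_ps1_real a \<longleftrightarrow> (\<exists>r>0. summable (\<lambda>n. \<bar>a n\<bar> * r ^ n))"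

definition eval_ps1 :: "(nat \<Rightarrow> real) \<Rightarrow> complex \<Rightarrow> complex" where
  "eval_ps1 a x = (\<Sum>n. complex_of_real (a n) * x ^ n)"

definition germ_eq :: "(complex \<Rightarrow> complex \<Rightarrow> complex) \<Rightarrow> (complex \<Rightarrow> complex \<Rightarrow> complex) \<Rightarrow> bool" where
  "germ_eq f g \<longleftrightarrow> (\<exists>r>0. \<forall>x y. norm x < r \<longrightarrow> norm y < r \<longrightarrow> f x y = g x y)"

definition cong_ideal2 ::
  "(complex \<Rightarrow> complex \<Rightarrow> complex) \<Rightarrow> (complex \<Rightarrow> complex \<Rightarrow> complex) \<Rightarrow>
   (complex \<Rightarrow> complex \<Rightarrow> complex) \<Rightarrow> (complex \<Rightarrow> complex \<Rightarrow> complex) \<Rightarrow> bool" where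
  "cong_ideal2 P1 P2 Q R \<longleftrightarrow> (\<exists>G H. conv_ps2 G \<and> conv_ps2 H \<and>
      germ_eq (\<lambda>x y. Q x y - R x y) (\<lambda>x y. G x y * P1 x y + H x y * P2 x y))"

definition ordc :: "(nat \<Rightarrow> 'a::zero) \<Rightarrow> enat" where
  "ordc a = (if \<forall>n. a n = 0 then \<infinity> else enat (LEAST n. a n \<noteq> 0))"

text \<open>O_{ij} = min (Ord (q_j - q_i), 2 L_j, 2 L_i) (always finite).\<close>
definition Oij :: "(nat \<Rightarrow> nat) \<Rightarrow> (nat \<Rightarrow> real poly) \<Rightarrow> nat \<Rightarrow> nat \<Rightarrow> nat" where
  "Oij L q i j = the_enat (min (ordc (coeff (q j - q i))) (enat (min (2 * L j) (2 * L i))))"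

definition shift_coeffs :: "nat \<Rightarrow> (nat \<Rightarrow> real) \<Rightarrow> nat \<Rightarrow> real" where
  "shift_coeffs k a n = (if k \<le> n then a (n - k) else 0)"

definition Pfun :: "nat \<Rightarrow> (nat \<Rightarrow> nat) \<Rightarrow> (nat \<Rightarrow> real poly) \<Rightarrow> complex \<Rightarrow> complex \<Rightarrow> complex" where
  "Pfun M L q x y = (\<Prod>j<M. y + poly (map_poly complex_of_real (q j)) x + \<i> * x ^ (2 * L j))"

definition Pbar :: "(complex \<Rightarrow> complex \<Rightarrow> complex) \<Rightarrow> complex \<Rightarrow> complex \<Rightarrow> complex" where
  "Pbar P x y = cnj (P (cnj x) (cnj y))"

definition Afun :: "(complex \<Rightarrow> complex \<Rightarrow> complex) \<Rightarrow> complex \<Rightarrow> complex \<Rightarrow> complex" where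
  "Afun P x y = (P x y + Pbar P x y) / 2"

definition Bfun :: "(complex \<Rightarrow> complex \<Rightarrow> complex) \<Rightarrow> complex \<Rightarrow> complex \<Rightarrow> complex" where
  "Bfun P x y = (P x y - Pbar P x y) / (2 * \<i>)"

definition branch_factor :: "(nat \<Rightarrow> nat) \<Rightarrow> (nat \<Rightarrow> real poly) \<Rightarrow> (nat \<Rightarrow> nat \<Rightarrow> real) \<Rightarrow> nat \<Rightarrow> complex \<Rightarrow> complex \<Rightarrow> complex" where
  "branch_factor L q \<psi> j x y = y + poly (map_poly complex_of_real (q j)) x + x ^ (2 * L j) * eval_ps1 (\<psi> j) x"

definition proper_factorization ::
  "nat \<Rightarrow> (nat \<Rightarrow> nat) \<Rightarrow> (nat \<Rightarrow> real poly) \<Rightarrow> real \<Rightarrow>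
   (complex \<Rightarrow> complex \<Rightarrow> complex) \<Rightarrow> (nat \<Rightarrow> nat \<Rightarrow> real) \<Rightarrow> bool" where
  "proper_factorization M L q t u \<psi> \<longleftrightarrow>
     conv_ps2 u \<and> u 0 0 \<noteq> 0 \<and> (\<forall>j<M. conv_ps1_real (\<psi> j)) \<and>
     germ_eq (\<lambda>x y. Afun (Pfun M L q) x y + complex_of_real t * Bfun (Pfun M L q) x y)
             (\<lambda>x y. u x y * (\<Prod>j<M. branch_factor L q \<psi> j x y)) \<and>
     (\<forall>i<M. \<forall>j<M. i \<noteq> j \<longrightarrow>
        ordc (\<lambda>n. coeff (q j - q i) n + shift_coeffs (2 * L j) (\<psi> j) n
                   - shift_coeffs (2 * L i) (\<psi> i) n) = enat (Oij L q i j))"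

definition proper :: "nat \<Rightarrow> (nat \<Rightarrow> nat) \<Rightarrow> (nat \<Rightarrow> real poly) \<Rightarrow> real \<Rightarrow> bool" where
  "proper M L q t \<longleftrightarrow> (\<exists>u \<psi>. proper_factorization M L q t u \<psi>)"

definition Lp_loc :: "real \<Rightarrow> (real \<times> real \<Rightarrow> complex) \<Rightarrow> bool" where
  "Lp_loc p f \<longleftrightarrow> (\<exists>U. open U \<and> (0,0) \<in> U \<and> set_borel_measurable lborel U f \<and>
      set_integrable lborel U (\<lambda>z. norm (f z) powr p))"

end

theory Submission
  imports Defs "HOL-Complex_Analysis.Complex_Analysis"
begin

text \<open>
  The ideal generated by \<open>P\<close> and \<open>Pbar P\<close> equals \<open>(A + tB, B)\<close>, and \<open>A + tB\<close> is a unit times \<open>\<Prod> (y - a\<^sub>j)\<close>.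
  Newton interpolation along the branches \<open>a\<^sub>M, \<dots>, a\<^sub>1\<close> writes every germ modulo \<open>A + tB\<close> as
  \<open>\<Sum> c\<^sub>k F\<^sub>k\<close> with \<open>c\<^sub>k \<in> \<complex>{x}\<close>; in this basis multiplication by \<open>B\<close> is triangular, with
  diagonal entries \<open>B(x, a\<^sub>k)\<close> of order \<open>2L\<^sub>k + \<Sum>\<^bsub>j \<noteq> k\<^esub> O\<^sub>j\<^sub>k\<close> because \<open>P = (\<i> - t)B\<close> on the
  branches. This gives the normal form for every ordering of the branches.

  On real points \<open>\<bar>P\<bar>\<close> is comparable to the product of the \<open>d\<^sub>j = \<bar>y - a\<^sub>j\<bar> + \<bar>x\<bar>\<^bsup>2L\<^sub>j\<^esup>\<close>, so that
  \<open>\<bar>F\<^sub>k / P\<bar>\<close> is at most a constant times the reciprocal of the product of \<open>d\<^sub>1, \<dots>, d\<^sub>k\<close>. Where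
  \<open>d\<^sub>j\<close> is the smallest of these, that reciprocal is at most a constant times
  \<open>1 / (\<bar>x\<bar>\<^bsup>s\<^esup> d\<^sub>j)\<close>, where \<open>s\<close> is the sum of the \<open>O\<^sub>i\<^sub>j\<close> over \<open>i \<le> k\<close>, \<open>i \<noteq> j\<close>. The term
  \<open>c\<^sub>k F\<^sub>k / P\<close> of the asserted order is therefore in \<open>L\<^sup>p\<close> as soon as \<open>k\<close> maximises
  \<open>\<lfloor>(2L\<^sub>k + 1)(1 - 1/p)\<rfloor> + \<Sum> O\<^sub>i\<^sub>k\<close> among the first \<open>k\<close> indices, and such a relabeling is found
  greedily, choosing the last index first. Conversely, near the branch \<open>a\<^sub>M\<close> only \<open>c\<^sub>M\<close> survives; a
  polynomial in \<open>y\<close> is controlled at \<open>a\<^sub>M\<close> by its values at nearby equidistant points, so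
  integrability forces the order of \<open>c\<^sub>M\<close>. Subtracting \<open>c\<^sub>M F\<^sub>M\<close> and descending gives the claim.
\<close>

section \<open>Holomorphic germs in two variables\<close>

text \<open>The branches of A + tB, unlike those of P, are real over real x, so the curves near
  which \<open>F k / P\<close> is large lie in the domain of integration. Two obstacles shape the
  rest. First, c_k is isolated only on the curve y = a_k, a null set, so its size has to be read off
  from an open neighbourhood of width about |x|^(2L_k); this is why interpolation in y appears.
  Second, the descent may subtract c_k F_k only if this term lies in L^p by itself, so sufficiency
  is needed term by term, and only that single-term estimate depends on the ordering. The number
  floor((2L + 1)(1 - 1/p)) comes from the model |x|^e / (|y| + |x|^(2L)): integrating its p-th power
  in y leaves |x|^(pe - 2L(p - 1)), up to a logarithm when p = 1. This is integrable at 0 iff e >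
  (2L + 1)(1 - 1/p) - 1, and the floor is the least such integer. The additional sum of O_jk over j
  < k pays for the factors of P with index below k, which stay in the denominator of F_k / P; those
  with index above k are compensated by F_k.\<close>

text \<open>Requiring holomorphy along all holomorphic curves, not only separately in each variable, makes
  substitution \<open>y := a(x, y)\<close> immediate.\<close>

definition hol2_on :: "real \<Rightarrow> (complex \<Rightarrow> complex \<Rightarrow> complex) \<Rightarrow> bool" where
  "hol2_on r f \<longleftrightarrow> continuous_on (ball 0 r \<times> ball 0 r) (\<lambda>(x,y). f x y) \<and>
     (\<forall>S g h. open S \<longrightarrow> g holomorphic_on S \<longrightarrow> h holomorphic_on S \<longrightarrow>
        g ` S \<subseteq> ball 0 r \<longrightarrow> h ` S \<subseteq> ball 0 r \<longrightarrow> (\<lambda>z. f (g z) (h z)) holomorphic_on S)"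

lemma hol2_onI:
  assumes "continuous_on (ball 0 r \<times> ball 0 r) (\<lambda>(x,y). f x y)"
    and "\<And>S g h. open S \<Longrightarrow> g holomorphic_on S \<Longrightarrow> h holomorphic_on S \<Longrightarrow>
        g ` S \<subseteq> ball 0 r \<Longrightarrow> h ` S \<subseteq> ball 0 r \<Longrightarrow> (\<lambda>z. f (g z) (h z)) holomorphic_on S"
  shows "hol2_on r f"
  using assms unfolding hol2_on_def by blast

lemma hol2_on_continuous: "hol2_on r f \<Longrightarrow> continuous_on (ball 0 r \<times> ball 0 r) (\<lambda>(x,y). f x y)"
  unfolding hol2_on_def by blast

lemma hol2_on_curve:
  assumes "hol2_on r f" "open S" "g holomorphic_on S" "h holomorphic_on S"
    "g ` S \<subseteq> ball 0 r" "h ` S \<subseteq> ball 0 r"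
  shows "(\<lambda>z. f (g z) (h z)) holomorphic_on S"
  using assms unfolding hol2_on_def by blast

lemma hol2_on_mono:
  assumes "hol2_on r f" "s \<le> r" shows "hol2_on s f"
proof (rule hol2_onI)
  have "ball 0 s \<subseteq> (ball 0 r :: complex set)" using assms(2) by auto
  then show "continuous_on (ball 0 s \<times> ball 0 s) (\<lambda>(x,y). f x y)"
    using hol2_on_continuous[OF assms(1)] by (meson Sigma_mono continuous_on_subset)
  fix S g h assume "open S" "g holomorphic_on S" "h holomorphic_on S" "g ` S \<subseteq> ball 0 s" "h ` S \<subseteq> ball 0 s"
  with \<open>ball 0 s \<subseteq> (ball 0 r :: complex set)\<close> show "(\<lambda>z. f (g z) (h z)) holomorphic_on S"
    by (intro hol2_on_curve[OF assms(1)]) auto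
qed

lemma taylor_coeff_bound:
  assumes f: "f holomorphic_on ball 0 r" and \<rho>: "0 < \<rho>" "\<rho> < r" and K: "\<And>x. norm x \<le> \<rho> \<Longrightarrow> norm (f x) \<le> K"
  shows "norm ((deriv ^^ n) f 0 / fact n) \<le> K / \<rho> ^ n"
proof -
  have "norm ((deriv ^^ n) f 0) \<le> fact n * K / \<rho> ^ n"
  proof (rule Cauchy_inequality)
    show "f holomorphic_on ball 0 \<rho>" by (rule holomorphic_on_subset[OF f]) (use \<rho> in auto)
    show "continuous_on (cball 0 \<rho>) f"
      by (rule holomorphic_on_imp_continuous_on[OF holomorphic_on_subset[OF f]]) (use \<rho> in auto)
  qed (use \<rho> K in auto)
  then show ?thesis by (simp add: norm_divide field_simps)
qed

text \<open>The tail is compared with a geometric series of ratio |x|/\<rho> \<le> 1/2, whose sum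
  gives the factor 2.\<close>

lemma power_series_remainder_bound:
  fixes a :: "nat \<Rightarrow> complex"
  assumes a: "\<And>k. norm (a k) \<le> K / \<rho> ^ k" and "\<rho> > 0" and x: "norm x \<le> \<rho> / 2"
    and s: "(\<lambda>k. a k * x ^ k) sums s"
  shows "norm (s - (\<Sum>k<N. a k * x ^ k)) \<le> 2 * K * (norm x / \<rho>) ^ N"
proof -
  have K: "K \<ge> 0" using order_trans[OF norm_ge_zero a[of 0]] by simp
  have *: "(\<lambda>k. a (k + N) * x ^ (k + N)) sums (s - (\<Sum>k<N. a k * x ^ k))"
    using sums_split_initial_segment[OF s] by simp
  have "(\<lambda>k. (1/2::real) ^ k) sums (1 / (1 - 1/2))" by (rule geometric_sums) simp
  then have "(\<lambda>k. (K * (norm x / \<rho>) ^ N) * (1/2) ^ k) sums ((K * (norm x / \<rho>) ^ N) * 2)"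
    using sums_mult[of "\<lambda>k. (1/2::real) ^ k"] by simp
  moreover have "norm (a (k + N) * x ^ (k + N)) \<le> (K * (norm x / \<rho>) ^ N) * (1/2) ^ k" for k
  proof -
    have "norm (a (k + N) * x ^ (k + N)) \<le> K / \<rho> ^ (k + N) * norm x ^ (k + N)"
      unfolding norm_mult norm_power by (intro mult_right_mono a) auto
    also have "\<dots> = K * (norm x / \<rho>) ^ N * (norm x / \<rho>) ^ k"
      by (simp add: power_add power_divide field_simps)
    also have "\<dots> \<le> K * (norm x / \<rho>) ^ N * (1/2) ^ k"
      using assms K by (intro mult_left_mono power_mono) (auto simp: field_simps)
    finally show ?thesis .
  qed
  ultimately have "norm (s - (\<Sum>k<N. a k * x ^ k)) \<le> (K * (norm x / \<rho>) ^ N) * 2"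
    using norm_sums_le[OF *] by blast
  then show ?thesis by simp
qed

text \<open>Summability in the complex numbers is absolute, so convergence at the single point
  (\<rho>, \<rho>) majorises the series on the bidisc. The finite partial sums then converge
  uniformly, also after substituting a curve (g, h), and uniform limits of holomorphic functions are
  holomorphic.\<close>

lemma conv_ps2_imp_hol2_on:
  assumes "conv_ps2 f" obtains r where "r > 0" "hol2_on r f"
proof -
  obtain r c where r: "r > 0" and c: "\<And>x y. norm x < r \<Longrightarrow> norm y < r \<Longrightarrow>
        ((\<lambda>(m,n). c m n * x ^ m * y ^ n) has_sum f x y) UNIV"
    using assms unfolding conv_ps2_def by blast
  define \<rho> where "\<rho> = r / 2"
  have \<rho>: "0 < \<rho>" "\<rho> < r" using r by (auto simp: \<rho>_def)
  have "(\<lambda>(m,n). c m n * complex_of_real \<rho> ^ m * complex_of_real \<rho> ^ n) summable_on UNIV"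
    using c[of "complex_of_real \<rho>" "complex_of_real \<rho>"] \<rho> by (auto simp: summable_on_def)
  then have sm: "(\<lambda>(m,n). norm (c m n) * \<rho> ^ m * \<rho> ^ n) summable_on UNIV"
    using \<rho> by (subst (asm) summable_on_iff_abs_summable_on_complex)
               (simp add: norm_mult norm_power case_prod_unfold)
  have ul: "uniform_limit (ball 0 \<rho> \<times> ball 0 \<rho>) (\<lambda>X z. \<Sum>(m,n)\<in>X. c m n * fst z ^ m * snd z ^ n)
     (\<lambda>z. f (fst z) (snd z)) (finite_subsets_at_top UNIV)"
  proof (rule Weierstrass_m_test_general'[OF _ _ sm])
    fix mn :: "nat \<times> nat" and z :: "complex \<times> complex" assume "z \<in> ball 0 \<rho> \<times> ball 0 \<rho>"
    then show "norm (case mn of (m,n) \<Rightarrow> c m n * fst z ^ m * snd z ^ n)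
        \<le> (case mn of (m, n) \<Rightarrow> norm (c m n) * \<rho> ^ m * \<rho> ^ n)"
      using \<rho> by (auto simp: norm_mult norm_power split: prod.split intro!: mult_mono power_mono)
  next
    fix z :: "complex \<times> complex" assume "z \<in> ball 0 \<rho> \<times> ball 0 \<rho>"
    then have "norm (fst z) < r" "norm (snd z) < r" using \<rho> by auto
    then show "((\<lambda>mn. case mn of (m,n) \<Rightarrow> c m n * fst z ^ m * snd z ^ n) has_sum f (fst z) (snd z)) UNIV"
      using c by blast
  qed
  have "hol2_on \<rho> f"
  proof (rule hol2_onI)
    have "continuous_on (ball 0 \<rho> \<times> ball 0 \<rho>) (\<lambda>z. f (fst z) (snd z))"
      by (rule uniform_limit_theorem[OF _ ul])
         (auto intro!: always_eventually continuous_intros simp: case_prod_unfold)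
    then show "continuous_on (ball 0 \<rho> \<times> ball 0 \<rho>) (\<lambda>(x,y). f x y)"
      by (simp add: case_prod_unfold)
  next
    fix S g h assume S: "open S" and g: "g holomorphic_on S" and h: "h holomorphic_on S"
      and gS: "g ` S \<subseteq> ball 0 \<rho>" and hS: "h ` S \<subseteq> ball 0 \<rho>"
    have "\<exists>d>0. ball z d \<subseteq> S \<and> (\<lambda>z. f (g z) (h z)) holomorphic_on ball z d" if "z \<in> S" for z
    proof -
      obtain d where d: "d > 0" "cball z d \<subseteq> S" using S \<open>z \<in> S\<close> open_contains_cball by blast
      have gd: "g holomorphic_on cball z d" "h holomorphic_on cball z d"
        using g h d(2) holomorphic_on_subset by blast+
      have im: "g w \<in> ball 0 \<rho>" "h w \<in> ball 0 \<rho>" if "w \<in> cball z d" for w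
        using that gS hS d(2) by blast+
      have "uniform_limit (cball z d) (\<lambda>X w. (\<lambda>X z. \<Sum>(m,n)\<in>X. c m n * fst z ^ m * snd z ^ n) X (g w, h w))
            (\<lambda>w. (\<lambda>z. f (fst z) (snd z)) (g w, h w)) (finite_subsets_at_top UNIV)"
        by (rule uniform_limit_compose'[OF ul]) (use im in auto)
      then have "uniform_limit (cball z d) (\<lambda>X w. \<Sum>(m,n)\<in>X. c m n * g w ^ m * h w ^ n)
            (\<lambda>w. f (g w) (h w)) (finite_subsets_at_top UNIV)" by simp
      then have "(\<lambda>w. f (g w) (h w)) holomorphic_on ball z d"
        by (rule holomorphic_uniform_limit[rotated])
           (use gd in \<open>auto intro!: always_eventually continuous_intros holomorphic_intros
              holomorphic_on_imp_continuous_on simp: case_prod_unfold intro: holomorphic_on_subset\<close>)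
      then show ?thesis using d by (meson ball_subset_cball order_trans)
    qed
    then show "(\<lambda>z. f (g z) (h z)) holomorphic_on S"
      by (metis S analytic_imp_holomorphic analytic_on_def)
  qed
  with \<rho> that show thesis by blast
qed

lemma summable_geometric_product:
  fixes a b :: real
  assumes "0 \<le> a" "a < 1" "0 \<le> b" "b < 1"
  shows "(\<lambda>(m::nat,n::nat). K * a ^ m * b ^ n) summable_on UNIV"
proof -
  have geo: "((\<lambda>n. b ^ n) has_sum (1 / (1 - b))) (UNIV::nat set)" if "0 \<le> b" "b < 1" for b :: real
    using that by (intro norm_summable_imp_has_sum geometric_sums) (auto intro!: summable_geometric)
  have "(\<lambda>(m::nat,n::nat). a ^ m * b ^ n) summable_on (UNIV \<times> UNIV)"
  proof (rule summable_on_SigmaI)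
    show "((\<lambda>y. case (m, y) of (m, n) \<Rightarrow> a ^ m * b ^ n) has_sum (a ^ m * (1 / (1 - b)))) UNIV" for m :: nat
      using has_sum_cmult_right[OF geo[OF assms(3,4)], of "a ^ m"] by simp
    show "(\<lambda>m. a ^ m * (1 / (1 - b))) summable_on (UNIV::nat set)"
      using has_sum_cmult_left[OF geo[OF assms(1,2)], of "1/(1-b)"] by (auto simp: summable_on_def)
  qed (use assms in auto)
  from summable_on_cmult_right[OF this, of K] show ?thesis
    by (simp add: case_prod_unfold mult.assoc)
qed

text \<open>Iterated expansion: in x with coefficients \<open>A m\<close> depending on y, then each
  \<open>A m\<close> in y. Cauchy's inequality, used twice, gives |c m n| \<le> K / (\<rho>^m
  \<tau>^n), and this geometric majorant merges both expansions into one absolutely convergent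
  double series. The radius shrinks from r to \<rho> to \<tau> because each use needs a strictly
  larger disc of holomorphy.\<close>

lemma hol2_on_imp_conv_ps2:
  assumes r: "r > 0" and f: "hol2_on r f"
  shows "conv_ps2 f"
proof -
  define \<rho> where "\<rho> = r / 2"
  have \<rho>: "0 < \<rho>" "\<rho> < r" using r by (auto simp: \<rho>_def)
  have "compact ((\<lambda>(x,y). f x y) ` (cball 0 \<rho> \<times> cball 0 \<rho>))"
    using \<rho> by (intro compact_continuous_image continuous_on_subset[OF hol2_on_continuous[OF f]]
        compact_Times compact_cball) auto
  then obtain K where "\<forall>z \<in> (\<lambda>(x,y). f x y) ` (cball 0 \<rho> \<times> cball 0 \<rho>). norm z \<le> K"
    using compact_imp_bounded bounded_iff by metis
  then have K: "norm (f x y) \<le> K" if "norm x \<le> \<rho>" "norm y \<le> \<rho>" for x y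
    using that by force
  have holx: "(\<lambda>x. f x y) holomorphic_on ball 0 r" if "norm y < r" for y
    using hol2_on_curve[OF f, of "ball 0 r" "\<lambda>x. x" "\<lambda>x. y"] that by (auto simp: image_subset_iff)
  have holy: "(\<lambda>y. f x y) holomorphic_on ball 0 r" if "norm x < r" for x
    using hol2_on_curve[OF f, of "ball 0 r" "\<lambda>_. x" "\<lambda>y. y"] that by (auto simp: image_subset_iff)
  define A where "A = (\<lambda>m y. (deriv ^^ m) (\<lambda>x. f x y) 0 / fact m)"
  have Asums: "(\<lambda>m. A m y * x ^ m) sums f x y" if "norm x < r" "norm y < r" for x y
    using holomorphic_power_series[OF holx[OF that(2)], of x] that by (simp add: A_def)
  have Abound: "norm (A m y) \<le> K / \<rho> ^ m" if "norm y \<le> \<rho>" for m y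
    unfolding A_def using that \<rho> K by (intro taylor_coeff_bound[OF holx]) auto
  \<comment> \<open>The coefficient \<open>A m\<close> is the uniform limit of the divided Taylor remainders at \<open>x = \<rho> / (2 + j)\<close>.\<close>
  have Ahol: "A m holomorphic_on ball 0 \<rho>" for m
  proof (induction m rule: less_induct)
    case (less m)
    define x where "x = (\<lambda>j::nat. complex_of_real (\<rho> / (2 + real j)))"
    have x: "x j \<noteq> 0" "norm (x j) \<le> \<rho> / 2" "norm (x j) = \<rho> / (2 + real j)" for j
      using \<rho> by (auto simp: x_def norm_divide field_simps simp flip: of_real_add of_real_divide)
    define g where "g = (\<lambda>j y. (f (x j) y - (\<Sum>k<m. A k y * x j ^ k)) / x j ^ m)"
    have bnd: "norm (g j y - A m y) \<le> 2 * K / \<rho> ^ m * (1 / (2 + real j))" if "norm y < \<rho>" for j y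
    proof -
      have xr: "norm (x j) < r" using x(2)[of j] \<rho> by auto
      have "norm (f (x j) y - (\<Sum>k<Suc m. A k y * x j ^ k)) \<le> 2 * K * (norm (x j) / \<rho>) ^ Suc m"
        by (rule power_series_remainder_bound[OF _ _ _ Asums[OF xr]]) (use Abound that x(2) \<rho> in auto)
      moreover have "g j y - A m y = (f (x j) y - (\<Sum>k<Suc m. A k y * x j ^ k)) / x j ^ m"
        using x(1)[of j] by (simp add: g_def field_simps)
      ultimately have "norm (g j y - A m y) \<le> 2 * K * (norm (x j) / \<rho>) ^ Suc m / norm (x j) ^ m"
        by (simp only: norm_divide norm_power) (rule divide_right_mono, auto)
      also have "\<dots> = 2 * K / \<rho> ^ m * (norm (x j) / \<rho>)"
        using x(1)[of j] \<rho> by (simp add: field_simps power_divide)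
      also have "norm (x j) / \<rho> = 1 / (2 + real j)" using x(3)[of j] \<rho> by simp
      finally show ?thesis .
    qed
    have lim: "(\<lambda>j. 2 * K / \<rho> ^ m * (1 / (2 + real j))) \<longlonglongrightarrow> 0"
      by real_asymp
    have ul: "uniform_limit (ball 0 \<rho>) g (A m) sequentially"
    proof (rule uniform_limitI)
      fix e :: real assume "e > 0"
      with lim have "\<forall>\<^sub>F j in sequentially. 2 * K / \<rho> ^ m * (1 / (2 + real j)) < e"
        by (rule order_tendstoD)
      then show "\<forall>\<^sub>F j in sequentially. \<forall>y\<in>ball 0 \<rho>. dist (g j y) (A m y) < e"
      proof (rule eventually_mono, intro ballI)
        fix j :: nat and y :: complex assume "2 * K / \<rho> ^ m * (1 / (2 + real j)) < e" "y \<in> ball 0 \<rho>"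
        then show "dist (g j y) (A m y) < e"
          using bnd[of y j] unfolding dist_norm mem_ball_0 by linarith
      qed
    qed
    show ?case
    proof (rule holomorphic_uniform_sequence[where f = g])
      fix j
      have "norm (x j) < r" using x(2)[of j] \<rho> by auto
      from holy[OF this] have "f (x j) holomorphic_on ball 0 \<rho>"
        using holomorphic_on_subset \<rho> by (metis less_imp_le subset_ball)
      then show "g j holomorphic_on ball 0 \<rho>"
        unfolding g_def using less x(1)[of j] by (intro holomorphic_intros) auto
    next
      fix y :: complex assume "y \<in> ball 0 \<rho>"
      then obtain d where "d > 0" "cball y d \<subseteq> ball 0 \<rho>" using open_ball open_contains_cball by blast
      then show "\<exists>d>0. cball y d \<subseteq> ball 0 \<rho> \<and> uniform_limit (cball y d) g (A m) sequentially"
        using uniform_limit_on_subset[OF ul] by blast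
    qed auto
  qed
  define c where "c = (\<lambda>m n. (deriv ^^ n) (A m) 0 / fact n)"
  define \<tau> where "\<tau> = \<rho> / 2"
  have \<tau>: "0 < \<tau>" "\<tau> < \<rho>" using \<rho> by (auto simp: \<tau>_def)
  have csums: "(\<lambda>n. c m n * y ^ n) sums A m y" if "norm y < \<tau>" for m y
    using holomorphic_power_series[OF Ahol[of m], of y] that \<tau> by (simp add: c_def)
  have cbound: "norm (c m n) \<le> K / \<rho> ^ m / \<tau> ^ n" for m n
    unfolding c_def using \<tau> Abound by (intro taylor_coeff_bound[OF Ahol]) auto
  have "((\<lambda>(m,n). c m n * x ^ m * y ^ n) has_sum f x y) UNIV" if xy: "norm x < \<tau>" "norm y < \<tau>" for x y
  proof -
    have sm: "(\<lambda>(m,n). c m n * x ^ m * y ^ n) summable_on (UNIV \<times> UNIV)"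
    proof (subst summable_on_iff_abs_summable_on_complex, rule Infinite_Sum.abs_summable_on_comparison_test')
      show "(\<lambda>(m,n). K * (norm x / \<rho>) ^ m * (norm y / \<tau>) ^ n) summable_on (UNIV \<times> UNIV)"
        using summable_geometric_product[of "norm x / \<rho>" "norm y / \<tau>" K] xy \<rho> \<tau> by simp
      fix mn :: "nat \<times> nat"
      obtain m n where mn: "mn = (m, n)" by fastforce
      have "norm (c m n * x ^ m * y ^ n) \<le> K / \<rho> ^ m / \<tau> ^ n * norm x ^ m * norm y ^ n"
        unfolding norm_mult norm_power by (intro mult_right_mono cbound) auto
      then show "norm (case mn of (m, n) \<Rightarrow> c m n * x ^ m * y ^ n)
          \<le> (case mn of (m, n) \<Rightarrow> K * (norm x / \<rho>) ^ m * (norm y / \<tau>) ^ n)"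
        by (simp add: mn power_divide field_simps)
    qed
    have "((\<lambda>(m,n). c m n * x ^ m * y ^ n) has_sum f x y) (UNIV \<times> UNIV)"
    proof (rule has_sum_SigmaI[OF _ _ sm])
      have inner: "summable (\<lambda>n. norm (c m n * y ^ n))" for m
      proof (rule summable_comparison_test')
        show "summable (\<lambda>n. K / \<rho> ^ m * (norm y / \<tau>) ^ n)"
          using xy \<tau> by (intro summable_mult summable_geometric) auto
        show "norm (norm (c m n * y ^ n)) \<le> K / \<rho> ^ m * (norm y / \<tau>) ^ n" for n
          using mult_right_mono[OF cbound[of m n], of "norm y ^ n"]
          by (simp add: norm_mult norm_power power_divide field_simps)
      qed
      show "((\<lambda>n. case (m, n) of (m, n) \<Rightarrow> c m n * x ^ m * y ^ n) has_sum A m y * x ^ m) UNIV" for m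
        using has_sum_cmult_left[OF norm_summable_imp_has_sum[OF inner csums[OF xy(2)]], of m "x ^ m"]
        by (simp add: mult_ac)
      have xr: "norm x < r" "norm y < r" "norm y \<le> \<rho>" using xy \<tau> \<rho> by auto
      show "((\<lambda>m. A m y * x ^ m) has_sum f x y) UNIV"
      proof (rule norm_summable_imp_has_sum[OF _ Asums[OF xr(1,2)]], rule summable_comparison_test')
        show "summable (\<lambda>m. K * (norm x / \<rho>) ^ m)"
          using xy \<tau> \<rho> by (intro summable_mult summable_geometric) auto
        show "norm (norm (A m y * x ^ m)) \<le> K * (norm x / \<rho>) ^ m" for m
          using mult_right_mono[OF Abound[OF xr(3), of m], of "norm x ^ m"]
          by (simp add: norm_mult norm_power power_divide field_simps)
      qed
    qed
    then show ?thesis by simp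
  qed
  with \<tau> show ?thesis unfolding conv_ps2_def by blast
qed

section \<open>Germs at the origin and their closure properties\<close>

lemma eventually_nhds_bidisc:
  "eventually P (nhds (0::complex, 0::complex)) \<longleftrightarrow>
     (\<exists>r>0. \<forall>x y. norm x < r \<longrightarrow> norm y < r \<longrightarrow> P (x, y))"
proof
  assume "eventually P (nhds (0::complex, 0::complex))"
  then obtain d where d: "d > 0" "\<And>z. dist z (0,0) < d \<Longrightarrow> P z"
    unfolding eventually_nhds_metric by blast
  have "P (x, y)" if "norm x < d / 2" "norm y < d / 2" for x y
  proof (rule d(2))
    have "dist (x, y) (0, 0) \<le> norm x + norm y"
      by (simp add: dist_Pair_Pair sqrt_sum_squares_le_sum)
    then show "dist (x, y) (0, 0) < d" using that by simp
  qed
  then show "\<exists>r>0. \<forall>x y. norm x < r \<longrightarrow> norm y < r \<longrightarrow> P (x, y)"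
    using d(1) by (intro exI[of _ "d/2"]) auto
next
  assume "\<exists>r>0. \<forall>x y. norm x < r \<longrightarrow> norm y < r \<longrightarrow> P (x, y)"
  then obtain r where r: "r > 0" "\<And>x y. norm x < r \<Longrightarrow> norm y < r \<Longrightarrow> P (x, y)" by blast
  have "open (ball (0::complex) r \<times> ball (0::complex) r)" by (intro open_Times) auto
  then show "eventually P (nhds (0::complex, 0::complex))"
    using r by (intro eventually_nhds[THEN iffD2] exI[of _ "ball 0 r \<times> ball 0 r"]) auto
qed

lemma germ_eq_iff: "germ_eq f g \<longleftrightarrow> (\<forall>\<^sub>F (x,y) in nhds (0,0). f x y = g x y)"
  unfolding germ_eq_def eventually_nhds_bidisc by simp

lemma eventually_nhds_prod_fst:
  assumes "eventually P (nhds (0::complex))"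
  shows "\<forall>\<^sub>F (x,y) in nhds (0::complex, 0::complex). P x"
proof -
  from assms obtain d where "d > 0" "\<And>x. dist x 0 < d \<Longrightarrow> P x" unfolding eventually_nhds_metric by blast
  then show ?thesis unfolding eventually_nhds_bidisc by auto
qed

lemma eventually_restrict_fst:
  assumes "\<forall>\<^sub>F (x,y) in nhds (0::complex, 0::complex). P x" shows "\<forall>\<^sub>F x in nhds 0. P x"
proof -
  obtain r where r: "r > 0" "\<forall>x y::complex. norm x < r \<longrightarrow> norm y < r \<longrightarrow> P x"
    using assms unfolding eventually_nhds_bidisc prod.case by blast
  have "P x" if "norm x < r" for x using r(2)[rule_format, of x 0] r(1) that by simp
  then show ?thesis unfolding eventually_nhds_metric using r(1) by auto
qed

lemma conv_ps2_iff: "conv_ps2 f \<longleftrightarrow> (\<exists>r>0. hol2_on r f)"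
  by (meson conv_ps2_imp_hol2_on hol2_on_imp_conv_ps2)

lemma conv_ps2_const [simp]: "conv_ps2 (\<lambda>x y. k)"
  and conv_ps2_fst [simp]: "conv_ps2 (\<lambda>x y. x)"
  and conv_ps2_snd [simp]: "conv_ps2 (\<lambda>x y. y)"
  unfolding conv_ps2_iff
  by (intro exI[of _ 1] conjI hol2_onI; simp add: case_prod_unfold continuous_intros)+

lemma conv_ps2_add [intro]: "conv_ps2 f \<Longrightarrow> conv_ps2 g \<Longrightarrow> conv_ps2 (\<lambda>x y. f x y + g x y)"
  and conv_ps2_diff [intro]: "conv_ps2 f \<Longrightarrow> conv_ps2 g \<Longrightarrow> conv_ps2 (\<lambda>x y. f x y - g x y)"
  and conv_ps2_mult [intro]: "conv_ps2 f \<Longrightarrow> conv_ps2 g \<Longrightarrow> conv_ps2 (\<lambda>x y. f x y * g x y)"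
proof -
  assume "conv_ps2 f" "conv_ps2 g"
  then obtain r s where rs: "r > 0" "s > 0" and *: "hol2_on r f" "hol2_on s g"
    unfolding conv_ps2_iff by blast
  define t where "t = min r s"
  have t: "t > 0" "hol2_on t f" "hol2_on t g"
    using rs hol2_on_mono[OF *(1), of t] hol2_on_mono[OF *(2), of t] by (auto simp: t_def)
  note c = hol2_on_continuous[OF t(2), unfolded case_prod_unfold] hol2_on_continuous[OF t(3), unfolded case_prod_unfold]
  note h = hol2_on_curve[OF t(2)] hol2_on_curve[OF t(3)]
  show "conv_ps2 (\<lambda>x y. f x y + g x y)" "conv_ps2 (\<lambda>x y. f x y - g x y)" "conv_ps2 (\<lambda>x y. f x y * g x y)"
    unfolding conv_ps2_iff
    by (intro exI[of _ t] conjI hol2_onI t; simp add: case_prod_unfold c h continuous_intros holomorphic_intros)+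
qed

lemma conv_ps2_minus [intro]: "conv_ps2 f \<Longrightarrow> conv_ps2 (\<lambda>x y. - f x y)"
  using conv_ps2_diff[of "\<lambda>x y. 0" f] by simp

lemma conv_ps2_sum [intro]: "(\<And>i. i \<in> I \<Longrightarrow> conv_ps2 (f i)) \<Longrightarrow> conv_ps2 (\<lambda>x y. \<Sum>i\<in>I. f i x y)"
  by (induction I rule: infinite_finite_induct) auto

lemma conv_ps2_prod [intro]: "(\<And>i. i \<in> I \<Longrightarrow> conv_ps2 (f i)) \<Longrightarrow> conv_ps2 (\<lambda>x y. \<Prod>i\<in>I. f i x y)"
  by (induction I rule: infinite_finite_induct) auto

lemma conv_ps2_power [intro]: "conv_ps2 f \<Longrightarrow> conv_ps2 (\<lambda>x y. f x y ^ n)"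
  by (induction n) auto

lemma conv_ps2_poly [intro]: "conv_ps2 (\<lambda>x y. poly p x)"
  by (induction p) (auto intro!: conv_ps2_add conv_ps2_mult conv_ps2_const conv_ps2_fst)

lemmas conv_ps2_intros = conv_ps2_const conv_ps2_fst conv_ps2_snd conv_ps2_add conv_ps2_diff
  conv_ps2_mult conv_ps2_minus conv_ps2_sum conv_ps2_prod conv_ps2_power conv_ps2_poly

lemma conv_ps2_holomorphic:
  assumes "r > 0" "a holomorphic_on ball 0 r" shows "conv_ps2 (\<lambda>x y. a x)"
  unfolding conv_ps2_iff
proof (intro exI[of _ r] conjI hol2_onI assms(1))
  show "continuous_on (ball 0 r \<times> ball 0 r) (\<lambda>(x,y). a x)"
    unfolding case_prod_unfold
    by (rule continuous_on_compose2[OF holomorphic_on_imp_continuous_on[OF assms(2)]])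
       (auto intro!: continuous_intros)
  fix S and g h :: "complex \<Rightarrow> complex" assume "g holomorphic_on S" "g ` S \<subseteq> ball 0 r"
  then show "(\<lambda>z. a (g z)) holomorphic_on S"
    using holomorphic_on_compose_gen[OF _ assms(2), of g S] by (simp add: o_def)
qed

text \<open>Meant for germs of the form \<open>\<lambda>x y. a x\<close>, where it returns the
  one-variable function; a converse to \<open>conv_ps2_holomorphic\<close>.\<close>

lemma conv_ps2_restrict:
  assumes "conv_ps2 f" obtains r where "r > 0" "(\<lambda>x. f x 0) holomorphic_on ball 0 r"
proof -
  obtain r where "r > 0" "hol2_on r f" using assms conv_ps2_iff by blast
  with hol2_on_curve[OF this(2), of "ball 0 r" "\<lambda>x. x" "\<lambda>x. 0"] that show thesis
    by (auto simp: image_subset_iff)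
qed

lemma conv_ps2_tendsto:
  assumes "conv_ps2 f" shows "((\<lambda>(x,y). f x y) \<longlongrightarrow> f 0 0) (nhds (0,0))"
proof -
  obtain r where r: "r > 0" "hol2_on r f" using assms conv_ps2_iff by blast
  have "isCont (\<lambda>(x,y). f x y) (0,0)"
    using r by (intro continuous_on_interior[OF hol2_on_continuous[OF r(2)]]) (auto simp: interior_Times)
  then show ?thesis
    using tendsto_at_iff_tendsto_nhds[of "\<lambda>(x,y). f x y" "(0,0)"] by (simp add: isCont_def)
qed

lemma conv_ps2_near:
  assumes "conv_ps2 f" "e > 0" shows "\<forall>\<^sub>F (x,y) in nhds (0,0). norm (f x y - f 0 0) < e"
  using tendstoD[OF conv_ps2_tendsto[OF assms(1)] assms(2)] by (simp add: case_prod_unfold dist_norm)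

lemma conv_ps2_bounded:
  assumes "conv_ps2 f" obtains K where "K > 0" "\<forall>\<^sub>F (x,y) in nhds (0,0). norm (f x y) \<le> K"
proof -
  have "\<forall>\<^sub>F (x,y) in nhds (0,0). norm (f x y) \<le> norm (f 0 0) + 1"
    using conv_ps2_near[OF assms zero_less_one]
    by (rule eventually_mono) (auto, smt (verit) norm_triangle_sub)
  then show thesis using that[of "norm (f 0 0) + 1"] by (smt (verit) norm_ge_zero)
qed

lemma conv_ps2_compose:
  assumes f: "conv_ps2 f" and a: "conv_ps2 a" "a 0 0 = 0"
  shows "conv_ps2 (\<lambda>x y. f x (a x y))"
proof -
  obtain r where r: "r > 0" "hol2_on r f" using f conv_ps2_iff by blast
  obtain s where s: "s > 0" "hol2_on s a" using a conv_ps2_iff by blast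
  obtain d where d: "d > 0" "\<And>x y. norm x < d \<Longrightarrow> norm y < d \<Longrightarrow> norm (a x y) < r"
    using conv_ps2_near[OF a(1) r(1)] a(2) unfolding eventually_nhds_bidisc by auto
  define t where "t = min r (min s d)"
  have t: "t > 0" "t \<le> r" "t \<le> s" "t \<le> d" using r s d by (auto simp: t_def)
  have at: "hol2_on t a" using hol2_on_mono[OF s(2) t(3)] .
  show ?thesis unfolding conv_ps2_iff
  proof (intro exI[of _ t] conjI hol2_onI t)
    have "continuous_on (ball 0 t \<times> ball 0 t) (\<lambda>z. (\<lambda>(x,y). f x y) (fst z, a (fst z) (snd z)))"
    proof (rule continuous_on_compose2[OF hol2_on_continuous[OF r(2)]])
      show "continuous_on (ball 0 t \<times> ball 0 t) (\<lambda>z. (fst z, a (fst z) (snd z)))"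
        using hol2_on_continuous[OF at] by (auto simp: case_prod_unfold intro!: continuous_intros)
    qed (use d t in force)
    then show "continuous_on (ball 0 t \<times> ball 0 t) (\<lambda>(x,y). f x (a x y))" by (simp add: case_prod_unfold)
    fix S g h assume S: "open S" "g holomorphic_on S" "h holomorphic_on S" "g ` S \<subseteq> ball 0 t" "h ` S \<subseteq> ball 0 t"
    show "(\<lambda>z. f (g z) (a (g z) (h z))) holomorphic_on S"
    proof (rule hol2_on_curve[OF r(2)])
      show "(\<lambda>z. a (g z) (h z)) holomorphic_on S" using hol2_on_curve[OF at S] .
      have "norm (g z) < t" "norm (h z) < t" if "z \<in> S" for z using S(4,5) that by auto
      then have "norm (g z) < r" "norm (a (g z) (h z)) < r" if "z \<in> S" for z
        using that d(2) t by (meson order_less_le_trans)+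
      then show "g ` S \<subseteq> ball 0 r" "(\<lambda>z. a (g z) (h z)) ` S \<subseteq> ball 0 r" by auto
    qed (use S in auto)
  qed
qed

lemma conv_ps2_inverse:
  assumes f: "conv_ps2 f" "f 0 0 \<noteq> 0"
  shows "conv_ps2 (\<lambda>x y. inverse (f x y))"
proof -
  obtain r where r: "r > 0" "hol2_on r f" using f conv_ps2_iff by blast
  obtain d where d: "d > 0" "\<And>x y. norm x < d \<Longrightarrow> norm y < d \<Longrightarrow> norm (f x y - f 0 0) < norm (f 0 0)"
    using conv_ps2_near[OF f(1), of "norm (f 0 0)"] f(2) unfolding eventually_nhds_bidisc by auto
  define t where "t = min r d"
  have t: "t > 0" "t \<le> r" "t \<le> d" using r d by (auto simp: t_def)
  have ft: "hol2_on t f" using hol2_on_mono[OF r(2) t(2)] .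
  have nz: "f x y \<noteq> 0" if "norm x < t" "norm y < t" for x y
    using d(2)[of x y] that t by (auto simp: norm_minus_commute)
  show ?thesis unfolding conv_ps2_iff
  proof (intro exI[of _ t] conjI hol2_onI t)
    show "continuous_on (ball 0 t \<times> ball 0 t) (\<lambda>(x,y). inverse (f x y))"
      using hol2_on_continuous[OF ft] nz by (auto simp: case_prod_unfold intro!: continuous_intros)
    fix S g h assume S: "open S" "g holomorphic_on S" "h holomorphic_on S" "g ` S \<subseteq> ball 0 t" "h ` S \<subseteq> ball 0 t"
    have "norm (g z) < t" "norm (h z) < t" if "z \<in> S" for z using S(4,5) that by auto
    then show "(\<lambda>z. inverse (f (g z) (h z))) holomorphic_on S"
      using hol2_on_curve[OF ft S] nz by (intro holomorphic_intros) auto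
  qed
qed

section \<open>Division by a branch, and division with remainder in one variable\<close>

lemma conv_ps2_divide_snd:
  assumes "conv_ps2 f"
  obtains g where "conv_ps2 g" "\<forall>\<^sub>F (x,y) in nhds (0,0). f x y = f x 0 + y * g x y"
proof -
  obtain r c where r: "r > 0" and c: "\<And>x y. norm x < r \<Longrightarrow> norm y < r \<Longrightarrow>
        ((\<lambda>(m,n). c m n * x ^ m * y ^ n) has_sum f x y) UNIV"
    using assms unfolding conv_ps2_def by blast
  define g where "g = (\<lambda>x y. \<Sum>\<^sub>\<infinity>(m,n). c m (Suc n) * x ^ m * y ^ n)"
  have inj: "inj (\<lambda>(m::nat,n). (m, Suc n))" by (auto simp: inj_on_def)
  have sm: "(\<lambda>(m,n). c m (Suc n) * x ^ m * y ^ n) summable_on UNIV" if xy: "norm x < r" "norm y < r" for x y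
  proof -
    \<comment> \<open>The shifted series cannot be obtained by dividing by y, which may be 0. It is
      summed at a nonzero w with |y| \<le> |w| < r and then compared termwise.\<close>
    define w where "w = complex_of_real ((norm y + r) / 2)"
    have "norm w = (norm y + r) / 2"
      unfolding w_def norm_of_real using r by (intro abs_of_nonneg) simp
    then have w: "norm y \<le> norm w" "norm w < r" "w \<noteq> 0"
      using xy r norm_ge_zero[of y] by (auto simp del: norm_ge_zero)
    have "(\<lambda>(m,n). c m n * x ^ m * w ^ n) summable_on UNIV"
      using c[OF xy(1) w(2)] by (auto simp: summable_on_def)
    then have "(\<lambda>(m,n). c m n * x ^ m * w ^ n) summable_on (range (\<lambda>(m,n). (m, Suc n)))"
      by (rule summable_on_subset_banach) auto
    then have "(\<lambda>(m,n). c m (Suc n) * x ^ m * w ^ Suc n) summable_on UNIV"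
      by (subst (asm) summable_on_reindex[OF inj]) (simp add: o_def case_prod_unfold)
    from summable_on_cmult_left[OF this, of "inverse w"]
    have "(\<lambda>mn. (case mn of (m,n) \<Rightarrow> c m (Suc n) * x ^ m * w ^ Suc n) * inverse w) summable_on UNIV" .
    moreover have "(\<lambda>mn. (case mn of (m,n) \<Rightarrow> c m (Suc n) * x ^ m * w ^ Suc n) * inverse w)
        = (\<lambda>(m,n). c m (Suc n) * x ^ m * w ^ n)"
      by (rule ext) (simp add: w(3) split: prod.split)
    ultimately have "(\<lambda>(m,n). c m (Suc n) * x ^ m * w ^ n) summable_on UNIV" by simp
    then have ab: "(\<lambda>mn. norm (case mn of (m,n) \<Rightarrow> c m (Suc n) * x ^ m * w ^ n)) summable_on UNIV"
      by (rule summable_on_iff_abs_summable_on_complex[THEN iffD1])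
    show ?thesis
      by (subst summable_on_iff_abs_summable_on_complex, rule Infinite_Sum.abs_summable_on_comparison_test[OF ab])
         (auto simp: norm_mult norm_power intro!: mult_left_mono power_mono w)
  qed
  have gs: "((\<lambda>(m,n). c m (Suc n) * x ^ m * y ^ n) has_sum g x y) UNIV" if "norm x < r" "norm y < r" for x y
    unfolding g_def using sm[OF that] by (rule has_sum_infsum)
  have cg: "conv_ps2 g" unfolding conv_ps2_def using r gs by (intro exI[of _ r] conjI exI[of _ "\<lambda>m n. c m (Suc n)"]) auto
  have eq: "f x y = f x 0 + y * g x y" if xy: "norm x < r" "norm y < r" for x y
  proof -
    have "((\<lambda>(m,n). c m (Suc n) * x ^ m * y ^ Suc n) has_sum y * g x y) UNIV"
      using has_sum_cmult_right[OF gs[OF xy], of y] by (simp add: case_prod_unfold algebra_simps)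
    then have 1: "((\<lambda>(m,n). c m n * x ^ m * y ^ n) has_sum y * g x y) (range (\<lambda>(m,n). (m, Suc n)))"
      by (subst has_sum_reindex[OF inj]) (simp add: o_def case_prod_unfold)
    have inj0: "inj (\<lambda>m::nat. (m, 0::nat))" by (auto simp: inj_on_def)
    have "((\<lambda>(m,n). c m n * x ^ m * 0 ^ n) has_sum f x 0) UNIV" using c xy(1) r by auto
    then have "((\<lambda>(m,n). c m n * x ^ m * 0 ^ n) has_sum f x 0) (range (\<lambda>m. (m, 0)))"
      by (subst has_sum_cong_neutral[where T = UNIV and g = "\<lambda>(m,n). c m n * x ^ m * 0 ^ n"]) (auto simp: image_iff gr0_conv_Suc)
    then have 2: "((\<lambda>(m,n). c m n * x ^ m * y ^ n) has_sum f x 0) (range (\<lambda>m. (m, 0)))"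
      by (subst (asm) has_sum_reindex[OF inj0], subst has_sum_reindex[OF inj0]) (simp add: o_def)
    have U: "range (\<lambda>m::nat. (m, 0::nat)) \<union> range (\<lambda>(m,n). (m, Suc n)) = UNIV"
    proof -
      have "mn \<in> range (\<lambda>m::nat. (m, 0::nat)) \<union> range (\<lambda>(m,n). (m, Suc n))" for mn :: "nat \<times> nat"
        by (cases mn; cases "snd mn") (auto simp: image_iff)
      then show ?thesis by blast
    qed
    have disj: "range (\<lambda>m::nat. (m, 0::nat)) \<inter> range (\<lambda>(m,n). (m, Suc n)) = {}" by auto
    have "((\<lambda>(m,n). c m n * x ^ m * y ^ n) has_sum (f x 0 + y * g x y)) UNIV"
      using has_sum_Un_disjoint[OF 2 1 disj] unfolding U .
    from has_sum_unique[OF c[OF xy] this] show ?thesis .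
  qed
  have "\<forall>\<^sub>F (x,y) in nhds (0,0). f x y = f x 0 + y * g x y"
    unfolding eventually_nhds_bidisc prod.case using r eq by blast
  with cg that show thesis by blast
qed


lemma eventually_nhds_compose:
  assumes "eventually P (nhds (0, 0))" "conv_ps2 a" "a 0 0 = 0"
  shows "\<forall>\<^sub>F (x,y) in nhds (0,0). P (x, a x y)"
proof -
  have "((\<lambda>(x,y). (x, a x y)) \<longlongrightarrow> (0, 0)) (nhds (0,0))"
    using conv_ps2_tendsto[OF assms(2)] assms(3) unfolding case_prod_unfold
    by (intro tendsto_Pair) (auto intro!: tendsto_eq_intros simp: tendsto_at_iff_tendsto_nhds filterlim_ident nhds_prod filterlim_fst)
  then show ?thesis
    using eventually_compose_filterlim[OF assms(1)] by (simp add: case_prod_unfold)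
qed

text \<open>The substitution y + a(x) for y straightens the branch to y = 0, where
  \<open>conv_ps2_divide_snd\<close> applies; a(0) = 0 keeps both shifts within germs at the
  origin.\<close>

lemma conv_ps2_divide_branch:
  assumes f: "conv_ps2 f" and a: "conv_ps2 (\<lambda>x y. a x)" "a 0 = 0"
  obtains g where "conv_ps2 g" "\<forall>\<^sub>F (x,y) in nhds (0,0). f x y = f x (a x) + (y - a x) * g x y"
proof -
  have "conv_ps2 (\<lambda>x y. f x (y + a x))" using a by (intro conv_ps2_compose[OF f]) auto
  then obtain g where g: "conv_ps2 g" "\<forall>\<^sub>F (x,y) in nhds (0,0). f x (y + a x) = f x (0 + a x) + y * g x y"
    by (rule conv_ps2_divide_snd)
  have c: "conv_ps2 (\<lambda>x y. y - a x)" using a by auto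
  show thesis
  proof (rule that)
    show "conv_ps2 (\<lambda>x y. g x (y - a x))" using a by (intro conv_ps2_compose[OF g(1)]) auto
    show "\<forall>\<^sub>F (x,y) in nhds (0,0). f x y = f x (a x) + (y - a x) * g x (y - a x)"
      using eventually_nhds_compose[OF g(2) c] a(2) by simp
  qed
qed

text \<open>The remainder p is the Taylor polynomial of f below degree N. Then f - p is O(x^N), its
  quotient by g is bounded near 0, and the singularity is removable. The order of g is given as a
  lower bound for |g|, the form in which \<open>B_order\<close> provides it.\<close>

lemma division_by_germ_of_order:
  assumes f: "conv_ps2 (\<lambda>x y. f x)" and g: "conv_ps2 (\<lambda>x y. g x)" "g 0 = 0"
    and N: "N > 0" and c: "c > 0" "\<forall>\<^sub>F x in nhds 0. c * norm x ^ N \<le> norm (g x)"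
  obtains p h where "degree p < N" "conv_ps2 (\<lambda>x y. h x)" "\<forall>\<^sub>F x in nhds 0. f x = poly p x + g x * h x"
proof -
  obtain r1 where r1: "r1 > 0" "f holomorphic_on ball 0 r1" using conv_ps2_restrict[OF f] by auto
  obtain r2 where r2: "r2 > 0" "g holomorphic_on ball 0 r2" using conv_ps2_restrict[OF g(1)] by auto
  obtain r3 where r3: "r3 > 0" "\<And>x. norm x < r3 \<Longrightarrow> c * norm x ^ N \<le> norm (g x)"
    using c(2) unfolding eventually_nhds_metric by auto
  define r where "r = min r1 (min r2 r3)"
  have r: "r > 0" "r \<le> r1" "r \<le> r2" "r \<le> r3" using r1 r2 r3 by (auto simp: r_def)
  have fr: "f holomorphic_on ball 0 r" and gr: "g holomorphic_on ball 0 r"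
    using r1 r2 r holomorphic_on_subset subset_ball by metis+
  define \<rho> where "\<rho> = r / 2"
  have \<rho>: "0 < \<rho>" "\<rho> < r" using r by (auto simp: \<rho>_def)
  define a where "a = (\<lambda>n. (deriv ^^ n) f 0 / fact n)"
  have asums: "(\<lambda>n. a n * x ^ n) sums f x" if "norm x < r" for x
    using holomorphic_power_series[OF fr, of x] that by (simp add: a_def)
  have fc: "continuous_on (cball 0 \<rho>) f"
    by (rule holomorphic_on_imp_continuous_on[OF holomorphic_on_subset[OF fr]]) (use \<rho> in auto)
  have "compact (f ` cball 0 \<rho>)" using fc by (intro compact_continuous_image) auto
  then obtain K where K: "\<And>x. norm x \<le> \<rho> \<Longrightarrow> norm (f x) \<le> K"
    using compact_imp_bounded bounded_iff by (metis imageI mem_cball_0)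
  have abound: "norm (a n) \<le> K / \<rho> ^ n" for n
    unfolding a_def using \<rho> K by (intro taylor_coeff_bound[OF fr]) auto
  define p where "p = (\<Sum>k<N. monom (a k) k)"
  have px: "poly p x = (\<Sum>k<N. a k * x ^ k)" for x by (simp add: p_def poly_sum poly_monom)
  have deg: "degree p < N" unfolding p_def
    by (rule degree_sum_less) (use N in \<open>auto intro: le_less_trans[OF degree_monom_le]\<close>)
  have gnz: "g x \<noteq> 0" if "norm x < r" "x \<noteq> 0" for x
  proof -
    have "0 < c * norm x ^ N" using c that by simp
    also have "\<dots> \<le> norm (g x)" using r3 that r by auto
    finally show ?thesis by auto
  qed
  have hol: "(\<lambda>x. (f x - poly p x) / g x) holomorphic_on ball 0 r - {0}"
    using gnz by (intro holomorphic_intros holomorphic_on_subset[OF fr] holomorphic_on_subset[OF gr]) auto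
  have "norm ((f x - poly p x) / g x) \<le> 2 * K / (\<rho> ^ N * c)" if x: "norm x < \<rho> / 2" "x \<noteq> 0" for x
  proof -
    have xr: "norm x < r" using x \<rho> by auto
    have "norm (f x - poly p x) \<le> 2 * K * (norm x / \<rho>) ^ N"
      unfolding px by (rule power_series_remainder_bound[OF abound _ _ asums[OF xr]]) (use x \<rho> in auto)
    also have "\<dots> = 2 * K / (\<rho> ^ N * c) * (c * norm x ^ N)" using c by (simp add: power_divide)
    also have "\<dots> \<le> 2 * K / (\<rho> ^ N * c) * norm (g x)"
    proof (rule mult_left_mono)
      have "K \<ge> 0" using order_trans[OF norm_ge_zero K[of 0]] \<rho> by auto
      then show "0 \<le> 2 * K / (\<rho> ^ N * c)" using c \<rho> by simp
    qed (use r3 xr r in auto)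
    finally show ?thesis using gnz[OF xr x(2)] by (simp add: norm_divide divide_le_eq)
  qed
  then have "\<exists>B. \<forall>\<^sub>F x in at 0. norm ((f x - poly p x) / g x) \<le> B"
    unfolding eventually_at using \<rho> by (intro exI[of _ "2 * K / (\<rho> ^ N * c)"] exI[of _ "\<rho>/2"]) (auto simp: dist_norm)
  then obtain h where h: "h holomorphic_on ball 0 r" "\<And>x. x \<in> ball 0 r - {0} \<Longrightarrow> h x = (f x - poly p x) / g x"
    using holomorphic_on_extend_bounded[OF hol] r(1) by auto
  have "f x = poly p x + g x * h x" if "norm x < r" for x
  proof (cases "x = 0")
    case True
    have "f 0 = a 0" by (simp add: a_def)
    also have "\<dots> = poly p 0" using N unfolding px by (cases N) (auto simp: sum.lessThan_Suc_shift)
    finally show ?thesis using True g(2) by simp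
  next
    case False
    then show ?thesis using h(2)[of x] gnz[of x] that by simp
  qed
  then have "\<forall>\<^sub>F x in nhds 0. f x = poly p x + g x * h x"
    unfolding eventually_nhds_metric using r by (intro exI[of _ r]) auto
  with that[OF deg conv_ps2_holomorphic[OF r(1) h(1)]] show thesis by blast
qed

section \<open>Normal forms along branches\<close>

lemma prod_greaterThanLessThan_Suc:
  fixes f :: "nat \<Rightarrow> 'a::comm_monoid_mult"
  assumes "k < n"
  shows "(\<Prod>j\<in>{k<..<Suc n}. f j) = f n * (\<Prod>j\<in>{k<..<n}. f j)"
proof -
  have "{k<..<Suc n} = insert n {k<..<n}" using assms by auto
  then show ?thesis by simp
qed

text \<open>A Horner step: the index n carries the empty product, and every other term contains the
  factor \<open>w n\<close>.\<close>

lemma newton_sum_Suc: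
  fixes w :: "nat \<Rightarrow> 'a::comm_ring_1"
  shows "(\<Sum>k<Suc n. c k * (\<Prod>j\<in>{k<..<Suc n}. w j)) = c n + w n * (\<Sum>k<n. c k * (\<Prod>j\<in>{k<..<n}. w j))"
proof -
  have "(\<Sum>k<n. c k * (\<Prod>j\<in>{k<..<Suc n}. w j)) = (\<Sum>k<n. w n * (c k * (\<Prod>j\<in>{k<..<n}. w j)))"
    by (rule sum.cong) (auto simp: prod_greaterThanLessThan_Suc mult_ac)
  moreover have "{n<..<Suc n} = {}" by auto
  ultimately show ?thesis by (simp add: sum_distrib_left)
qed

text \<open>The ring identity behind one induction step. Here b stands for B restricted to the
  branch w = 0; replacing b h by (B - w B1) h puts the multiple of B into the ideal and moves the
  correction h B1 into the next dividend \<open>Q1 - h * B1\<close>.\<close>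

lemma newton_step_identity:
  fixes Q :: "'a::comm_ring_1"
  assumes Q: "Q = p + b * h + w * Q1" and B: "B = b + w * B1" and "Q1 - h * B1 = S + G * R + H * B"
  shows "Q = (p + w * S) + G * (w * R) + (h + w * H) * B"
proof -
  have 1: "Q1 = h * B1 + S + G * R + H * B" using assms(3) by (simp add: algebra_simps)
  have 2: "b = B - w * B1" using B by simp
  show ?thesis unfolding Q 1 2 by (simp add: algebra_simps)
qed

text \<open>Induction on the number of branches, peeling off the one with the largest index. The
  restriction of Q to that branch is reduced modulo the restriction of B, which has order
  \<open>N n\<close>; the remainder is the coefficient of index n, and the quotient by y - a_n,
  corrected as in \<open>newton_step_identity\<close>, is treated recursively.\<close>

lemma newton_representation_exists:
  fixes n :: nat
  assumes a: "\<And>j. j < n \<Longrightarrow> conv_ps2 (\<lambda>x y. a j x)" "\<And>j. j < n \<Longrightarrow> a j 0 = 0"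
    and B: "conv_ps2 B" "B 0 0 = 0"
    and N: "\<And>j. j < n \<Longrightarrow> N j > 0"
    and ord: "\<And>j. j < n \<Longrightarrow> \<exists>c>0. \<forall>\<^sub>F x in nhds 0. c * norm x ^ N j \<le> norm (B x (a j x))"
    and Q: "conv_ps2 Q"
  shows "\<exists>c G H. (\<forall>k\<ge>n. c k = 0) \<and> (\<forall>k<n. degree (c k) < N k) \<and> conv_ps2 G \<and> conv_ps2 H \<and>
     (\<forall>\<^sub>F (x,y) in nhds (0,0). Q x y = (\<Sum>k<n. poly (c k) x * (\<Prod>j\<in>{k<..<n}. y - a j x)) +
         G x y * (\<Prod>j<n. y - a j x) + H x y * B x y)"
  using assms
proof (induction n arbitrary: Q)
  case 0
  show ?case
    \<comment> \<open>With no branch left the empty product is 1, so G absorbs all of Q.\<close>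
    by (rule exI[of _ "\<lambda>_. 0"], rule exI[of _ Q], rule exI[of _ "\<lambda>_ _. 0"]) (simp add: 0(7))
next
  case (Suc n)
  have an: "conv_ps2 (\<lambda>x y. a n x)" "a n 0 = 0" using Suc.prems(1,2) by auto
  obtain Q1 where Q1: "conv_ps2 Q1" "\<forall>\<^sub>F (x,y) in nhds (0,0). Q x y = Q x (a n x) + (y - a n x) * Q1 x y"
    using conv_ps2_divide_branch[OF Suc.prems(7) an] by blast
  obtain B1 where B1: "conv_ps2 B1" "\<forall>\<^sub>F (x,y) in nhds (0,0). B x y = B x (a n x) + (y - a n x) * B1 x y"
    using conv_ps2_divide_branch[OF Suc.prems(3) an] by blast
  obtain e where e: "e > 0" "\<forall>\<^sub>F x in nhds 0. e * norm x ^ N n \<le> norm (B x (a n x))"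
    using Suc.prems(6)[of n] by auto
  have cQ: "conv_ps2 (\<lambda>x y. Q x (a n x))" and cB: "conv_ps2 (\<lambda>x y. B x (a n x))"
    by (rule conv_ps2_compose[OF Suc.prems(7) an], rule conv_ps2_compose[OF Suc.prems(3) an])
  have B0: "B 0 (a n 0) = 0" and Nn: "N n > 0" using Suc.prems(4,5) an(2) by simp_all
  obtain p h where p: "degree p < N n" and h: "conv_ps2 (\<lambda>x y. h x)"
      and ph: "\<forall>\<^sub>F x in nhds 0. Q x (a n x) = poly p x + B x (a n x) * h x"
    using division_by_germ_of_order[OF cQ cB B0 Nn e] by blast
  have Q': "conv_ps2 (\<lambda>x y. Q1 x y - h x * B1 x y)" by (intro conv_ps2_intros Q1(1) B1(1) h)
  have "\<exists>c G H. (\<forall>k\<ge>n. c k = 0) \<and> (\<forall>k<n. degree (c k) < N k) \<and> conv_ps2 G \<and> conv_ps2 H \<and>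
     (\<forall>\<^sub>F (x,y) in nhds (0,0). Q1 x y - h x * B1 x y = (\<Sum>k<n. poly (c k) x * (\<Prod>j\<in>{k<..<n}. y - a j x)) +
         G x y * (\<Prod>j<n. y - a j x) + H x y * B x y)"
    by (rule Suc.IH[OF _ _ Suc.prems(3,4) _ _ Q']; (rule Suc.prems, erule less_SucI))
  then obtain c G H where c: "\<forall>k\<ge>n. c k = 0" "\<forall>k<n. degree (c k) < N k" and GH: "conv_ps2 G" "conv_ps2 H" and
     eq: "\<forall>\<^sub>F (x,y) in nhds (0,0). Q1 x y - h x * B1 x y = (\<Sum>k<n. poly (c k) x * (\<Prod>j\<in>{k<..<n}. y - a j x)) +
         G x y * (\<Prod>j<n. y - a j x) + H x y * B x y"
    by blast
  show ?case
  proof (intro exI conjI)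
    show "\<forall>k\<ge>Suc n. (c(n := p)) k = 0" "\<forall>k<Suc n. degree ((c(n := p)) k) < N k"
      using c p by (auto simp: less_Suc_eq)
    show "conv_ps2 G" "conv_ps2 (\<lambda>x y. h x + (y - a n x) * H x y)"
      by (intro conv_ps2_intros GH h an)+
    show "\<forall>\<^sub>F (x,y) in nhds (0,0). Q x y = (\<Sum>k<Suc n. poly ((c(n := p)) k) x * (\<Prod>j\<in>{k<..<Suc n}. y - a j x)) +
         G x y * (\<Prod>j<Suc n. y - a j x) + (h x + (y - a n x) * H x y) * B x y"
      using Q1(2) B1(2) eventually_nhds_prod_fst[OF ph] eq
    proof eventually_elim
      case (elim z)
      obtain x y where z: "z = (x, y)" by fastforce
      define S where "S = (\<Sum>k<n. poly (c k) x * (\<Prod>j\<in>{k<..<n}. y - a j x))"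
      define R where "R = (\<Prod>j<n. y - a j x)"
      have "(\<Sum>k<Suc n. poly ((c(n := p)) k) x * (\<Prod>j\<in>{k<..<Suc n}. y - a j x)) = poly p x + (y - a n x) * S"
        unfolding newton_sum_Suc S_def by simp
      moreover have "(\<Prod>j<Suc n. y - a j x) = (y - a n x) * R" by (simp add: R_def mult.commute)
      moreover have "Q x y = (poly p x + (y - a n x) * S) + G x y * ((y - a n x) * R) + (h x + (y - a n x) * H x y) * B x y"
      proof (rule newton_step_identity)
        show "Q x y = poly p x + B x (a n x) * h x + (y - a n x) * Q1 x y"
          using elim(1,3) unfolding z prod.case by argo
        show "B x y = B x (a n x) + (y - a n x) * B1 x y" using elim(2) unfolding z prod.case .
        show "Q1 x y - h x * B1 x y = S + G x y * R + H x y * B x y"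
          using elim(4) unfolding z prod.case S_def R_def .
      qed
      ultimately show ?case unfolding z prod.case by argo
    qed
  qed
qed

lemma poly_eq_0_of_high_order:
  fixes p :: "complex poly"
  assumes "degree p < N" and "\<forall>\<^sub>F x in nhds 0. norm (poly p x) \<le> C * norm x ^ N"
  shows "p = 0"
proof (rule ccontr)
  assume "p \<noteq> 0"
  define m where "m = order 0 p"
  obtain q where q: "p = [:0, 1:] ^ m * q" "\<not> [:0, 1:] dvd q"
    using order_decomp[OF \<open>p \<noteq> 0\<close>, of 0] by (auto simp: m_def)
  then have q0: "poly q 0 \<noteq> 0" using poly_eq_0_iff_dvd[of q 0] by simp
  have "m \<le> degree p" using order_degree[OF \<open>p \<noteq> 0\<close>] by (simp add: m_def)
  with assms(1) have mN: "m < N" by simp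
  have "\<forall>\<^sub>F x in at 0. norm (poly q x) \<le> C * norm x ^ (N - m)"
    using eventually_nhds_conv_at[THEN iffD1, OF assms(2), THEN conjunct1] eventually_neq_at_within[of 0 0]
  proof eventually_elim
    case (elim x)
    have "norm x ^ m * norm (poly q x) \<le> C * (norm x ^ (N - m) * norm x ^ m)"
      using elim(1) mN by (simp add: q norm_mult norm_power flip: power_add)
    then show ?case using elim(2) by (simp add: field_simps)
  qed
  moreover have "((\<lambda>x. norm (poly q x)) \<longlongrightarrow> norm (poly q 0)) (at 0)"
    by (intro tendsto_intros)
  moreover have "((\<lambda>x. C * norm x ^ (N - m)) \<longlongrightarrow> C * norm (0::complex) ^ (N - m)) (at (0::complex))"
    by (rule tendsto_mult[OF tendsto_const tendsto_power[OF tendsto_norm[OF tendsto_ident_at]]])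
  ultimately have "norm (poly q 0) \<le> C * norm (0::complex) ^ (N - m)"
    using tendsto_le[OF at_neq_bot] by blast
  then show False using mN q0 by (simp add: power_0_left)
qed

text \<open>On the last branch every product with k < n and the full product vanish, leaving d_n = H
  B there. The right side is O(x^N_n) while deg d_n < N_n, so d_n = 0. As B is nonzero on the branch
  for x \<noteq> 0, H must vanish there; then y - a_n divides H and can be cancelled from the whole
  identity, which leaves the case of n - 1 branches.\<close>

lemma newton_representation_unique:
  fixes n :: nat
  assumes a: "\<And>j. j < n \<Longrightarrow> conv_ps2 (\<lambda>x y. a j x)" "\<And>j. j < n \<Longrightarrow> a j 0 = 0"
    and B: "conv_ps2 B"
    and up: "\<And>j. j < n \<Longrightarrow> \<exists>c. \<forall>\<^sub>F x in nhds 0. norm (B x (a j x)) \<le> c * norm x ^ N j"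
    and ord: "\<And>j. j < n \<Longrightarrow> \<exists>c>0. \<forall>\<^sub>F x in nhds 0. c * norm x ^ N j \<le> norm (B x (a j x))"
    and d: "\<And>k. k < n \<Longrightarrow> degree (d k) < N k"
    and GH: "conv_ps2 G" "conv_ps2 H"
    and eq: "\<forall>\<^sub>F (x,y) in nhds (0,0). (\<Sum>k<n. poly (d k) x * (\<Prod>j\<in>{k<..<n}. y - a j x)) =
         G x y * (\<Prod>j<n. y - a j x) + H x y * B x y"
  shows "\<forall>k<n. d k = 0"
  using assms
proof (induction n arbitrary: G H)
  case 0
  then show ?case by simp
next
  case (Suc n)
  have an: "conv_ps2 (\<lambda>x y. a n x)" "a n 0 = 0" using Suc.prems(1,2) by auto
  obtain C where C: "\<forall>\<^sub>F x in nhds 0. norm (B x (a n x)) \<le> C * norm x ^ N n" using Suc.prems(4)[of n] by blast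
  obtain e where e: "e > 0" "\<forall>\<^sub>F x in nhds 0. e * norm x ^ N n \<le> norm (B x (a n x))"
    using Suc.prems(5)[of n] by blast
  have Hn: "conv_ps2 (\<lambda>x y. H x (a n x))" by (rule conv_ps2_compose[OF Suc.prems(8) an])
  have "\<forall>\<^sub>F (x,y) in nhds (0::complex,0::complex). poly (d n) x = H x (a n x) * B x (a n x)"
    using eventually_nhds_compose[OF Suc.prems(9) an]
    by (rule eventually_mono) (auto simp: newton_sum_Suc simp del: sum.lessThan_Suc)
  then have dn: "\<forall>\<^sub>F x in nhds 0. poly (d n) x = H x (a n x) * B x (a n x)" by (rule eventually_restrict_fst)
  obtain K where K: "K > 0" "\<forall>\<^sub>F (x,y) in nhds (0::complex,0::complex). norm (H x (a n x)) \<le> K" using conv_ps2_bounded[OF Hn] by auto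
  have "\<forall>\<^sub>F x in nhds 0. norm (poly (d n) x) \<le> (K * C) * norm x ^ N n"
    using dn C eventually_restrict_fst[OF K(2)]
  proof eventually_elim
    case (elim x)
    have "norm (poly (d n) x) \<le> K * (C * norm x ^ N n)"
      unfolding elim(1) norm_mult using elim K by (intro mult_mono) auto
    then show ?case by (simp add: mult.assoc)
  qed
  then have d0: "d n = 0" using poly_eq_0_of_high_order Suc.prems(6) by blast
  have Hz: "\<forall>\<^sub>F x in at 0. H x (a n x) = 0"
    using eventually_nhds_conv_at[THEN iffD1, OF dn, THEN conjunct1]
      eventually_nhds_conv_at[THEN iffD1, OF e(2), THEN conjunct1] eventually_neq_at_within[of 0 0]
  proof eventually_elim
    case (elim x)
    then have "0 < e * norm x ^ N n" using e by simp
    with elim have "B x (a n x) \<noteq> 0" by auto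
    then show ?case using elim(1) d0 by simp
  qed
  \<comment> \<open>The vanishing of H was obtained only for x \<noteq> 0; continuity supplies the
    origin.\<close>
  have "((\<lambda>x. H x (a n x)) \<longlongrightarrow> H 0 (a n 0)) (at 0)"
  proof -
    obtain r where "r > 0" "(\<lambda>x. H x (a n x)) holomorphic_on ball 0 r" using conv_ps2_restrict[OF Hn] by auto
    then have "continuous_on (ball 0 r) (\<lambda>x. H x (a n x))" by (simp add: holomorphic_on_imp_continuous_on)
    with \<open>r > 0\<close> show ?thesis by (simp add: continuous_on_eq_continuous_at isCont_def)
  qed
  from tendsto_unique[OF at_neq_bot this tendsto_eventually[OF Hz]] have "H 0 (a n 0) = 0" .
  with Hz have Hz: "\<forall>\<^sub>F x in nhds 0. H x (a n x) = 0" by (simp add: eventually_nhds_conv_at)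
  obtain H1 where H1: "conv_ps2 H1" "\<forall>\<^sub>F (x,y) in nhds (0,0). H x y = H x (a n x) + (y - a n x) * H1 x y"
    using conv_ps2_divide_branch[OF Suc.prems(8) an] by blast
  define E where "E = (\<lambda>x y. (\<Sum>k<n. poly (d k) x * (\<Prod>j\<in>{k<..<n}. y - a j x)) -
         (G x y * (\<Prod>j<n. y - a j x) + H1 x y * B x y))"
  have cE: "conv_ps2 E" unfolding E_def 
    by (intro conv_ps2_intros Suc.prems(1,3,7,8) H1(1)) auto
  have "\<forall>\<^sub>F (x,y) in nhds (0,0). (y - a n x) * E x y = 0"
    using Suc.prems(9) H1(2) eventually_nhds_prod_fst[OF Hz]
  proof eventually_elim
    case (elim z)
    obtain x y where z: "z = (x, y)" by fastforce
    define S where "S = (\<Sum>k<n. poly (d k) x * (\<Prod>j\<in>{k<..<n}. y - a j x))"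
    define R where "R = (\<Prod>j<n. y - a j x)"
    have Hxy: "H x y = (y - a n x) * H1 x y" using elim(2,3) unfolding z prod.case by simp
    have "(y - a n x) * S = G x y * (R * (y - a n x)) + (y - a n x) * H1 x y * B x y"
      using elim(1) unfolding z prod.case newton_sum_Suc d0 Hxy by (simp add: S_def R_def)
    moreover have "(y - a n x) * E x y = (y - a n x) * S - (G x y * (R * (y - a n x)) + (y - a n x) * H1 x y * B x y)"
      unfolding E_def S_def R_def by (simp add: algebra_simps)
    ultimately show ?case unfolding z prod.case by simp
  qed
  then obtain r where r: "r > 0" "\<And>x y. norm x < r \<Longrightarrow> norm y < r \<Longrightarrow> (y - a n x) * E x y = 0"
    unfolding eventually_nhds_bidisc by auto
  obtain s where s: "s > 0" "hol2_on s E" using cE conv_ps2_iff by blast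
  \<comment> \<open>Cancelling y - a_n leaves the points of the branch itself undecided; there E
    vanishes by continuity in y.\<close>
  have E0: "E x y = 0" if xy: "norm x < min r s" "norm y < min r s" for x y
  proof (cases "y = a n x")
    case True
    have "(\<lambda>y. E x y) holomorphic_on ball 0 s"
      using hol2_on_curve[OF s(2), of "ball 0 s" "\<lambda>_. x" "\<lambda>y. y"] xy by (auto simp: image_subset_iff)
    then have "continuous_on (ball 0 s) (\<lambda>y. E x y)" by (simp add: holomorphic_on_imp_continuous_on)
    then have lim: "((\<lambda>y. E x y) \<longlongrightarrow> E x y) (at y)"
      using xy by (simp add: continuous_on_eq_continuous_at isCont_def)
    have "\<forall>\<^sub>F w in at y. norm w < r"
      using xy by (intro order_tendstoD(2)[where y = "norm y"] tendsto_intros) auto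
    then have "\<forall>\<^sub>F w in at y. E x w = 0" using eventually_neq_at_within[of y y]
      by eventually_elim (use r xy True in auto)
    from tendsto_unique[OF at_neq_bot lim tendsto_eventually[OF this]] show ?thesis .
  next
    case False
    then show ?thesis using r(2)[of x y] xy by auto
  qed
  have eq': "\<forall>\<^sub>F (x,y) in nhds (0,0). (\<Sum>k<n. poly (d k) x * (\<Prod>j\<in>{k<..<n}. y - a j x)) =
         G x y * (\<Prod>j<n. y - a j x) + H1 x y * B x y"
    unfolding eventually_nhds_bidisc using E0 r(1) s(1) by (intro exI[of _ "min r s"]) (auto simp: E_def)
  have "\<forall>k<n. d k = 0"
    by (rule Suc.IH[OF _ _ Suc.prems(3) _ _ _ Suc.prems(7) H1(1) eq']; (rule Suc.prems, erule less_SucI))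
  with d0 show ?case by (auto simp: less_Suc_eq)
qed

section \<open>Orders along the branches\<close>

text \<open>Links coefficient sequences, in terms of which \<open>ordc\<close> and properness are
  stated, with functions, for which the estimates are made.\<close>

definition has_ps :: "(nat \<Rightarrow> complex) \<Rightarrow> (complex \<Rightarrow> complex) \<Rightarrow> bool" where
  "has_ps \<alpha> f \<longleftrightarrow> (\<exists>r>0. \<forall>x. norm x < r \<longrightarrow> (\<lambda>n. \<alpha> n * x ^ n) sums f x)"

lemma has_ps_add:
  assumes "has_ps \<alpha> f" "has_ps \<beta> g" shows "has_ps (\<lambda>n. \<alpha> n + \<beta> n) (\<lambda>x. f x + g x)"
proof -
  obtain r s where "r > 0" "s > 0" "\<And>x. norm x < r \<Longrightarrow> (\<lambda>n. \<alpha> n * x ^ n) sums f x"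
    "\<And>x. norm x < s \<Longrightarrow> (\<lambda>n. \<beta> n * x ^ n) sums g x" using assms unfolding has_ps_def by blast
  then show ?thesis unfolding has_ps_def
    by (intro exI[of _ "min r s"]) (auto simp: distrib_right intro!: sums_add)
qed

lemma has_ps_minus: "has_ps \<alpha> f \<Longrightarrow> has_ps (\<lambda>n. - \<alpha> n) (\<lambda>x. - f x)"
  unfolding has_ps_def by (auto dest: sums_minus)

lemma has_ps_diff:
  assumes "has_ps \<alpha> f" "has_ps \<beta> g" shows "has_ps (\<lambda>n. \<alpha> n - \<beta> n) (\<lambda>x. f x - g x)"
  using has_ps_add[OF assms(1) has_ps_minus[OF assms(2)]] by simp

lemma has_ps_monomial: "has_ps (\<lambda>n. if n = m then c else 0) (\<lambda>x. c * x ^ m)"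
  unfolding has_ps_def
proof (intro exI[of _ 1] conjI allI impI)
  fix x :: complex
  have "(\<lambda>n. (if n = m then c else 0) * x ^ n) = (\<lambda>n. if n = m then c * x ^ m else 0)" by auto
  then show "(\<lambda>n. (if n = m then c else 0) * x ^ n) sums (c * x ^ m)"
    using sums_single[of m "\<lambda>_. c * x ^ m"] by simp
qed simp

lemma has_ps_real_poly:
  "has_ps (\<lambda>n. complex_of_real (coeff p n)) (poly (map_poly complex_of_real p))"
  unfolding has_ps_def
proof (intro exI[of _ 1] conjI allI impI)
  fix x :: complex
  have "(\<lambda>n. complex_of_real (coeff p n) * x ^ n) sums (\<Sum>n\<le>degree p. complex_of_real (coeff p n) * x ^ n)"
    by (rule sums_finite) (auto simp: coeff_eq_0)
  moreover have "poly (map_poly complex_of_real p) x = (\<Sum>n\<le>degree p. complex_of_real (coeff p n) * x ^ n)"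
    by (simp add: poly_altdef coeff_map_poly degree_map_poly)
  ultimately show "(\<lambda>n. complex_of_real (coeff p n) * x ^ n) sums poly (map_poly complex_of_real p) x" by simp
qed simp

lemma has_ps_eval_ps1:
  assumes "conv_ps1_real a"
  shows "has_ps (\<lambda>n. complex_of_real (a n)) (eval_ps1 a)"
proof -
  obtain r where r: "r > 0" "summable (\<lambda>n. \<bar>a n\<bar> * r ^ n)" using assms unfolding conv_ps1_real_def by blast
  have "(\<lambda>n. complex_of_real (a n) * x ^ n) sums eval_ps1 a x" if "norm x < r" for x
    unfolding eval_ps1_def
  proof (rule summable_sums, rule summable_comparison_test'[OF r(2)])
    show "norm (complex_of_real (a n) * x ^ n) \<le> \<bar>a n\<bar> * r ^ n" for n
      using that by (auto simp: norm_mult norm_power intro!: mult_left_mono power_mono)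
  qed
  then show ?thesis unfolding has_ps_def using r(1) by blast
qed

lemma has_ps_shift:
  assumes "has_ps (\<lambda>n. complex_of_real (a n)) f"
  shows "has_ps (\<lambda>n. complex_of_real (shift_coeffs k a n)) (\<lambda>x. x ^ k * f x)"
proof -
  obtain r where r: "r > 0" "\<And>x. norm x < r \<Longrightarrow> (\<lambda>n. complex_of_real (a n) * x ^ n) sums f x"
    using assms unfolding has_ps_def by blast
  have "(\<lambda>n. complex_of_real (shift_coeffs k a n) * x ^ n) sums (x ^ k * f x)" if "norm x < r" for x
  proof -
    have "(\<lambda>n. x ^ k * (complex_of_real (a n) * x ^ n)) sums (x ^ k * f x)"
      using sums_mult[OF r(2)[OF that]] .
    then have "(\<lambda>n. complex_of_real (shift_coeffs k a (n + k)) * x ^ (n + k)) sums (x ^ k * f x)"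
      by (simp add: shift_coeffs_def power_add mult_ac)
    then show ?thesis
      by (subst (asm) sums_iff_shift) (simp add: shift_coeffs_def)
  qed
  then show ?thesis unfolding has_ps_def using r(1) by blast
qed

lemma has_ps_conv_ps2: assumes "has_ps \<alpha> f" shows "conv_ps2 (\<lambda>x y. f x)"
proof -
  obtain r where r: "r > 0" "\<And>x. norm x < r \<Longrightarrow> (\<lambda>n. \<alpha> n * x ^ n) sums f x"
    using assms unfolding has_ps_def by blast
  have "f holomorphic_on ball 0 r" by (rule power_series_holomorphic[where a = \<alpha>]) (use r in auto)
  with r(1) show ?thesis by (rule conv_ps2_holomorphic)
qed

text \<open>Near 0 the remainder is at most half of the leading term, so |f| lies between d |x|^N
  and 3 d |x|^N with d = |\<alpha>_N| / 2.\<close>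

lemma has_ps_order:
  assumes "has_ps \<alpha> f" and z: "\<And>n. n < N \<Longrightarrow> \<alpha> n = 0" and nz: "\<alpha> N \<noteq> 0"
  obtains c C where "c > 0" "\<forall>\<^sub>F x in nhds 0. c * norm x ^ N \<le> norm (f x) \<and> norm (f x) \<le> C * norm x ^ N"
proof -
  obtain r0 where r0: "r0 > 0" "\<And>x. norm x < r0 \<Longrightarrow> (\<lambda>n. \<alpha> n * x ^ n) sums f x"
    using assms unfolding has_ps_def by blast
  define r where "r = r0 / 2"
  have r: "r > 0" "r < r0" using r0 by (auto simp: r_def)
  have "summable (\<lambda>n. \<alpha> n * complex_of_real r ^ n)"
    using r0(2)[of "complex_of_real r"] r by (auto simp: summable_def)
  then have "Bseq (\<lambda>n. \<alpha> n * complex_of_real r ^ n)" 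
    using summable_LIMSEQ_zero convergent_imp_Bseq convergentI by blast
  then obtain K where K: "K > 0" "\<And>n. norm (\<alpha> n * complex_of_real r ^ n) \<le> K" unfolding Bseq_def by blast
  have b: "norm (\<alpha> n) \<le> K / r ^ n" for n
    using K(2)[of n] r by (simp add: norm_mult norm_power field_simps)
  define d where "d = norm (\<alpha> N) / 2"
  have d: "d > 0" using nz by (simp add: d_def)
  \<comment> \<open>The second bound is what 2 K (|x|/r)^(N+1) \<le> d |x|^N requires.\<close>
  define s where "s = min (r / 2) (d * r ^ Suc N / (2 * K))"
  have s: "s > 0" using r d K by (simp add: s_def)
  have main: "d * norm x ^ N \<le> norm (f x) \<and> norm (f x) \<le> (3 * d) * norm x ^ N" if x: "norm x < s" for x
  proof -
    have xr: "norm x \<le> r / 2" "norm x < r0" using x r by (auto simp: s_def)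
    have "norm (f x - (\<Sum>k<Suc N. \<alpha> k * x ^ k)) \<le> 2 * K * (norm x / r) ^ Suc N"
      by (rule power_series_remainder_bound[OF b r(1) xr(1) r0(2)[OF xr(2)]])
    moreover have "(\<Sum>k<Suc N. \<alpha> k * x ^ k) = \<alpha> N * x ^ N" using z by simp
    moreover have "2 * K * (norm x / r) ^ Suc N \<le> d * norm x ^ N"
    proof -
      have "norm x \<le> d * r ^ Suc N / (2 * K)" using x by (simp add: s_def)
      then have "2 * K * norm x / r ^ Suc N \<le> d" using K r by (simp add: field_simps)
      then have "2 * K * norm x / r ^ Suc N * norm x ^ N \<le> d * norm x ^ N"
        by (rule mult_right_mono) auto
      then show ?thesis by (simp add: power_divide field_simps)
    qed
    ultimately have "norm (f x - \<alpha> N * x ^ N) \<le> d * norm x ^ N" by simp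
    moreover have "norm (\<alpha> N * x ^ N) = 2 * d * norm x ^ N" by (simp add: d_def norm_mult norm_power)
    moreover have "norm (\<alpha> N * x ^ N) \<le> norm (f x) + norm (f x - \<alpha> N * x ^ N)"
      by (metis norm_minus_commute norm_triangle_sub)
    moreover have "norm (f x) \<le> norm (\<alpha> N * x ^ N) + norm (f x - \<alpha> N * x ^ N)" by (rule norm_triangle_sub)
    ultimately show ?thesis by linarith
  qed
  show thesis
    by (rule that[OF d, of "3 * d"])
       (unfold eventually_nhds_metric, rule exI[of _ s], use s main in \<open>simp add: dist_norm\<close>)
qed

lemma ordc_eq_enatD:
  assumes "ordc a = enat N" shows "a N \<noteq> 0" "\<And>n. n < N \<Longrightarrow> a n = 0"
proof -
  have ex: "\<exists>n. a n \<noteq> 0" and N: "N = (LEAST n. a n \<noteq> 0)"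
    using assms unfolding ordc_def by (auto split: if_splits)
  show "a N \<noteq> 0" unfolding N using ex by (rule LeastI_ex)
  show "a n = 0" if "n < N" for n using not_less_Least that unfolding N by blast
qed

lemma the_enat_min_le: "the_enat (min e (enat m)) \<le> m"
  by (cases e) (auto simp: min_def)

lemma Oij_le: "Oij L q i j \<le> 2 * L i" "Oij L q i j \<le> 2 * L j"
  unfolding Oij_def using the_enat_min_le[of "ordc (coeff (q j - q i))" "min (2 * L j) (2 * L i)"] by auto

lemma Oij_commute: "Oij L q i j = Oij L q j i"
proof -
  have "coeff (q j - q i) n \<noteq> 0 \<longleftrightarrow> coeff (q i - q j) n \<noteq> 0" for n by auto
  then have "ordc (coeff (q j - q i)) = ordc (coeff (q i - q j))" unfolding ordc_def by simp
  then show ?thesis unfolding Oij_def by (simp add: min.commute)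
qed

lemma prod_order_bounds:
  fixes f :: "'a \<Rightarrow> complex \<Rightarrow> complex"
  assumes "finite I"
    and "\<And>i. i \<in> I \<Longrightarrow> \<exists>c>0. \<exists>C. \<forall>\<^sub>F x in nhds 0. c * norm x ^ N i \<le> norm (f i x) \<and> norm (f i x) \<le> C * norm x ^ N i"
  shows "\<exists>c>0. \<exists>C. \<forall>\<^sub>F x in nhds 0. c * norm x ^ (\<Sum>i\<in>I. N i) \<le> norm (\<Prod>i\<in>I. f i x) \<and>
            norm (\<Prod>i\<in>I. f i x) \<le> C * norm x ^ (\<Sum>i\<in>I. N i)"
  using assms
proof (induction I rule: finite_induct)
  case empty
  show ?case by (intro exI[of _ 1]) auto
next
  case (insert i I)
  obtain c C where c: "c > 0" "\<forall>\<^sub>F x in nhds 0. c * norm x ^ (\<Sum>i\<in>I. N i) \<le> norm (\<Prod>i\<in>I. f i x) \<and>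
            norm (\<Prod>i\<in>I. f i x) \<le> C * norm x ^ (\<Sum>i\<in>I. N i)" using insert by force
  obtain d D where d: "d > 0" "\<forall>\<^sub>F x in nhds 0. d * norm x ^ N i \<le> norm (f i x) \<and> norm (f i x) \<le> D * norm x ^ N i"
    using insert.prems by blast
  have "\<forall>\<^sub>F x in nhds 0. (d * c) * norm x ^ (\<Sum>i\<in>insert i I. N i) \<le> norm (\<Prod>i\<in>insert i I. f i x) \<and>
            norm (\<Prod>i\<in>insert i I. f i x) \<le> (D * C) * norm x ^ (\<Sum>i\<in>insert i I. N i)"
    using c(2) d(2)
  proof eventually_elim
    case (elim x)
    have 1: "norm (\<Prod>i\<in>insert i I. f i x) = norm (f i x) * norm (\<Prod>i\<in>I. f i x)"
      using insert by (simp add: norm_mult)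
    have 2: "(k * l) * norm x ^ (\<Sum>i\<in>insert i I. N i) = (k * norm x ^ N i) * (l * norm x ^ (\<Sum>i\<in>I. N i))" for k l
      using insert by (simp add: power_add mult_ac)
    show ?case unfolding 1 2 using elim c d
      by (intro conjI mult_mono) (auto intro: order_trans[OF norm_ge_zero])
  qed
  then show ?case using c(1) d(1) by (intro exI[of _ "d * c"] conjI exI[of _ "D * C"]) auto
qed

lemma poly_of_real_cnj:
  "cnj (poly (map_poly complex_of_real p) (cnj x)) = poly (map_poly complex_of_real p) x"
  by (induction p) (auto simp: map_poly_pCons)

lemma Pbar_Pfun:
  "Pbar (Pfun M L q) x y = (\<Prod>j<M. y + poly (map_poly complex_of_real (q j)) x - \<i> * x ^ (2 * L j))"
  unfolding Pbar_def Pfun_def by (simp add: poly_of_real_cnj)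

lemma conv_ps2_Pfun: "conv_ps2 (Pfun M L q)"
  unfolding Pfun_def by (intro conv_ps2_intros)

lemma conv_ps2_Pbar_Pfun: "conv_ps2 (Pbar (Pfun M L q))"
  unfolding Pbar_Pfun by (intro conv_ps2_intros)

lemma conv_ps2_Bfun: "conv_ps2 (Bfun (Pfun M L q))"
  unfolding Bfun_def[abs_def] divide_inverse
  by (intro conv_ps2_mult conv_ps2_diff conv_ps2_Pfun conv_ps2_Pbar_Pfun conv_ps2_const)

text \<open>The indices carry one fixed but arbitrary order here. The theorem instantiates the
  locale with the permuted data, so no permutation enters the analysis.\<close>

locale proper_setting =
  fixes M :: nat and L :: "nat \<Rightarrow> nat" and q :: "nat \<Rightarrow> real poly"
    and t :: real and u :: "complex \<Rightarrow> complex \<Rightarrow> complex" and \<psi> :: "nat \<Rightarrow> nat \<Rightarrow> real"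
  assumes L_pos: "\<And>j. j < M \<Longrightarrow> 1 \<le> L j"
    and q_zero: "\<And>j. j < M \<Longrightarrow> poly (q j) 0 = 0"
    and fact: "proper_factorization M L q t u \<psi>"
begin

definition a :: "nat \<Rightarrow> complex \<Rightarrow> complex" where
  "a j x = - (poly (map_poly complex_of_real (q j)) x + x ^ (2 * L j) * eval_ps1 (\<psi> j) x)"

lemma branch_factor_eq: "branch_factor L q \<psi> j x y = y - a j x"
  unfolding branch_factor_def a_def by simp

abbreviation P :: "complex \<Rightarrow> complex \<Rightarrow> complex" where "P \<equiv> Pfun M L q"
abbreviation A :: "complex \<Rightarrow> complex \<Rightarrow> complex" where "A \<equiv> Afun P"
abbreviation B :: "complex \<Rightarrow> complex \<Rightarrow> complex" where "B \<equiv> Bfun P"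
abbreviation Ord :: "nat \<Rightarrow> nat \<Rightarrow> nat" where "Ord \<equiv> Oij L q"

text \<open>The order of vanishing of P, and hence of B, along the branch a_k, as established in
  \<open>P_order\<close> and \<open>B_order\<close>. It is also the degree bound of the normal
  form.\<close>

definition N :: "nat \<Rightarrow> nat" where "N k = 2 * L k + (\<Sum>j\<in>{..<M} - {k}. Ord j k)"

lemma conv_u: "conv_ps2 u" and u_nz: "u 0 0 \<noteq> 0"
  and conv_psi: "j < M \<Longrightarrow> conv_ps1_real (\<psi> j)"
  using fact unfolding proper_factorization_def by auto

lemma factorization:
  "\<forall>\<^sub>F (x,y) in nhds (0,0). A x y + complex_of_real t * B x y
      = u x y * (\<Prod>j<M. y - a j x)"
  using fact unfolding proper_factorization_def germ_eq_iff branch_factor_eq by auto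

lemma psi_has_ps: "j < M \<Longrightarrow> has_ps (\<lambda>n. complex_of_real (shift_coeffs (2 * L j) (\<psi> j) n)) (\<lambda>x. x ^ (2 * L j) * eval_ps1 (\<psi> j) x)"
  by (intro has_ps_shift has_ps_eval_ps1 conv_psi)

lemma minus_a_has_ps: "j < M \<Longrightarrow>
  has_ps (\<lambda>n. complex_of_real (coeff (q j) n) + complex_of_real (shift_coeffs (2 * L j) (\<psi> j) n)) (\<lambda>x. - a j x)"
  unfolding a_def minus_minus by (intro has_ps_add has_ps_real_poly psi_has_ps)

lemma conv_a: "j < M \<Longrightarrow> conv_ps2 (\<lambda>x y. a j x)"
  using conv_ps2_minus[OF has_ps_conv_ps2[OF minus_a_has_ps]] by simp

lemma a_0: "j < M \<Longrightarrow> a j 0 = 0"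
  using L_pos[of j] q_zero[of j] by (simp add: a_def poly_0_coeff_0 coeff_map_poly)

text \<open>The power series coefficients of a_i - a_j, in the form in which properness prescribes
  their order.\<close>

definition D :: "nat \<Rightarrow> nat \<Rightarrow> nat \<Rightarrow> real" where
  "D i j n = coeff (q j - q i) n + shift_coeffs (2 * L j) (\<psi> j) n - shift_coeffs (2 * L i) (\<psi> i) n"

lemma D_has_ps: "i < M \<Longrightarrow> j < M \<Longrightarrow> has_ps (\<lambda>n. complex_of_real (D i j n)) (\<lambda>x. a i x - a j x)"
  using has_ps_diff[OF minus_a_has_ps[of j] minus_a_has_ps[of i]] by (simp add: D_def algebra_simps)

lemma D_ord:
  assumes "i < M" "j < M" "i \<noteq> j"
  shows "D i j (Ord i j) \<noteq> 0" "\<And>n. n < Ord i j \<Longrightarrow> D i j n = 0"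
proof -
  have "ordc (D i j) = enat (Ord i j)"
    using fact assms unfolding proper_factorization_def D_def[abs_def] by blast
  from ordc_eq_enatD[OF this] show "D i j (Ord i j) \<noteq> 0" "\<And>n. n < Ord i j \<Longrightarrow> D i j n = 0" by auto
qed

lemma branch_separation:
  assumes "i < M" "j < M" "i \<noteq> j"
  shows "\<exists>c>0. \<exists>C. \<forall>\<^sub>F x in nhds 0. c * norm x ^ Ord i j \<le> norm (a i x - a j x) \<and> norm (a i x - a j x) \<le> C * norm x ^ Ord i j"
proof -
  obtain c C where "c > 0" "\<forall>\<^sub>F x in nhds 0. c * norm x ^ Ord i j \<le> norm (a i x - a j x) \<and> norm (a i x - a j x) \<le> C * norm x ^ Ord i j"
    by (rule has_ps_order[OF D_has_ps[OF assms(1,2)]]) (use D_ord[OF assms] in auto)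
  then show ?thesis by blast
qed

text \<open>At y = a_k the j-th factor of P is (a_k - a_j) - x^(2L_j) psi_j + i x^(2L_j). For j
  \<noteq> k, properness gives a_k - a_j the order \<open>Ord j k\<close>, which is at most 2L_j. If
  it is smaller, its leading term survives. If it equals 2L_j, or if j = k, the coefficient of
  x^(2L_j) has imaginary part 1, since all other contributions are real, so it cannot
  cancel.\<close>

lemma P_factor_order:
  assumes kj: "k < M" "j < M"
  shows "\<exists>c>0. \<exists>C. \<forall>\<^sub>F x in nhds 0.
     c * norm x ^ (if j = k then 2 * L k else Ord j k) \<le> norm (a k x + poly (map_poly complex_of_real (q j)) x + \<i> * x ^ (2 * L j)) \<and>
     norm (a k x + poly (map_poly complex_of_real (q j)) x + \<i> * x ^ (2 * L j)) \<le> C * norm x ^ (if j = k then 2 * L k else Ord j k)"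
proof -
  define \<alpha> where "\<alpha> = (\<lambda>n. complex_of_real (D k j n) - complex_of_real (shift_coeffs (2 * L j) (\<psi> j) n) + (if n = 2 * L j then \<i> else 0))"
  define m where "m = (if j = k then 2 * L k else Ord j k)"
  have "has_ps \<alpha> (\<lambda>x. (a k x - a j x) - x ^ (2 * L j) * eval_ps1 (\<psi> j) x + \<i> * x ^ (2 * L j))"
    unfolding \<alpha>_def by (intro has_ps_add has_ps_diff D_has_ps psi_has_ps has_ps_monomial kj)
  moreover have "(\<lambda>x. (a k x - a j x) - x ^ (2 * L j) * eval_ps1 (\<psi> j) x + \<i> * x ^ (2 * L j))
     = (\<lambda>x. a k x + poly (map_poly complex_of_real (q j)) x + \<i> * x ^ (2 * L j))"
    by (simp add: a_def[of j] fun_eq_iff)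
  ultimately have ps: "has_ps \<alpha> (\<lambda>x. a k x + poly (map_poly complex_of_real (q j)) x + \<i> * x ^ (2 * L j))" by simp
  have Dm: "D k j n = 0" if "n < m" for n
  proof (cases "j = k")
    case True then show ?thesis by (simp add: D_def)
  next
    case False then show ?thesis using that D_ord(2)[of k j n] kj by (simp add: m_def Oij_commute)
  qed
  have mle: "m \<le> 2 * L j" using Oij_le[of L q j k] by (simp add: m_def)
  have "\<alpha> n = 0" if "n < m" for n using Dm[OF that] that mle by (simp add: \<alpha>_def shift_coeffs_def)
  moreover have "\<alpha> m \<noteq> 0"
  proof (cases "m = 2 * L j")
    case True
    then have "Im (\<alpha> m) = 1" by (simp add: \<alpha>_def)
    then show ?thesis by auto
  next
    case False
    then have "j \<noteq> k" "m = Ord k j" by (auto simp: m_def Oij_commute)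
    then have "D k j m \<noteq> 0" using D_ord(1)[of k j] kj by simp
    then show ?thesis using False mle by (simp add: \<alpha>_def shift_coeffs_def)
  qed
  ultimately obtain c C where "c > 0" "\<forall>\<^sub>F x in nhds 0. c * norm x ^ m \<le> norm (a k x + poly (map_poly complex_of_real (q j)) x + \<i> * x ^ (2 * L j)) \<and>
     norm (a k x + poly (map_poly complex_of_real (q j)) x + \<i> * x ^ (2 * L j)) \<le> C * norm x ^ m"
    using has_ps_order[OF ps, of m] by blast
  then show ?thesis unfolding m_def by blast
qed

lemma N_eq: "k < M \<Longrightarrow> N k = (\<Sum>j<M. if j = k then 2 * L k else Ord j k)"
  unfolding N_def by (auto simp: sum.remove[of "{..<M}" k] intro!: sum.cong)

lemma P_order:
  assumes "k < M"
  shows "\<exists>c>0. \<exists>C. \<forall>\<^sub>F x in nhds 0. c * norm x ^ N k \<le> norm (P x (a k x)) \<and> norm (P x (a k x)) \<le> C * norm x ^ N k"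
  unfolding Pfun_def N_eq[OF assms]
  by (rule prod_order_bounds) (use P_factor_order assms in auto)

lemma A_B_eq: "P x y = A x y + \<i> * B x y"
  "Pbar P x y = A x y - \<i> * B x y"
  unfolding Afun_def Bfun_def by (simp_all add: field_simps)

lemma eventually_nhds_branch:
  assumes "\<forall>\<^sub>F (x,y) in nhds (0,0). R x y" "k < M" shows "\<forall>\<^sub>F x in nhds 0. R x (a k x)"
proof -
  have "\<forall>\<^sub>F (x,y) in nhds (0::complex,0::complex). R x (a k x)"
    using eventually_nhds_compose[OF assms(1) conv_a a_0] assms(2) by simp
  then show ?thesis by (rule eventually_restrict_fst)
qed

lemma P_B_branch:
  assumes "k < M"
  shows "\<forall>\<^sub>F x in nhds 0. P x (a k x) = (\<i> - complex_of_real t) * B x (a k x)"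
  using eventually_nhds_branch[OF factorization assms]
proof eventually_elim
  case (elim x)
  have z: "(\<Prod>j<M. a k x - a j x) = 0" using assms by (auto intro!: prod_zero)
  have A: "A x (a k x) = - (complex_of_real t * B x (a k x))"
    using elim unfolding z by (simp add: eq_neg_iff_add_eq_0)
  show ?case unfolding A_B_eq(1)[of x "a k x"] A by (simp add: algebra_simps)
qed

lemma B_order:
  assumes "k < M"
  shows "\<exists>c>0. \<exists>C. \<forall>\<^sub>F x in nhds 0. c * norm x ^ N k \<le> norm (B x (a k x)) \<and>
     norm (B x (a k x)) \<le> C * norm x ^ N k"
proof -
  obtain c C where c: "c > 0" "\<forall>\<^sub>F x in nhds 0. c * norm x ^ N k \<le> norm (P x (a k x)) \<and> norm (P x (a k x)) \<le> C * norm x ^ N k"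
    using P_order[OF assms] by blast
  define \<tau> where "\<tau> = norm (\<i> - complex_of_real t)"
  have "Im (\<i> - complex_of_real t) \<noteq> 0" by simp
  then have "\<i> - complex_of_real t \<noteq> 0" by (metis zero_complex.sel(2))
  then have \<tau>: "\<tau> > 0" by (simp add: \<tau>_def)
  have "\<forall>\<^sub>F x in nhds 0. (c / \<tau>) * norm x ^ N k \<le> norm (B x (a k x)) \<and>
     norm (B x (a k x)) \<le> (C / \<tau>) * norm x ^ N k"
    using c(2) P_B_branch[OF assms]
  proof eventually_elim
    case (elim x)
    have "norm (P x (a k x)) = \<tau> * norm (B x (a k x))"
      unfolding elim(2) norm_mult \<tau>_def ..
    with elim(1) \<tau> show ?case by (simp add: field_simps)
  qed
  then show ?thesis using c(1) \<tau> by (intro exI[of _ "c / \<tau>"] conjI exI[of _ "C / \<tau>"]) auto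
qed

section \<open>Existence and uniqueness of the normal form for a fixed ordering\<close>

lemma B_00: "B 0 0 = 0"
proof -
  have "P 0 0 = (\<Prod>j<M. 0)" unfolding Pfun_def
    by (rule prod.cong) (use L_pos q_zero in \<open>force simp: poly_0_coeff_0 coeff_map_poly\<close>)+
  moreover have "Pbar P 0 0 = (\<Prod>j<M. 0)" unfolding Pbar_Pfun
    by (rule prod.cong) (use L_pos q_zero in \<open>force simp: poly_0_coeff_0 coeff_map_poly\<close>)+
  ultimately show ?thesis by (simp add: Bfun_def)
qed

text \<open>The quotient of A + tB by its linear factors of index at most k, written without
  division. Indices start at 0, so the last function, with k = M - 1, is the unit alone.\<close>

definition F :: "nat \<Rightarrow> complex \<Rightarrow> complex \<Rightarrow> complex" where
  "F k x y = u x y * (\<Prod>j\<in>{k<..<M}. y - a j x)"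

text \<open>Coefficients of index at least M are pinned to 0, so that uniqueness makes sense for
  functions on all of \<open>nat\<close>.\<close>

definition Rep :: "(complex \<Rightarrow> complex \<Rightarrow> complex) \<Rightarrow> (nat \<Rightarrow> complex poly) \<Rightarrow> bool" where
  "Rep Q c \<longleftrightarrow> (\<forall>k\<ge>M. c k = 0) \<and> (\<forall>k<M. degree (c k) < N k) \<and>
     cong_ideal2 (P) (Pbar P) Q (\<lambda>x y. \<Sum>k<M. poly (c k) x * F k x y)"

lemma newton_sum_F: "(\<Sum>k<M. poly (c k) x * F k x y) = u x y * (\<Sum>k<M. poly (c k) x * (\<Prod>j\<in>{k<..<M}. y - a j x))"
  unfolding F_def by (simp add: sum_distrib_left mult_ac)

lemma u_nonzero: "\<forall>\<^sub>F (x,y) in nhds (0,0). u x y \<noteq> 0"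
  using conv_ps2_near[OF conv_u, of "norm (u 0 0)"] u_nz
  by (auto elim!: eventually_mono)

lemma N_pos: "k < M \<Longrightarrow> N k > 0" using L_pos[of k] by (simp add: N_def)

lemma Rep_exists:
  assumes "conv_ps2 Q" shows "\<exists>c. Rep Q c"
proof -
  \<comment> \<open>The Newton expansion is free of the unit, so it is applied to Q/u and multiplied
    by u afterwards.\<close>
  have cQ: "conv_ps2 (\<lambda>x y. Q x y * inverse (u x y))"
    by (intro conv_ps2_mult assms conv_ps2_inverse conv_u u_nz)
  have "\<exists>c G H. (\<forall>k\<ge>M. c k = 0) \<and> (\<forall>k<M. degree (c k) < N k) \<and> conv_ps2 G \<and> conv_ps2 H \<and>
     (\<forall>\<^sub>F (x,y) in nhds (0,0). Q x y * inverse (u x y) = (\<Sum>k<M. poly (c k) x * (\<Prod>j\<in>{k<..<M}. y - a j x)) +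
         G x y * (\<Prod>j<M. y - a j x) + H x y * B x y)"
  proof (rule newton_representation_exists[where n = M and a = a and B = B and N = N])
    show "\<exists>c>0. \<forall>\<^sub>F x in nhds 0. c * norm x ^ N j \<le> norm (B x (a j x))" if "j < M" for j
      using B_order[OF that] by (auto elim!: eventually_mono)
  qed (rule conv_a a_0 conv_ps2_Bfun B_00 N_pos cQ; assumption)+
  then obtain c G H where c: "\<forall>k\<ge>M. c k = 0" "\<forall>k<M. degree (c k) < N k" and GH: "conv_ps2 G" "conv_ps2 H"
    and eq: "\<forall>\<^sub>F (x,y) in nhds (0,0). Q x y * inverse (u x y) = (\<Sum>k<M. poly (c k) x * (\<Prod>j\<in>{k<..<M}. y - a j x)) +
         G x y * (\<Prod>j<M. y - a j x) + H x y * B x y" by blast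
  \<comment> \<open>From A = (P + Pbar)/2 and B = (P - Pbar)/(2i), the element G (A + tB) + u H B
    has the coefficients G/2 + W of P and G/2 - W of Pbar, where W = (u H + t G)/(2i) and 1/(2i) =
    -i/2.\<close>
  define W where "W = (\<lambda>x y. (u x y * H x y + complex_of_real t * G x y) * (- \<i> / 2))"
  have cW: "conv_ps2 W" unfolding W_def by (intro conv_ps2_intros conv_u GH)
  have "cong_ideal2 P (Pbar P) Q (\<lambda>x y. \<Sum>k<M. poly (c k) x * F k x y)"
    unfolding cong_ideal2_def germ_eq_iff
  proof (intro exI conjI)
    show "conv_ps2 (\<lambda>x y. G x y * (1/2) + W x y)" "conv_ps2 (\<lambda>x y. G x y * (1/2) - W x y)"
      by (intro conv_ps2_intros GH cW)+
    show "\<forall>\<^sub>F (x,y) in nhds (0,0). Q x y - (\<Sum>k<M. poly (c k) x * F k x y) =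
        (G x y * (1/2) + W x y) * P x y + (G x y * (1/2) - W x y) * Pbar P x y"
      using eq factorization u_nonzero
    proof eventually_elim
      case (elim z)
      obtain x y where z: "z = (x, y)" by fastforce
      define S where "S = (\<Sum>k<M. poly (c k) x * (\<Prod>j\<in>{k<..<M}. y - a j x))"
      define R where "R = (\<Prod>j<M. y - a j x)"
      have 1: "Q x y * inverse (u x y) = S + G x y * R + H x y * B x y"
        and 2: "A x y + complex_of_real t * B x y = u x y * R" and 3: "u x y \<noteq> 0"
        using elim unfolding z prod.case S_def R_def by blast+
      have "Q x y = u x y * (Q x y * inverse (u x y))" using 3 by simp
      also have "\<dots> = u x y * S + G x y * (u x y * R) + u x y * H x y * B x y"
        unfolding 1 by (simp add: algebra_simps)
      also have "\<dots> = u x y * S + G x y * (A x y + complex_of_real t * B x y) + u x y * H x y * B x y"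
        unfolding 2 ..
      finally have "Q x y - u x y * S = G x y * (A x y + complex_of_real t * B x y) + u x y * H x y * B x y" by simp
      also have "\<dots> = (G x y * (1/2) + W x y) * P x y + (G x y * (1/2) - W x y) * Pbar P x y"
        unfolding A_B_eq[of x y] W_def by (simp add: algebra_simps)
      finally show ?case unfolding z prod.case newton_sum_F S_def .
    qed
  qed
  then show ?thesis unfolding Rep_def using c by blast
qed

lemma Rep_unique:
  assumes "Rep Q c" "Rep Q c'" shows "c = c'"
proof -
  obtain G H where GH: "conv_ps2 G" "conv_ps2 H" and eq: "\<forall>\<^sub>F (x,y) in nhds (0,0).
      Q x y - (\<Sum>k<M. poly (c k) x * F k x y) = G x y * P x y + H x y * Pbar P x y"
    using assms(1) unfolding Rep_def cong_ideal2_def germ_eq_iff by blast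
  obtain G' H' where GH': "conv_ps2 G'" "conv_ps2 H'" and eq': "\<forall>\<^sub>F (x,y) in nhds (0,0).
      Q x y - (\<Sum>k<M. poly (c' k) x * F k x y) = G' x y * P x y + H' x y * Pbar P x y"
    using assms(2) unfolding Rep_def cong_ideal2_def germ_eq_iff by blast
  define d where "d = (\<lambda>k. c' k - c k)"
  \<comment> \<open>With g = G - G' and h = H - H', one has g P + h Pbar = (g + h) A + i (g - h) B =
    X (A + tB) + (i (g - h) - t X) B. Dividing by u turns A + tB into the product of the y - a_j and
    gives Y as the coefficient of B.\<close>
  define X where "X = (\<lambda>x y. G x y - G' x y + (H x y - H' x y))"
  define Y where "Y = (\<lambda>x y. (\<i> * (G x y - G' x y - (H x y - H' x y)) - complex_of_real t * X x y) * inverse (u x y))"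
  have cX: "conv_ps2 X" unfolding X_def by (intro conv_ps2_intros GH GH')
  have cY: "conv_ps2 Y" unfolding Y_def by (intro conv_ps2_intros cX GH GH' conv_ps2_inverse conv_u u_nz)
  have E: "\<forall>\<^sub>F (x,y) in nhds (0,0). (\<Sum>k<M. poly (d k) x * (\<Prod>j\<in>{k<..<M}. y - a j x)) =
         X x y * (\<Prod>j<M. y - a j x) + Y x y * B x y"
    using eq eq' factorization u_nonzero
  proof eventually_elim
    case (elim z)
    obtain x y where z: "z = (x, y)" by fastforce
    define S where "S = (\<Sum>k<M. poly (c k) x * (\<Prod>j\<in>{k<..<M}. y - a j x))"
    define S' where "S' = (\<Sum>k<M. poly (c' k) x * (\<Prod>j\<in>{k<..<M}. y - a j x))"
    define R where "R = (\<Prod>j<M. y - a j x)"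
    have 1: "Q x y - u x y * S = G x y * P x y + H x y * Pbar P x y"
      and 2: "Q x y - u x y * S' = G' x y * P x y + H' x y * Pbar P x y"
      and 3: "A x y + complex_of_real t * B x y = u x y * R" and 4: "u x y \<noteq> 0"
      using elim unfolding z prod.case S_def S'_def R_def newton_sum_F by blast+
    have dS: "(\<Sum>k<M. poly (d k) x * (\<Prod>j\<in>{k<..<M}. y - a j x)) = S' - S"
      unfolding S_def S'_def d_def by (simp add: sum_subtractf left_diff_distrib)
    have A: "A x y = u x y * R - complex_of_real t * B x y" using 3 by (simp add: algebra_simps)
    have "u x y * (S' - S) = (Q x y - u x y * S) - (Q x y - u x y * S')" by (simp add: algebra_simps)
    also have "\<dots> = X x y * A x y + \<i> * (G x y - G' x y - (H x y - H' x y)) * B x y"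
      unfolding 1 2 X_def A_B_eq[of x y] by (simp add: algebra_simps)
    also have "\<dots> = u x y * (X x y * R) + (\<i> * (G x y - G' x y - (H x y - H' x y)) - complex_of_real t * X x y) * B x y"
      unfolding A by (simp add: algebra_simps)
    also have "\<dots> = u x y * (X x y * R + Y x y * B x y)" using 4 unfolding Y_def by (simp add: distrib_left mult_ac)
    finally have "S' - S = X x y * R + Y x y * B x y" using 4 by simp
    then show ?case unfolding z prod.case dS R_def .
  qed
  have "\<forall>k<M. d k = 0"
  proof (rule newton_representation_unique[where n = M and a = a and B = B and N = N, OF _ _ _ _ _ _ cX cY E])
    show "\<exists>c>0. \<forall>\<^sub>F x in nhds 0. c * norm x ^ N j \<le> norm (B x (a j x))" if "j < M" for j
      using B_order[OF that] by (auto elim!: eventually_mono)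
    show "\<exists>c. \<forall>\<^sub>F x in nhds 0. norm (B x (a j x)) \<le> c * norm x ^ N j" if "j < M" for j
      using B_order[OF that] by (auto elim!: eventually_mono)
    show "degree (d k) < N k" if "k < M" for k
      unfolding d_def using assms that degree_diff_less[of "c' k" "N k" "c k"] by (auto simp: Rep_def)
  qed (rule conv_a a_0 conv_ps2_Bfun; assumption)+
  then show ?thesis using assms unfolding Rep_def d_def by (metis eq_iff_diff_eq_0 ext not_less)
qed

end

section \<open>Local integrability on squares\<close>

definition sq_box :: "real \<Rightarrow> (real \<times> real) set" where
  "sq_box r = {-r<..<r} \<times> {-r<..<r}"

lemma mem_sq_box: "(x, y) \<in> sq_box r \<longleftrightarrow> \<bar>x\<bar> < r \<and> \<bar>y\<bar> < r"
  by (auto simp: sq_box_def)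

lemma sq_box_mono: "s \<le> r \<Longrightarrow> sq_box s \<subseteq> sq_box r"
  by (auto simp: sq_box_def)

lemma open_sq_box: "open (sq_box r)"
  unfolding sq_box_def by (intro open_Times) auto

lemma sq_box_sets [measurable]: "sq_box r \<in> sets borel"
  using open_sq_box by (rule borel_open)

lemma open_contains_sq_box:
  assumes "open U" "(0,0) \<in> U" obtains r where "r > 0" "sq_box r \<subseteq> U"
proof -
  obtain d where d: "d > 0" "ball (0,0) d \<subseteq> U" using assms open_contains_ball by blast
  have "sq_box (d / 2) \<subseteq> ball (0,0) d"
  proof
    fix z assume "z \<in> sq_box (d / 2)"
    then obtain x y where z: "z = (x, y)" "\<bar>x\<bar> < d / 2" "\<bar>y\<bar> < d / 2" by (cases z) (auto simp: mem_sq_box)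
    have "dist (0,0) z \<le> \<bar>x\<bar> + \<bar>y\<bar>"
      unfolding z by (simp add: dist_Pair_Pair sqrt_sum_squares_le_sum_abs)
    then show "z \<in> ball (0,0) d" using z by simp
  qed
  then show thesis using d that[of "d / 2"] by auto
qed

abbreviation Lp_int :: "real \<Rightarrow> real \<Rightarrow> (real \<times> real \<Rightarrow> complex) \<Rightarrow> ennreal" where
  "Lp_int p r f \<equiv> \<integral>\<^sup>+z. ennreal (norm (f z) powr p) * indicator (sq_box r) z \<partial>lborel"

text \<open>The integral is taken in the extended nonnegative reals, so that iterated integration
  applies before finiteness is known.\<close>

definition Lp_box :: "real \<Rightarrow> real \<Rightarrow> (real \<times> real \<Rightarrow> complex) \<Rightarrow> bool" where
  "Lp_box p r f \<longleftrightarrow> set_borel_measurable lborel (sq_box r) f \<and>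
     Lp_int p r f < \<infinity>"

lemma set_borel_measurable_norm_powr:
  fixes f :: "'a \<Rightarrow> complex"
  assumes "set_borel_measurable M A f" "A \<in> sets M"
  shows "(\<lambda>z. indicator A z * norm (f z) powr p) \<in> borel_measurable M"
proof -
  have [measurable]: "(\<lambda>z. indicator A z *\<^sub>R f z) \<in> borel_measurable M" "A \<in> sets M"
    using assms by (auto simp: set_borel_measurable_def)
  have "(\<lambda>z. indicator A z * norm (indicator A z *\<^sub>R f z) powr p) \<in> borel_measurable M" by measurable
  also have "(\<lambda>z. indicator A z * norm (indicator A z *\<^sub>R f z) powr p) = (\<lambda>z. indicator A z * norm (f z) powr p)"
    by (auto simp: indicator_def)
  finally show ?thesis .
qed

lemma Lp_loc_iff_Lp_box: "Lp_loc p f \<longleftrightarrow> (\<exists>r>0. Lp_box p r f)"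
proof
  assume "Lp_loc p f"
  then obtain U where U: "open U" "(0,0) \<in> U" "set_borel_measurable lborel U f"
    "set_integrable lborel U (\<lambda>z. norm (f z) powr p)" unfolding Lp_loc_def by blast
  obtain r where r: "r > 0" "sq_box r \<subseteq> U" using open_contains_sq_box[OF U(1,2)] .
  have 1: "set_borel_measurable lborel (sq_box r) f"
    by (rule set_borel_measurable_subset[OF U(3) _ r(2)]) simp
  have "set_integrable lborel (sq_box r) (\<lambda>z. norm (f z) powr p)"
    by (rule set_integrable_subset[OF U(4) _ r(2)]) simp
  then have "(\<integral>\<^sup>+z. ennreal (norm (indicator (sq_box r) z *\<^sub>R norm (f z) powr p)) \<partial>lborel) < \<infinity>"
    unfolding set_integrable_def integrable_iff_bounded by blast
  also have "(\<lambda>z. ennreal (norm (indicator (sq_box r) z *\<^sub>R norm (f z) powr p))) = (\<lambda>z. ennreal (norm (f z) powr p) * indicator (sq_box r) z)"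
    by (auto simp: indicator_def)
  finally show "\<exists>r>0. Lp_box p r f" using 1 r(1) unfolding Lp_box_def by blast
next
  assume "\<exists>r>0. Lp_box p r f"
  then obtain r where r: "r > 0" "set_borel_measurable lborel (sq_box r) f"
     "Lp_int p r f < \<infinity>" unfolding Lp_box_def by blast
  have "(\<lambda>z. ennreal (norm (f z) powr p) * indicator (sq_box r) z) = (\<lambda>z. ennreal (norm (indicator (sq_box r) z *\<^sub>R norm (f z) powr p)))"
    by (auto simp: indicator_def)
  then have "set_integrable lborel (sq_box r) (\<lambda>z. norm (f z) powr p)"
    unfolding set_integrable_def integrable_iff_bounded
    using r(3) set_borel_measurable_norm_powr[OF r(2), of p] by simp
  then show "Lp_loc p f" unfolding Lp_loc_def
    using r open_sq_box[of r] by (intro exI[of _ "sq_box r"]) (auto simp: mem_sq_box)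
qed

lemma Lp_box_mono:
  assumes "Lp_box p r f" "s \<le> r" shows "Lp_box p s f"
  unfolding Lp_box_def
proof
  show "set_borel_measurable lborel (sq_box s) f"
    by (rule set_borel_measurable_subset[OF _ _ sq_box_mono[OF assms(2)]]) (use assms(1) in \<open>simp_all add: Lp_box_def\<close>)
  have "Lp_int p s f
     \<le> Lp_int p r f"
    using sq_box_mono[OF assms(2)] by (intro nn_integral_mono mult_left_mono) (auto simp: indicator_def)
  also have "\<dots> < \<infinity>" using assms(1) by (simp add: Lp_box_def)
  finally show "Lp_int p s f < \<infinity>" .
qed

lemma powr_add_le:
  fixes a b p :: real
  assumes "0 \<le> a" "0 \<le> b" "0 < p"
  shows "(a + b) powr p \<le> 2 powr p * (a powr p + b powr p)"
proof -
  have "(a + b) powr p \<le> (2 * max a b) powr p" using assms by (intro powr_mono2) auto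
  also have "\<dots> = 2 powr p * max a b powr p" using assms by (simp add: powr_mult)
  also have "\<dots> \<le> 2 powr p * (a powr p + b powr p)" by (intro mult_left_mono) (auto simp: max_def)
  finally show ?thesis .
qed

lemma Lp_box_add:
  assumes "Lp_box p r f" "Lp_box p r g" "p > 0" shows "Lp_box p r (\<lambda>z. f z + g z)"
  unfolding Lp_box_def
proof
  have m: "set_borel_measurable lborel (sq_box r) f" "set_borel_measurable lborel (sq_box r) g"
    using assms by (auto simp: Lp_box_def)
  show "set_borel_measurable lborel (sq_box r) (\<lambda>z. f z + g z)"
    using m unfolding set_borel_measurable_def by (simp add: scaleR_add_right)
  let ?F = "\<lambda>f z. ennreal (indicator (sq_box r) z * norm (f z) powr p)"
  have eq: "(\<lambda>z. ennreal (norm (h z) powr p) * indicator (sq_box r) z) = ?F h" for h :: "real \<times> real \<Rightarrow> complex"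
    by (auto simp: indicator_def)
  have mF: "?F f \<in> borel_measurable lborel" "?F g \<in> borel_measurable lborel"
    using set_borel_measurable_norm_powr[OF m(1), of p] set_borel_measurable_norm_powr[OF m(2), of p] by auto
  have "(\<integral>\<^sup>+z. ?F (\<lambda>z. f z + g z) z \<partial>lborel) \<le> (\<integral>\<^sup>+z. ennreal (2 powr p) * (?F f z + ?F g z) \<partial>lborel)"
  proof (rule nn_integral_mono)
    fix z
    have "norm (f z + g z) powr p \<le> (norm (f z) + norm (g z)) powr p"
      using assms(3) by (intro powr_mono2 norm_triangle_ineq) auto
    also have "\<dots> \<le> 2 powr p * (norm (f z) powr p + norm (g z) powr p)"
      using assms(3) by (intro powr_add_le) auto
    finally have "indicator (sq_box r) z * norm (f z + g z) powr p \<le>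
        2 powr p * (indicator (sq_box r) z * norm (f z) powr p + indicator (sq_box r) z * norm (g z) powr p)"
      by (auto simp: indicator_def)
    then show "?F (\<lambda>z. f z + g z) z \<le> ennreal (2 powr p) * (?F f z + ?F g z)"
      by (simp flip: ennreal_plus ennreal_mult add: ennreal_leI)
  qed
  also have "\<dots> = ennreal (2 powr p) * ((\<integral>\<^sup>+z. ?F f z \<partial>lborel) + (\<integral>\<^sup>+z. ?F g z \<partial>lborel))"
    using mF by (simp add: nn_integral_cmult nn_integral_add)
  also have "\<dots> < \<infinity>"
    using assms(1,2) unfolding Lp_box_def eq by (simp add: ennreal_mult_less_top)
  finally show "(\<integral>\<^sup>+z. ennreal (norm (f z + g z) powr p) * indicator (sq_box r) z \<partial>lborel) < \<infinity>"
    unfolding eq .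
qed

lemma Lp_loc_add:
  assumes "Lp_loc p f" "Lp_loc p g" "p > 0" shows "Lp_loc p (\<lambda>z. f z + g z)"
proof -
  obtain r s where "r > 0" "s > 0" "Lp_box p r f" "Lp_box p s g"
    using assms unfolding Lp_loc_iff_Lp_box by blast
  then have "Lp_box p (min r s) (\<lambda>z. f z + g z)" "min r s > 0"
    using assms(3) by (auto intro!: Lp_box_add intro: Lp_box_mono)
  then show ?thesis unfolding Lp_loc_iff_Lp_box by blast
qed

lemma Lp_loc_cong:
  assumes "r > 0" "\<And>z. z \<in> sq_box r \<Longrightarrow> f z = g z" "Lp_loc p f" shows "Lp_loc p g"
proof -
  obtain s where s: "s > 0" "Lp_box p s f" using assms unfolding Lp_loc_iff_Lp_box by blast
  define t where "t = min r s"
  have t: "t > 0" "t \<le> r" "t \<le> s" using assms s by (auto simp: t_def)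
  have eq: "f z = g z" if "z \<in> sq_box t" for z using assms(2) sq_box_mono[OF t(2)] that by blast
  have "Lp_box p t f" using Lp_box_mono[OF s(2) t(3)] .
  moreover have "(\<lambda>z. indicator (sq_box t) z *\<^sub>R f z) = (\<lambda>z. indicator (sq_box t) z *\<^sub>R g z)"
    "(\<lambda>z. ennreal (norm (f z) powr p) * indicator (sq_box t) z) = (\<lambda>z. ennreal (norm (g z) powr p) * indicator (sq_box t) z)"
    using eq by (fastforce simp: indicator_def fun_eq_iff)+
  ultimately have "Lp_box p t g" unfolding Lp_box_def set_borel_measurable_def by simp
  then show ?thesis using t(1) unfolding Lp_loc_iff_Lp_box by blast
qed

lemma emeasure_sq_box_finite: "emeasure lborel (sq_box r) < \<infinity>"
proof -
  have "bounded (sq_box r)" unfolding sq_box_def by (intro bounded_Times) auto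
  then show ?thesis by (rule emeasure_bounded_finite)
qed

lemma Lp_loc_bounded:
  assumes "r > 0" "set_borel_measurable lborel (sq_box r) f" "\<And>z. z \<in> sq_box r \<Longrightarrow> norm (f z) \<le> K" "p > 0"
  shows "Lp_loc p f"
proof -
  have "Lp_int p r f
     \<le> (\<integral>\<^sup>+z. ennreal (K powr p) * indicator (sq_box r) z \<partial>lborel)"
    using assms by (intro nn_integral_mono) (auto simp: indicator_def intro!: ennreal_leI powr_mono2)
  also have "\<dots> < \<infinity>" using emeasure_sq_box_finite[of r] by (simp add: nn_integral_cmult ennreal_mult_less_top)
  finally show ?thesis using assms unfolding Lp_loc_iff_Lp_box Lp_box_def by blast
qed

section \<open>Model integrals and two criteria, one for integrability and one against it\<close>

lemma nn_integral_abs_powr_finite: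
  fixes \<gamma> c :: real
  assumes "\<gamma> > -1" "c \<ge> 0"
  shows "(\<integral>\<^sup>+s. ennreal (\<bar>s\<bar> powr \<gamma>) * indicator {-c..c} s \<partial>lborel) < \<infinity>"
proof -
  have 0: "(\<integral>\<^sup>+s. ennreal (s powr \<gamma>) * indicator {0..c} s \<partial>lborel) = ennreal (c powr (\<gamma> + 1) / (\<gamma> + 1))"
    by (rule nn_integral_has_integral_lebesgue'[OF _ has_integral_powr_from_0[OF assms]]) auto
  have 1: "(\<lambda>s. ennreal (s powr \<gamma>) * indicator {0..c} s) = (\<lambda>s. ennreal (\<bar>s\<bar> powr \<gamma>) * indicator {0..c} s)"
    by (auto simp: indicator_def)
  have pos: "(\<integral>\<^sup>+s. ennreal (\<bar>s\<bar> powr \<gamma>) * indicator {0..c} s \<partial>lborel) < \<infinity>"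
    using 0 unfolding 1 by simp
  have "(\<integral>\<^sup>+s. ennreal (\<bar>s\<bar> powr \<gamma>) * indicator {-c..0} s \<partial>lborel)
     = (\<integral>\<^sup>+s. ennreal (\<bar>0 + (-1) * s\<bar> powr \<gamma>) * indicator {-c..0} (0 + (-1) * s) \<partial>lborel)"
    by (subst nn_integral_real_affine[where c = "-1" and t = 0]) auto
  also have "\<dots> = (\<integral>\<^sup>+s. ennreal (\<bar>s\<bar> powr \<gamma>) * indicator {0..c} s \<partial>lborel)"
    by (intro nn_integral_cong) (auto simp: indicator_def)
  finally have neg: "(\<integral>\<^sup>+s. ennreal (\<bar>s\<bar> powr \<gamma>) * indicator {-c..0} s \<partial>lborel) < \<infinity>" using pos by simp
  have "(\<integral>\<^sup>+s. ennreal (\<bar>s\<bar> powr \<gamma>) * indicator {-c..c} s \<partial>lborel) \<le>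
     (\<integral>\<^sup>+s. ennreal (\<bar>s\<bar> powr \<gamma>) * indicator {-c..0} s + ennreal (\<bar>s\<bar> powr \<gamma>) * indicator {0..c} s \<partial>lborel)"
    by (intro nn_integral_mono) (auto simp: indicator_def)
  also have "\<dots> = (\<integral>\<^sup>+s. ennreal (\<bar>s\<bar> powr \<gamma>) * indicator {-c..0} s \<partial>lborel) + (\<integral>\<^sup>+s. ennreal (\<bar>s\<bar> powr \<gamma>) * indicator {0..c} s \<partial>lborel)"
    by (rule nn_integral_add) auto
  also have "\<dots> < \<infinity>" using pos neg by simp
  finally show ?thesis .
qed

lemma nn_integral_inverse_infinite:
  fixes \<epsilon> \<kappa> :: real
  assumes "\<epsilon> > 0" "\<kappa> > 0"
  shows "(\<integral>\<^sup>+x. ennreal (\<kappa> / x) * indicator {0<..<\<epsilon>} x \<partial>lborel) = \<infinity>"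
proof (rule ccontr)
  assume "\<not> ?thesis"
  then have fin: "(\<integral>\<^sup>+x. ennreal (\<kappa> / x) * indicator {0<..<\<epsilon>} x \<partial>lborel) < \<infinity>"
    by (simp add: less_top)
  have ge: "ennreal (\<kappa> * (ln (\<epsilon> / 2) - ln a)) \<le> (\<integral>\<^sup>+x. ennreal (\<kappa> / x) * indicator {0<..<\<epsilon>} x \<partial>lborel)"
    if a: "0 < a" "a < \<epsilon> / 2" for a
  proof -
    have "((\<lambda>x. \<kappa> / x) has_integral (\<kappa> * ln (\<epsilon> / 2) - \<kappa> * ln a)) {a..\<epsilon>/2}"
      using a assms by (intro fundamental_theorem_of_calculus)
        (auto intro!: derivative_eq_intros simp flip: has_real_derivative_iff_has_vector_derivative)
    then have "(\<integral>\<^sup>+x. ennreal (\<kappa> / x) * indicator {a..\<epsilon>/2} x \<partial>lborel) = ennreal (\<kappa> * ln (\<epsilon> / 2) - \<kappa> * ln a)"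
      using a assms by (intro nn_integral_has_integral_lebesgue') auto
    moreover have "(\<integral>\<^sup>+x. ennreal (\<kappa> / x) * indicator {a..\<epsilon>/2} x \<partial>lborel) \<le> (\<integral>\<^sup>+x. ennreal (\<kappa> / x) * indicator {0<..<\<epsilon>} x \<partial>lborel)"
      using a assms by (intro nn_integral_mono mult_left_mono) (auto simp: indicator_def)
    ultimately show ?thesis by (simp add: algebra_simps)
  qed
  obtain C where C: "C \<ge> 0" "(\<integral>\<^sup>+x. ennreal (\<kappa> / x) * indicator {0<..<\<epsilon>} x \<partial>lborel) = ennreal C"
    using fin by (cases "\<integral>\<^sup>+x. ennreal (\<kappa> / x) * indicator {0<..<\<epsilon>} x \<partial>lborel") auto
  \<comment> \<open>Chosen so that the integral from a to \<epsilon>/2 equals C + 1, more than the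
    supposed total C.\<close>
  define a where "a = \<epsilon> / 2 * exp (- (C + 1) / \<kappa>)"
  have "exp (- (C + 1) / \<kappa>) < 1" using C assms by (simp add: divide_neg_pos)
  then have a: "0 < a" "a < \<epsilon> / 2" using assms by (auto simp: a_def)
  have "ln a = ln (\<epsilon> / 2) - (C + 1) / \<kappa>" using assms by (simp add: a_def ln_mult ln_div diff_divide_distrib add_divide_distrib)
  then have "\<kappa> * (ln (\<epsilon> / 2) - ln a) = C + 1" using assms by simp
  with ge[OF a] C show False by (simp add: ennreal_le_iff)
qed

lemma nn_integral_sq_box:
  fixes f :: "real \<times> real \<Rightarrow> complex"
  assumes "set_borel_measurable lborel (sq_box r) f"
  shows "(\<lambda>z. ennreal (norm (f z) powr p) * indicator (sq_box r) z) \<in> borel_measurable borel"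
    "Lp_int p r f
      = (\<integral>\<^sup>+x. (\<integral>\<^sup>+y. ennreal (norm (f (x,y)) powr p) * indicator (sq_box r) (x,y) \<partial>lborel) \<partial>lborel)"
proof -
  have "(\<lambda>z. ennreal (norm (f z) powr p) * indicator (sq_box r) z) = (\<lambda>z. ennreal (indicator (sq_box r) z * norm (f z) powr p))"
    by (auto simp: indicator_def)
  then show m: "(\<lambda>z. ennreal (norm (f z) powr p) * indicator (sq_box r) z) \<in> borel_measurable borel"
    using set_borel_measurable_norm_powr[OF assms, of p] by simp
  then have "(\<lambda>z. ennreal (norm (f z) powr p) * indicator (sq_box r) z) \<in> borel_measurable (lborel \<Otimes>\<^sub>M lborel)"
    by (simp add: lborel_prod)
  from lborel.nn_integral_fst[OF this]
  show "Lp_int p r f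
      = (\<integral>\<^sup>+x. (\<integral>\<^sup>+y. ennreal (norm (f (x,y)) powr p) * indicator (sq_box r) (x,y) \<partial>lborel) \<partial>lborel)"
    by (simp add: lborel_prod)
qed

text \<open>The weight \<open>\<bar>y - \<alpha>\<bar> powr (\<eta> - 1)\<close> with a small \<open>\<eta> > 0\<close> replaces the exact integral in \<open>y\<close>,
  which would produce a logarithm when \<open>p = 1\<close>.\<close>

lemma Lp_box_if_branch_bounds:
  fixes \<alpha> :: "'i \<Rightarrow> real \<Rightarrow> real" and l :: "'i \<Rightarrow> nat" and e :: "'i \<Rightarrow> real" and p r K :: real
    and f :: "real \<times> real \<Rightarrow> complex"
  assumes p: "p \<ge> 1" and r: "0 < r" "r \<le> 1" and S: "finite S" and K: "K \<ge> 0"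
    and f: "set_borel_measurable lborel (sq_box r) f"
    and \<alpha>: "\<And>j x. j \<in> S \<Longrightarrow> \<bar>x\<bar> < r \<Longrightarrow> \<bar>\<alpha> j x\<bar> < 1"
    and l: "\<And>j. j \<in> S \<Longrightarrow> l j \<ge> 1"
    and e: "\<And>j. j \<in> S \<Longrightarrow> p * e j - l j * (p - 1) > -1"
    and bound: "\<And>x y. \<bar>x\<bar> < r \<Longrightarrow> \<bar>y\<bar> < r \<Longrightarrow> x \<noteq> 0 \<Longrightarrow>
       \<exists>j\<in>S. norm (f (x, y)) \<le> K * \<bar>x\<bar> powr e j / (\<bar>y - \<alpha> j x\<bar> + \<bar>x\<bar> ^ l j)"
  shows "Lp_box p r f"
proof -
  \<comment> \<open>The product l \<eta> consumes at most half of the excess of p e - l (p - 1) over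
    -1, so the exponent \<beta> left for |x| stays above -1. The cap 1 keeps \<eta> - 1 \<le> 0, so
    that negative powers may be estimated through lower bounds of the base.\<close>
  define \<eta> where "\<eta> = (\<lambda>j. min 1 ((p * e j - l j * (p - 1) + 1) / (2 * l j)))"
  define \<beta> where "\<beta> = (\<lambda>j. p * e j - l j * (p - 1 + \<eta> j))"
  have \<eta>: "0 < \<eta> j" "\<eta> j \<le> 1" if "j \<in> S" for j
    using e[OF that] l[OF that] by (auto simp: \<eta>_def)
  have \<beta>: "\<beta> j > -1" if "j \<in> S" for j
  proof -
    have "\<eta> j \<le> (p * e j - l j * (p - 1) + 1) / (2 * l j)" by (simp add: \<eta>_def)
    then have "l j * \<eta> j \<le> l j * ((p * e j - l j * (p - 1) + 1) / (2 * l j))"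
      by (rule mult_left_mono) simp
    also have "\<dots> = (p * e j - l j * (p - 1) + 1) / 2" using l[OF that] by simp
    finally show ?thesis using e[OF that] by (simp add: \<beta>_def algebra_simps)
  qed
  \<comment> \<open>After the shift y = \<alpha> j x + s the variable s stays in [-2, 2], because
    |y| < r \<le> 1 and |\<alpha> j x| < 1.\<close>
  define C where "C = (\<lambda>j. \<integral>\<^sup>+s. ennreal (\<bar>s\<bar> powr (\<eta> j - 1)) * indicator {-2..2} s \<partial>lborel)"
  have C: "C j < \<infinity>" if "j \<in> S" for j
    unfolding C_def using \<eta>[OF that] by (intro nn_integral_abs_powr_finite) auto
  have pt: "norm (f (x, y)) powr p \<le> (\<Sum>j\<in>S. K powr p * \<bar>x\<bar> powr \<beta> j * \<bar>y - \<alpha> j x\<bar> powr (\<eta> j - 1))"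
    if xy: "\<bar>x\<bar> < r" "\<bar>y\<bar> < r" "x \<noteq> 0" "\<forall>j\<in>S. y \<noteq> \<alpha> j x" for x y
  proof -
    obtain j where j: "j \<in> S" and b: "norm (f (x, y)) \<le> K * \<bar>x\<bar> powr e j / (\<bar>y - \<alpha> j x\<bar> + \<bar>x\<bar> ^ l j)"
      using bound[OF xy(1-3)] by blast
    define d where "d = \<bar>y - \<alpha> j x\<bar> + \<bar>x\<bar> ^ l j"
    have yj: "\<bar>y - \<alpha> j x\<bar> > 0" using xy(4) j by auto
    have xl: "\<bar>x\<bar> ^ l j = \<bar>x\<bar> powr l j" using xy(3) by (simp add: powr_realpow)
    have xl0: "\<bar>x\<bar> ^ l j > 0" using xy(3) by simp
    have d: "d > 0" "d \<ge> \<bar>y - \<alpha> j x\<bar>" "d \<ge> \<bar>x\<bar> ^ l j" using yj xl0 unfolding d_def by linarith+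
    have "norm (f (x, y)) powr p \<le> (K * \<bar>x\<bar> powr e j / d) powr p"
      using b p unfolding d_def by (intro powr_mono2) auto
    also have "\<dots> = K powr p * \<bar>x\<bar> powr (e j * p) * d powr (- p)"
      using K d by (simp add: powr_mult powr_divide powr_powr powr_minus_divide)
    \<comment> \<open>Both exponents are nonpositive. The first power is bounded through d \<ge> |y
      - \<alpha>| and remains integrable in y; the second is bounded through d \<ge> |x|^l.\<close>
    also have "d powr (- p) = d powr (\<eta> j - 1) * d powr (- (p - 1 + \<eta> j))"
      using d by (simp flip: powr_add)
    also have "K powr p * \<bar>x\<bar> powr (e j * p) * (d powr (\<eta> j - 1) * d powr (- (p - 1 + \<eta> j))) \<le>
       K powr p * \<bar>x\<bar> powr (e j * p) * (\<bar>y - \<alpha> j x\<bar> powr (\<eta> j - 1) * (\<bar>x\<bar> ^ l j) powr (- (p - 1 + \<eta> j)))"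
      using d yj xl0 \<eta>[OF j] p by (intro mult_left_mono mult_mono powr_mono2') auto
    also have "(\<bar>x\<bar> ^ l j) powr (- (p - 1 + \<eta> j)) = \<bar>x\<bar> powr (- (l j * (p - 1 + \<eta> j)))"
      unfolding xl powr_powr by (simp add: algebra_simps)
    also have "K powr p * \<bar>x\<bar> powr (e j * p) * (\<bar>y - \<alpha> j x\<bar> powr (\<eta> j - 1) * \<bar>x\<bar> powr (- (l j * (p - 1 + \<eta> j))))
        = K powr p * (\<bar>x\<bar> powr (e j * p) * \<bar>x\<bar> powr (- (l j * (p - 1 + \<eta> j)))) * \<bar>y - \<alpha> j x\<bar> powr (\<eta> j - 1)"
      by (simp add: mult_ac)
    also have "\<bar>x\<bar> powr (e j * p) * \<bar>x\<bar> powr (- (l j * (p - 1 + \<eta> j))) = \<bar>x\<bar> powr \<beta> j"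
      unfolding \<beta>_def powr_add[symmetric] by (simp add: mult.commute)
    also have "K powr p * \<bar>x\<bar> powr \<beta> j * \<bar>y - \<alpha> j x\<bar> powr (\<eta> j - 1) \<le> (\<Sum>j\<in>S. K powr p * \<bar>x\<bar> powr \<beta> j * \<bar>y - \<alpha> j x\<bar> powr (\<eta> j - 1))"
      by (rule member_le_sum[OF j]) (use S in auto)
    finally show ?thesis .
  qed
  have inner: "(\<integral>\<^sup>+y. ennreal (norm (f (x,y)) powr p) * indicator (sq_box r) (x,y) \<partial>lborel)
     \<le> (\<Sum>j\<in>S. ennreal (K powr p * \<bar>x\<bar> powr \<beta> j) * C j) * indicator {-r<..<r} x" if "x \<noteq> 0" for x
  proof (cases "\<bar>x\<bar> < r")
    case False
    then show ?thesis by (auto simp: mem_sq_box indicator_def)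
  next
    case True
    \<comment> \<open>On a branch the majorant breaks down, since
      \<open>0 powr (\<eta> j - 1)\<close> is 0; for each x these finitely many y form a null
      set.\<close>
    have "AE y in lborel. \<forall>j\<in>S. y \<noteq> \<alpha> j x"
      using S AE_lborel_singleton by (subst AE_finite_all) auto
    then have "(\<integral>\<^sup>+y. ennreal (norm (f (x,y)) powr p) * indicator (sq_box r) (x,y) \<partial>lborel)
      \<le> (\<integral>\<^sup>+y. (\<Sum>j\<in>S. ennreal (K powr p * \<bar>x\<bar> powr \<beta> j) * (ennreal (\<bar>y - \<alpha> j x\<bar> powr (\<eta> j - 1)) * indicator {-r<..<r} y)) \<partial>lborel)"
    proof (intro nn_integral_mono_AE, eventually_elim)
      case (elim y)
      show ?case
      proof (cases "\<bar>y\<bar> < r")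
        case True
        have "ennreal (norm (f (x,y)) powr p) \<le> ennreal (\<Sum>j\<in>S. K powr p * \<bar>x\<bar> powr \<beta> j * \<bar>y - \<alpha> j x\<bar> powr (\<eta> j - 1))"
          using pt[OF \<open>\<bar>x\<bar> < r\<close> True \<open>x \<noteq> 0\<close> elim(2)] by (rule ennreal_leI)
        also have "\<dots> = (\<Sum>j\<in>S. ennreal (K powr p * \<bar>x\<bar> powr \<beta> j) * ennreal (\<bar>y - \<alpha> j x\<bar> powr (\<eta> j - 1)))"
          by (subst sum_ennreal[symmetric]) (auto simp: ennreal_mult')
        finally show ?thesis using True \<open>\<bar>x\<bar> < r\<close> by (auto simp: indicator_def mem_sq_box abs_less_iff)
      qed (auto simp: indicator_def mem_sq_box)
    qed
    also have "\<dots> = (\<Sum>j\<in>S. ennreal (K powr p * \<bar>x\<bar> powr \<beta> j) * (\<integral>\<^sup>+y. ennreal (\<bar>y - \<alpha> j x\<bar> powr (\<eta> j - 1)) * indicator {-r<..<r} y \<partial>lborel))"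
      by (subst nn_integral_sum) (auto intro!: sum.cong nn_integral_cmult)
    also have "\<dots> \<le> (\<Sum>j\<in>S. ennreal (K powr p * \<bar>x\<bar> powr \<beta> j) * C j)"
    proof (intro sum_mono mult_left_mono)
      fix j assume j: "j \<in> S"
      have "(\<integral>\<^sup>+y. ennreal (\<bar>y - \<alpha> j x\<bar> powr (\<eta> j - 1)) * indicator {-r<..<r} y \<partial>lborel)
         = (\<integral>\<^sup>+s. ennreal (\<bar>(\<alpha> j x + 1 * s) - \<alpha> j x\<bar> powr (\<eta> j - 1)) * indicator {-r<..<r} (\<alpha> j x + 1 * s) \<partial>lborel)"
        by (subst nn_integral_real_affine[where c = 1 and t = "\<alpha> j x"]) auto
      also have "\<dots> \<le> C j"
        unfolding C_def using \<alpha>[OF j True] r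
        by (intro nn_integral_mono mult_mono) (auto simp: indicator_def abs_less_iff)
      finally show "(\<integral>\<^sup>+y. ennreal (\<bar>y - \<alpha> j x\<bar> powr (\<eta> j - 1)) * indicator {-r<..<r} y \<partial>lborel) \<le> C j" .
    qed auto
    finally show ?thesis using True by (auto simp: indicator_def abs_less_iff)
  qed
  have "Lp_int p r f
     \<le> (\<integral>\<^sup>+x. (\<Sum>j\<in>S. ennreal (K powr p * \<bar>x\<bar> powr \<beta> j) * C j) * indicator {-r<..<r} x \<partial>lborel)"
    unfolding nn_integral_sq_box(2)[OF f]
    by (rule nn_integral_mono_AE, rule eventually_mono[OF AE_lborel_singleton[of 0] inner])
  also have "\<dots> = (\<integral>\<^sup>+x. (\<Sum>j\<in>S. ennreal (K powr p) * C j * (ennreal (\<bar>x\<bar> powr \<beta> j) * indicator {-r<..<r} x)) \<partial>lborel)"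
    unfolding sum_distrib_right by (intro nn_integral_cong sum.cong refl) (simp add: ennreal_mult' mult_ac)
  also have "\<dots> = (\<Sum>j\<in>S. ennreal (K powr p) * C j * (\<integral>\<^sup>+x. ennreal (\<bar>x\<bar> powr \<beta> j) * indicator {-r<..<r} x \<partial>lborel))"
    by (subst nn_integral_sum) (auto intro!: sum.cong nn_integral_cmult)
  also have "\<dots> < \<infinity>"
  proof -
    have "(\<integral>\<^sup>+x. ennreal (\<bar>x\<bar> powr \<beta> j) * indicator {-r<..<r} x \<partial>lborel) < \<infinity>" if "j \<in> S" for j
    proof -
      have "(\<integral>\<^sup>+x. ennreal (\<bar>x\<bar> powr \<beta> j) * indicator {-r<..<r} x \<partial>lborel) \<le> (\<integral>\<^sup>+x. ennreal (\<bar>x\<bar> powr \<beta> j) * indicator {-r..r} x \<partial>lborel)"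
        by (intro nn_integral_mono mult_left_mono) (auto simp: indicator_def)
      also have "\<dots> < \<infinity>" using \<beta>[OF that] r by (intro nn_integral_abs_powr_finite) auto
      finally show ?thesis .
    qed
    with C show ?thesis using S by (auto simp: ennreal_mult_less_top)
  qed
  finally show ?thesis using f unfolding Lp_box_def by blast
qed

text \<open>For each i the point y = \<alpha> x + \<delta> i x^l s runs with s over a segment, with
  Jacobian at least \<delta> x^l. The integral over s is thus at most 1/(\<delta> x^l) times the
  integral over the whole vertical section, and overlapping segments do no harm. The hypothesis then
  forces every section to carry at least c/x, and 1/x is not integrable at 0.\<close>

lemma not_Lp_box_if_lower_bound:
  fixes \<alpha> :: "real \<Rightarrow> real"
  assumes f: "Lp_box p r f" and \<epsilon>: "0 < \<epsilon>" "\<epsilon> \<le> r" and \<delta>: "\<delta> > 0" and \<kappa>: "\<kappa> > 0"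
    and inbox: "\<And>x s i. 0 < x \<Longrightarrow> x < \<epsilon> \<Longrightarrow> 0 < s \<Longrightarrow> s < 1 \<Longrightarrow> i \<in> {1..n} \<Longrightarrow> \<bar>\<alpha> x + \<delta> * real i * x ^ l * s\<bar> < r"
    and lower: "\<And>x s. 0 < x \<Longrightarrow> x < \<epsilon> \<Longrightarrow> 0 < s \<Longrightarrow> s < 1 \<Longrightarrow>
       \<kappa> / x ^ Suc l \<le> (\<Sum>i\<in>{1..n}. norm (f (x, \<alpha> x + \<delta> * real i * x ^ l * s)) powr p)"
  shows False
proof -
  have fm: "set_borel_measurable lborel (sq_box r) f" using f by (simp add: Lp_box_def)
  define h where "h = (\<lambda>x y. ennreal (norm (f (x,y)) powr p) * indicator (sq_box r) (x,y))"
  have hm [measurable]: "h x \<in> borel_measurable borel" for x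
  proof -
    have "(\<lambda>y. (\<lambda>z. ennreal (norm (f z) powr p) * indicator (sq_box r) z) (x, y)) \<in> borel_measurable borel"
      by (rule measurable_compose[OF _ nn_integral_sq_box(1)[OF fm]]) (auto simp: borel_prod[symmetric])
    then show ?thesis unfolding h_def .
  qed
  \<comment> \<open>The denominator n + 1 instead of n keeps c positive even for n = 0.\<close>
  define c where "c = \<kappa> * \<delta> / (real n + 1)"
  have c: "c > 0" using \<kappa> \<delta> by (simp add: c_def)
  have main: "ennreal (c / x) \<le> (\<integral>\<^sup>+y. h x y \<partial>lborel)" if x: "0 < x" "x < \<epsilon>" for x
  proof -
    have "ennreal (\<kappa> / x ^ Suc l) = (\<integral>\<^sup>+s. ennreal (\<kappa> / x ^ Suc l) * indicator {0<..<1::real} s \<partial>lborel)"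
      by (simp add: nn_integral_cmult)
    also have "\<dots> \<le> (\<integral>\<^sup>+s. (\<Sum>i\<in>{1..n}. h x (\<alpha> x + \<delta> * real i * x ^ l * s)) \<partial>lborel)"
    proof (rule nn_integral_mono)
      fix s :: real
      show "ennreal (\<kappa> / x ^ Suc l) * indicator {0<..<1} s \<le> (\<Sum>i\<in>{1..n}. h x (\<alpha> x + \<delta> * real i * x ^ l * s))"
      proof (cases "0 < s \<and> s < 1")
        case True
        then have "h x (\<alpha> x + \<delta> * real i * x ^ l * s) = ennreal (norm (f (x, \<alpha> x + \<delta> * real i * x ^ l * s)) powr p)"
          if "i \<in> {1..n}" for i
          using inbox[OF x, of s i] that x \<epsilon> by (auto simp: h_def mem_sq_box indicator_def)
        then have "(\<Sum>i\<in>{1..n}. h x (\<alpha> x + \<delta> * real i * x ^ l * s)) = (\<Sum>i\<in>{1..n}. ennreal (norm (f (x, \<alpha> x + \<delta> * real i * x ^ l * s)) powr p))"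
          by (rule sum.cong[OF refl])
        also have "\<dots> = ennreal (\<Sum>i\<in>{1..n}. norm (f (x, \<alpha> x + \<delta> * real i * x ^ l * s)) powr p)"
          by (rule sum_ennreal) simp
        finally show ?thesis using lower[OF x, of s] True by (auto intro!: ennreal_leI)
      qed (auto simp: indicator_def)
    qed
    also have "\<dots> = (\<Sum>i\<in>{1..n}. \<integral>\<^sup>+s. h x (\<alpha> x + \<delta> * real i * x ^ l * s) \<partial>lborel)"
      by (rule nn_integral_sum) measurable
    also have "\<dots> \<le> (\<Sum>i\<in>{1..n}. ennreal (1 / (\<delta> * x ^ l)) * (\<integral>\<^sup>+y. h x y \<partial>lborel))"
    proof (rule sum_mono)
      fix i assume i: "i \<in> {1..n}"
      define k where "k = \<delta> * real i * x ^ l"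
      have k: "k > 0" "k \<ge> \<delta> * x ^ l"
        using i \<delta> x by (auto simp: k_def mult_right_mono)
      have "(\<integral>\<^sup>+y. h x y \<partial>lborel) = ennreal k * (\<integral>\<^sup>+s. h x (\<alpha> x + k * s) \<partial>lborel)"
        using nn_integral_real_affine[of "h x" k "\<alpha> x"] k by simp
      then have "ennreal (1 / k) * (\<integral>\<^sup>+y. h x y \<partial>lborel) = ennreal (1 / k) * ennreal k * (\<integral>\<^sup>+s. h x (\<alpha> x + k * s) \<partial>lborel)"
        by (simp add: mult.assoc)
      also have "ennreal (1 / k) * ennreal k = 1" using k by (simp flip: ennreal_mult)
      finally have "(\<integral>\<^sup>+s. h x (\<alpha> x + k * s) \<partial>lborel) = ennreal (1 / k) * (\<integral>\<^sup>+y. h x y \<partial>lborel)" by simp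
      also have "\<dots> \<le> ennreal (1 / (\<delta> * x ^ l)) * (\<integral>\<^sup>+y. h x y \<partial>lborel)"
        using k \<delta> x by (intro mult_right_mono ennreal_leI) (auto simp: frac_le)
      finally show "(\<integral>\<^sup>+s. h x (\<alpha> x + \<delta> * real i * x ^ l * s) \<partial>lborel) \<le> ennreal (1 / (\<delta> * x ^ l)) * (\<integral>\<^sup>+y. h x y \<partial>lborel)"
        by (simp add: k_def)
    qed
    also have "\<dots> = ennreal (real n / (\<delta> * x ^ l)) * (\<integral>\<^sup>+y. h x y \<partial>lborel)"
      using \<delta> x by (simp add: ennreal_of_nat_eq_real_of_nat mult.assoc[symmetric] flip: ennreal_mult)
    also have "\<dots> \<le> ennreal ((real n + 1) / (\<delta> * x ^ l)) * (\<integral>\<^sup>+y. h x y \<partial>lborel)"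
      using \<delta> x by (intro mult_right_mono ennreal_leI divide_right_mono) auto
    finally have "ennreal (\<delta> * x ^ l / (real n + 1)) * ennreal (\<kappa> / x ^ Suc l) \<le>
      ennreal (\<delta> * x ^ l / (real n + 1)) * (ennreal ((real n + 1) / (\<delta> * x ^ l)) * (\<integral>\<^sup>+y. h x y \<partial>lborel))"
      by (rule mult_left_mono) simp
    moreover have "ennreal (\<delta> * x ^ l / (real n + 1)) * ennreal (\<kappa> / x ^ Suc l) = ennreal (c / x)"
      using \<delta> x \<kappa> by (simp add: c_def field_simps flip: ennreal_mult)
    moreover have "ennreal (\<delta> * x ^ l / (real n + 1)) * (ennreal ((real n + 1) / (\<delta> * x ^ l)) * (\<integral>\<^sup>+y. h x y \<partial>lborel)) = (\<integral>\<^sup>+y. h x y \<partial>lborel)"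
    proof -
      have "\<delta> * x ^ l / (real n + 1) * ((real n + 1) / (\<delta> * x ^ l)) = 1" using \<delta> x by simp
      then have "ennreal (\<delta> * x ^ l / (real n + 1)) * ennreal ((real n + 1) / (\<delta> * x ^ l)) = 1"
        using \<delta> x by (subst ennreal_mult[symmetric]) auto
      then show ?thesis by (simp add: mult.assoc[symmetric])
    qed
    ultimately show ?thesis by simp
  qed
  have "(\<integral>\<^sup>+x. ennreal (c / x) * indicator {0<..<\<epsilon>} x \<partial>lborel) \<le> (\<integral>\<^sup>+x. (\<integral>\<^sup>+y. h x y \<partial>lborel) \<partial>lborel)"
    using main by (intro nn_integral_mono) (auto simp: indicator_def)
  also have "\<dots> = Lp_int p r f"
    unfolding nn_integral_sq_box(2)[OF fm] h_def ..
  also have "\<dots> < \<infinity>" using f by (simp add: Lp_box_def)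
  finally show False using nn_integral_inverse_infinite[OF \<epsilon>(1) c] by simp
qed

section \<open>Restriction to real points, polynomial interpolation and dependence on the class
  modulo the ideal\<close>

lemma eventually_nhds_of_real:
  assumes "eventually P (nhds (0::complex))"
  shows "\<forall>\<^sub>F x in nhds (0::real). P (of_real x)"
proof -
  obtain d where d: "d > 0" "\<And>z. dist z 0 < d \<Longrightarrow> P z" using assms unfolding eventually_nhds_metric by blast
  then show ?thesis unfolding eventually_nhds_metric by (intro exI[of _ d]) auto
qed

lemma has_ps_real_valued:
  assumes "has_ps (\<lambda>n. complex_of_real (b n)) f"
  shows "\<forall>\<^sub>F x in nhds (0::real). f (of_real x) \<in> \<real>"
proof -
  obtain r where r: "r > 0" "\<And>x. norm x < r \<Longrightarrow> (\<lambda>n. complex_of_real (b n) * x ^ n) sums f x"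
    using assms unfolding has_ps_def by blast
  have "f (of_real x) \<in> \<real>" if "\<bar>x\<bar> < r" for x
  proof -
    have "(\<lambda>n. Im (complex_of_real (b n) * complex_of_real x ^ n)) sums Im (f (of_real x))"
      using sums_Im[OF r(2)[of "complex_of_real x"]] that by simp
    moreover have "(\<lambda>n. Im (complex_of_real (b n) * complex_of_real x ^ n)) = (\<lambda>n. 0)"
      by (simp flip: of_real_power of_real_mult)
    ultimately have "Im (f (of_real x)) = 0" using sums_unique2[OF _ sums_zero] by metis
    then show ?thesis by (simp add: complex_is_Real_iff)
  qed
  then show ?thesis unfolding eventually_nhds_metric using r(1) by (intro exI[of _ r]) auto
qed

lemma uniform_constant:
  assumes "finite I" and "\<And>i. i \<in> I \<Longrightarrow> \<exists>K\<ge>1::real. \<forall>\<^sub>F x in F. P i K x"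
    and mono: "\<And>i x K K'. K \<le> K' \<Longrightarrow> P i K x \<Longrightarrow> P i K' x"
  shows "\<exists>K\<ge>1. \<forall>\<^sub>F x in F. \<forall>i\<in>I. P i K x"
  using assms(1,2)
proof (induction I rule: finite_induct)
  case empty
  show ?case by (intro exI[of _ 1]) auto
next
  case (insert i I)
  obtain K where K: "K \<ge> 1" "\<forall>\<^sub>F x in F. \<forall>i\<in>I. P i K x" using insert by force
  obtain K' where K': "K' \<ge> 1" "\<forall>\<^sub>F x in F. P i K' x" using insert.prems by blast
  have "\<forall>\<^sub>F x in F. \<forall>i\<in>insert i I. P i (max K K') x"
    using K(2) K'(2) by eventually_elim (auto intro: mono[of K "max K K'"] mono[of K' "max K K'"])
  then show ?case using K(1) by (intro exI[of _ "max K K'"]) auto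
qed

lemma sum_powr_le:
  fixes a :: "'i \<Rightarrow> real"
  assumes "finite I" "\<And>i. i \<in> I \<Longrightarrow> a i \<ge> 0" "p > 0"
  shows "(\<Sum>i\<in>I. a i) powr p \<le> real (card I) powr p * (\<Sum>i\<in>I. a i powr p)"
proof -
  define A where "A = (\<Sum>i\<in>I. a i powr p) powr (1 / p)"
  have s: "(\<Sum>i\<in>I. a i powr p) \<ge> 0" by (intro sum_nonneg) auto
  have "a i \<le> A" if "i \<in> I" for i
  proof -
    have "a i = (a i powr p) powr (1 / p)" using assms that by (simp add: powr_powr)
    also have "\<dots> \<le> A" unfolding A_def using assms that by (intro powr_mono2 member_le_sum) auto
    finally show ?thesis .
  qed
  then have "(\<Sum>i\<in>I. a i) \<le> real (card I) * A" using sum_bounded_above[of I a A] by simp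
  then have "(\<Sum>i\<in>I. a i) powr p \<le> (real (card I) * A) powr p"
    using assms by (intro powr_mono2 sum_nonneg) auto
  also have "\<dots> = real (card I) powr p * A powr p" by (simp add: powr_mult A_def)
  also have "A powr p = (\<Sum>i\<in>I. a i powr p)" using assms(3) s by (simp add: A_def powr_powr)
  finally show ?thesis .
qed

text \<open>Induction on the number of nodes: dividing \<tau> - \<tau>(m) by z - m at the new node m
  lowers the degree, and the old weights apply to the quotient.\<close>

lemma interpolation_weights_exist:
  "\<exists>w :: nat \<Rightarrow> complex. \<forall>\<tau>. degree \<tau> < n \<longrightarrow> poly \<tau> 0 = (\<Sum>i\<in>{1..n}. w i * poly \<tau> (of_nat i))"
proof (induction n)
  case 0
  show ?case by simp
next
  case (Suc n)
  then obtain w :: "nat \<Rightarrow> complex" where w: "\<And>\<tau>. degree \<tau> < n \<Longrightarrow> poly \<tau> 0 = (\<Sum>i\<in>{1..n}. w i * poly \<tau> (of_nat i))" by blast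
  define m :: complex where "m = of_nat (Suc n)"
  \<comment> \<open>Obtained by inserting \<rho>(i) = (\<tau>(i) - \<tau>(m)) / (i - m) into
    \<tau>(0) = \<tau>(m) - m \<rho>(0) and collecting the values of \<tau>.\<close>
  define v where "v = (\<lambda>i. if i = Suc n then 1 + (\<Sum>i\<in>{1..n}. m * w i / (of_nat i - m)) else - (m * w i / (of_nat i - m)))"
  have "poly \<tau> 0 = (\<Sum>i\<in>{1..Suc n}. v i * poly \<tau> (of_nat i))" if deg: "degree \<tau> < Suc n" for \<tau>
  proof -
    have "poly (\<tau> - [:poly \<tau> m:]) m = 0" by simp
    then obtain \<rho> where "\<tau> - [:poly \<tau> m:] = [:-m, 1:] * \<rho>" using poly_eq_0_iff_dvd by blast
    then have \<tau>: "\<tau> = [:poly \<tau> m:] + [:-m, 1:] * \<rho>" by (simp add: algebra_simps)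
    have ev: "poly \<tau> z = poly \<tau> m + (z - m) * poly \<rho> z" for z
      by (subst \<tau>) (simp add: algebra_simps)
    have S: "poly \<rho> 0 = (\<Sum>i\<in>{1..n}. w i * poly \<rho> (of_nat i))"
    proof (cases "\<rho> = 0")
      case False
      have "degree ([:-m, 1:] * \<rho>) = Suc (degree \<rho>)" using False by (subst degree_mult_eq) auto
      moreover have "degree ([:-m, 1:] * \<rho>) \<le> degree \<tau>"
      proof -
        have "[:-m, 1:] * \<rho> = \<tau> - [:poly \<tau> m:]" using \<tau> by (simp add: algebra_simps)
        then show ?thesis using degree_diff_le[of \<tau> "degree \<tau>" "[:poly \<tau> m:]"] by simp
      qed
      ultimately show ?thesis using deg by (intro w) auto
    qed simp
    have ne: "of_nat i - m \<noteq> 0" if "i \<in> {1..n}" for i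
      using that unfolding m_def by (metis atLeastAtMost_iff eq_iff_diff_eq_0 not_less_eq_eq of_nat_eq_iff order_refl)
    have "(\<Sum>i\<in>{1..n}. m * w i * poly \<rho> (of_nat i)) = (\<Sum>i\<in>{1..n}. m * w i / (of_nat i - m) * (poly \<tau> (of_nat i) - poly \<tau> m))"
    proof (rule sum.cong)
      fix i assume "i \<in> {1..n}"
      then show "m * w i * poly \<rho> (of_nat i) = m * w i / (of_nat i - m) * (poly \<tau> (of_nat i) - poly \<tau> m)"
        using ne[of i] unfolding ev[of "of_nat i"] by simp
    qed simp
    moreover have "m * poly \<rho> 0 = (\<Sum>i\<in>{1..n}. m * w i * poly \<rho> (of_nat i))"
      unfolding S sum_distrib_left by (simp add: mult.assoc)
    ultimately have "poly \<tau> 0 = poly \<tau> m - (\<Sum>i\<in>{1..n}. m * w i / (of_nat i - m) * (poly \<tau> (of_nat i) - poly \<tau> m))"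
      using ev[of 0] by simp
    also have "\<dots> = (\<Sum>i\<in>{1..n}. v i * poly \<tau> (of_nat i)) + v (Suc n) * poly \<tau> m"
      unfolding v_def by (simp add: right_diff_distrib sum_subtractf sum_negf sum_distrib_right distrib_right)
    also have "\<dots> = (\<Sum>i\<in>{1..Suc n}. v i * poly \<tau> (of_nat i))" by (simp add: m_def)
    finally show ?thesis .
  qed
  then show ?case by blast
qed

text \<open>Replacing \<tau>(z) by \<tau>(h z) does not raise the degree, so one constant W serves
  all step widths h. This uniformity matters because the nodes will approach the branch as x tends
  to 0.\<close>

lemma interpolation_at_zero:
  "\<exists>W\<ge>1. \<forall>(\<tau> :: complex poly) h. degree \<tau> < n \<longrightarrow> norm (poly \<tau> 0) \<le> W * (\<Sum>i\<in>{1..n}. norm (poly \<tau> (of_nat i * h)))"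
proof -
  obtain w :: "nat \<Rightarrow> complex" where w: "\<And>\<tau>. degree \<tau> < n \<Longrightarrow> poly \<tau> 0 = (\<Sum>i\<in>{1..n}. w i * poly \<tau> (of_nat i))"
    using interpolation_weights_exist by blast
  define W where "W = 1 + (\<Sum>i\<in>{1..n}. norm (w i))"
  have W: "W \<ge> 1" unfolding W_def by (simp add: sum_nonneg)
  have wW: "norm (w i) \<le> W" if "i \<in> {1..n}" for i
    using member_le_sum[OF that, of "\<lambda>i. norm (w i)"] by (simp add: W_def)
  have "norm (poly \<tau> 0) \<le> W * (\<Sum>i\<in>{1..n}. norm (poly \<tau> (of_nat i * h)))" if deg: "degree \<tau> < n" for \<tau> :: "complex poly" and h
  proof -
    have "degree (pcompose \<tau> [:0, h:]) \<le> degree \<tau> * degree [:0, h:]" by (rule degree_pcompose_le)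
    also have "\<dots> \<le> degree \<tau> * 1" by (rule mult_left_mono) auto
    finally have "degree (pcompose \<tau> [:0, h:]) < n" using deg by simp
    from w[OF this] have "poly \<tau> 0 = (\<Sum>i\<in>{1..n}. w i * poly \<tau> (of_nat i * h))"
      by (simp add: poly_pcompose)
    also have "norm \<dots> \<le> (\<Sum>i\<in>{1..n}. norm (w i * poly \<tau> (of_nat i * h)))" by (rule norm_sum)
    also have "\<dots> \<le> (\<Sum>i\<in>{1..n}. W * norm (poly \<tau> (of_nat i * h)))"
      unfolding norm_mult by (intro sum_mono mult_right_mono wW) auto
    finally show ?thesis by (simp add: sum_distrib_left)
  qed
  with W show ?thesis by blast
qed

lemma conv_ps2_real_measurable:
  assumes "conv_ps2 f"
  obtains r where "r > 0" "\<And>s. s \<le> r \<Longrightarrow> set_borel_measurable lborel (sq_box s) (\<lambda>(x,y). f (of_real x) (of_real y))"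
proof -
  obtain r where r: "r > 0" "hol2_on r f" using assms conv_ps2_iff by blast
  have "set_borel_measurable lborel (sq_box s) (\<lambda>(x,y). f (of_real x) (of_real y))" if "s \<le> r" for s
  proof -
    have "continuous_on (sq_box s) (\<lambda>z. (\<lambda>(x,y). f x y) (complex_of_real (fst z), complex_of_real (snd z)))"
    proof (rule continuous_on_compose2[OF hol2_on_continuous[OF r(2)]])
      show "(\<lambda>z. (complex_of_real (fst z), complex_of_real (snd z))) ` sq_box s \<subseteq> ball 0 r \<times> ball 0 r"
        using that by (auto simp: sq_box_def)
    qed (intro continuous_intros)
    then have "(\<lambda>z. indicator (sq_box s) z *\<^sub>R (\<lambda>(x,y). f (of_real x) (of_real y)) z) \<in> borel_measurable borel"
      by (intro borel_measurable_continuous_on_indicator) (auto simp: case_prod_unfold)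
    then show ?thesis unfolding set_borel_measurable_def by simp
  qed
  with r(1) that show thesis by blast
qed

abbreviation (input) real_quot :: "(complex \<Rightarrow> complex \<Rightarrow> complex) \<Rightarrow> (complex \<Rightarrow> complex \<Rightarrow> complex) \<Rightarrow> real \<times> real \<Rightarrow> complex" where
  "real_quot f g \<equiv> (\<lambda>(x,y). f (of_real x) (of_real y) / g (of_real x) (of_real y))"

lemma conv_ps2_quotient_measurable:
  assumes "conv_ps2 f" "conv_ps2 g"
  obtains r where "r > 0" "\<And>s. s \<le> r \<Longrightarrow> set_borel_measurable lborel (sq_box s)
     (real_quot f g)"
proof -
  obtain r1 where r1: "r1 > 0" "\<And>s. s \<le> r1 \<Longrightarrow> set_borel_measurable lborel (sq_box s) (\<lambda>(x,y). f (of_real x) (of_real y))"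
    using conv_ps2_real_measurable[OF assms(1)] by blast
  obtain r2 where r2: "r2 > 0" "\<And>s. s \<le> r2 \<Longrightarrow> set_borel_measurable lborel (sq_box s) (\<lambda>(x,y). g (of_real x) (of_real y))"
    using conv_ps2_real_measurable[OF assms(2)] by blast
  have "set_borel_measurable lborel (sq_box s)
     (real_quot f g)" if "s \<le> min r1 r2" for s
  proof -
    have "(\<lambda>z. (indicator (sq_box s) z *\<^sub>R (case z of (x,y) \<Rightarrow> f (of_real x) (of_real y))) /
         (indicator (sq_box s) z *\<^sub>R (case z of (x,y) \<Rightarrow> g (of_real x) (of_real y)))) \<in> borel_measurable lborel"
      using r1(2)[of s] r2(2)[of s] that unfolding set_borel_measurable_def
      by (intro borel_measurable_divide) auto
    also have "(\<lambda>z. (indicator (sq_box s) z *\<^sub>R (case z of (x,y) \<Rightarrow> f (of_real x) (of_real y))) /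
         (indicator (sq_box s) z *\<^sub>R (case z of (x,y) \<Rightarrow> g (of_real x) (of_real y)))) =
       (\<lambda>z. indicator (sq_box s) z *\<^sub>R (case z of (x,y) \<Rightarrow> f (of_real x) (of_real y) / g (of_real x) (of_real y)))"
      by (auto simp: fun_eq_iff indicator_def)
    finally show ?thesis unfolding set_borel_measurable_def .
  qed
  then show thesis using that[of "min r1 r2"] r1(1) r2(1) by auto
qed

lemma eventually_bidisc_real:
  assumes "\<forall>\<^sub>F (x,y) in nhds (0::complex, 0::complex). P x y"
  obtains r where "r > 0" "\<And>x y. \<bar>x\<bar> < r \<Longrightarrow> \<bar>y\<bar> < r \<Longrightarrow> P (of_real x) (of_real y)"
  using assms unfolding eventually_nhds_bidisc by auto

text \<open>At real points |Pbar| = |P|, so an element of the ideal divided by P is bounded near the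
  origin. Hence only the class of Q modulo the ideal matters.\<close>

lemma Lp_loc_mod_ideal:
  fixes P :: "complex \<Rightarrow> complex \<Rightarrow> complex"
  assumes P: "conv_ps2 P" "conv_ps2 (Pbar P)" and GH: "conv_ps2 G" "conv_ps2 H" and p: "p > 0"
    and eq: "\<forall>\<^sub>F (x,y) in nhds (0,0). Q x y - R x y = G x y * P x y + H x y * Pbar P x y"
    and R: "Lp_loc p (real_quot R P)"
  shows "Lp_loc p (real_quot Q P)"
proof -
  define E where "E = (\<lambda>x y. G x y * P x y + H x y * Pbar P x y)"
  have cE: "conv_ps2 E" unfolding E_def by (intro conv_ps2_intros P GH)
  obtain r1 where r1: "r1 > 0" "\<And>s. s \<le> r1 \<Longrightarrow> set_borel_measurable lborel (sq_box s)
     (real_quot E P)"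
    using conv_ps2_quotient_measurable[OF cE P(1)] by blast
  obtain K1 where K1: "K1 > 0" "\<forall>\<^sub>F (x,y) in nhds (0,0). norm (G x y) \<le> K1" using conv_ps2_bounded[OF GH(1)] .
  obtain K2 where K2: "K2 > 0" "\<forall>\<^sub>F (x,y) in nhds (0,0). norm (H x y) \<le> K2" using conv_ps2_bounded[OF GH(2)] .
  have "\<forall>\<^sub>F (x,y) in nhds (0,0). norm (G x y) \<le> K1 \<and> norm (H x y) \<le> K2 \<and> Q x y - R x y = E x y"
    using K1(2) K2(2) eq unfolding E_def by eventually_elim auto
  then obtain r2 where r2: "r2 > 0" "\<And>x y. \<bar>x\<bar> < r2 \<Longrightarrow> \<bar>y\<bar> < r2 \<Longrightarrow>
      norm (G (of_real x) (of_real y)) \<le> K1 \<and> norm (H (of_real x) (of_real y)) \<le> K2 \<and>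
      Q (of_real x) (of_real y) - R (of_real x) (of_real y) = E (of_real x) (of_real y)"
    by (rule eventually_bidisc_real) blast
  define r where "r = min r1 r2"
  have r: "r > 0" "r \<le> r1" "r \<le> r2" using r1 r2 by (auto simp: r_def)
  have LE: "Lp_loc p (real_quot E P)"
  proof (rule Lp_loc_bounded[OF r(1) r1(2)[OF r(2)] _ p, where K = "K1 + K2"])
    fix z assume "z \<in> sq_box r"
    then obtain x y where z: "z = (x, y)" "\<bar>x\<bar> < r2" "\<bar>y\<bar> < r2" using r by (cases z) (auto simp: mem_sq_box)
    let ?x = "complex_of_real x" and ?y = "complex_of_real y"
    have nP: "norm (Pbar P ?x ?y) = norm (P ?x ?y)" by (simp add: Pbar_def)
    have "norm (E ?x ?y) \<le> norm (G ?x ?y) * norm (P ?x ?y) + norm (H ?x ?y) * norm (P ?x ?y)"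
      unfolding E_def using norm_triangle_ineq[of "G ?x ?y * P ?x ?y" "H ?x ?y * Pbar P ?x ?y"] by (simp add: norm_mult nP)
    also have "\<dots> \<le> K1 * norm (P ?x ?y) + K2 * norm (P ?x ?y)"
      using r2(2)[OF z(2,3)] by (intro add_mono mult_right_mono) auto
    finally have "norm (E ?x ?y) \<le> (K1 + K2) * norm (P ?x ?y)" by (simp add: distrib_right)
    \<comment> \<open>Where P vanishes the quotient is 0 by the convention on division by
      zero.\<close>
    then show "norm (case z of (x,y) \<Rightarrow> E (of_real x) (of_real y) / P (of_real x) (of_real y)) \<le> K1 + K2"
      using K1 K2 by (cases "P ?x ?y = 0") (auto simp: z norm_divide divide_le_eq)
  qed
  show ?thesis
  proof (rule Lp_loc_cong[OF r2(1) _ Lp_loc_add[OF R LE p]])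
    fix z assume "z \<in> sq_box r2"
    then obtain x y where z: "z = (x, y)" "\<bar>x\<bar> < r2" "\<bar>y\<bar> < r2" by (cases z) (auto simp: mem_sq_box)
    have "Q (of_real x) (of_real y) = R (of_real x) (of_real y) + E (of_real x) (of_real y)"
      using r2(2)[OF z(2,3)] by (simp add: algebra_simps)
    then show "(case z of (a, b) \<Rightarrow> R (of_real a) (of_real b) / P (of_real a) (of_real b)) +
         (case z of (x, y) \<Rightarrow> E (of_real x) (of_real y) / P (of_real x) (of_real y)) =
         (case z of (a, b) \<Rightarrow> Q (of_real a) (of_real b) / P (of_real a) (of_real b))"
      by (simp add: z add_divide_distrib)
  qed
qed

lemma poly_order_bound:
  fixes c :: "complex poly"
  assumes "\<forall>n<m. coeff c n = 0"
  shows "\<exists>C\<ge>0. \<forall>\<^sub>F x in nhds 0. norm (poly c x) \<le> C * norm x ^ m"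
proof -
  obtain q where q: "c = monom 1 m * q" using assms monom_1_dvd_iff'[of m c] by (auto elim: dvdE)
  obtain K where K: "K > 0" "\<forall>\<^sub>F (x,y::complex) in nhds (0,0). norm (poly q x) \<le> K"
    using conv_ps2_bounded[OF conv_ps2_poly] by blast
  then obtain r where r: "r > 0" "\<forall>x y::complex. norm x < r \<longrightarrow> norm y < r \<longrightarrow> norm (poly q x) \<le> K"
    unfolding eventually_nhds_bidisc prod.case by blast
  have "norm (poly c x) \<le> K * norm x ^ m" if "norm x < r" for x
    using r(2)[rule_format, of x 0] r(1) that by (simp add: q poly_monom norm_mult norm_power mult.commute[of K] mult_left_mono)
  then show ?thesis using K(1) r(1) unfolding eventually_nhds_metric by (intro exI[of _ K]) auto
qed

lemma poly_order_lower_bound: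
  fixes c :: "complex poly"
  assumes "\<forall>n<m. coeff c n = 0" "coeff c m \<noteq> 0"
  shows "\<exists>C>0. \<forall>\<^sub>F x in nhds 0. C * norm x ^ m \<le> norm (poly c x)"
proof -
  obtain q where q: "c = monom 1 m * q" using assms monom_1_dvd_iff'[of m c] by (auto elim: dvdE)
  have "coeff c m = coeff q 0" unfolding q using coeff_monom_mult[of 1 m q m] by simp
  then have q0: "poly q 0 \<noteq> 0" using assms(2) by (simp add: poly_0_coeff_0)
  have "isCont (\<lambda>x. norm (poly q x)) 0" by (intro continuous_intros)
  then have "((\<lambda>x. norm (poly q x)) \<longlongrightarrow> norm (poly q 0)) (nhds 0)"
    using tendsto_at_iff_tendsto_nhds[of "\<lambda>x. norm (poly q x)" 0] by (simp add: isCont_def)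
  then have "\<forall>\<^sub>F x in nhds 0. norm (poly q 0) / 2 < norm (poly q x)"
    by (rule order_tendstoD) (use q0 in auto)
  then have "\<forall>\<^sub>F x in nhds 0. norm (poly q 0) / 2 * norm x ^ m \<le> norm (poly c x)"
  proof eventually_elim
    case (elim x)
    have "norm (poly q 0) / 2 * norm x ^ m \<le> norm (poly q x) * norm x ^ m"
      by (rule mult_right_mono) (use elim in auto)
    then show ?case by (simp add: q poly_monom norm_mult norm_power mult.commute)
  qed
  then show ?thesis using q0 by (intro exI[of _ "norm (poly q 0) / 2"]) auto
qed

section \<open>Estimates on real points\<close>

text \<open>The least integer e with p e - 2 l (p - 1) > -1, that is, with |x|^(p e - 2 l (p - 1))
  integrable at 0.\<close>

definition expo :: "real \<Rightarrow> nat \<Rightarrow> nat" where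
  "expo p l = nat \<lfloor>(2 * real l + 1) * (1 - 1 / p)\<rfloor>"

text \<open>The two sides of that minimality: the exponent itself meets the condition of
  \<open>Lp_box_if_branch_bounds\<close>, and one less fails it. The failure is arranged so that
  |f|^p is seen to grow at least like 1 / x^(2l + 1), as \<open>not_Lp_box_if_lower_bound\<close>
  requires.\<close>

lemma expo_bounds:
  assumes "p \<ge> 1"
  shows "p * real (expo p l) - real (2 * l) * (p - 1) > -1"
    "p * (real (expo p l) - 1 - real (2 * l)) \<le> - real (2 * l + 1)"
proof -
  define X where "X = (2 * real l + 1) * (1 - 1 / p)"
  have X: "X \<ge> 0" using assms by (simp add: X_def)
  have pX: "p * X = (2 * real l + 1) * (p - 1)" using assms by (simp add: X_def field_simps)
  have "real (expo p l) = of_int \<lfloor>X\<rfloor>" using X by (simp add: expo_def X_def)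
  then have "X - 1 < real (expo p l)" "real (expo p l) \<le> X" by linarith+
  then have "p * (X - 1) < p * real (expo p l)" "p * real (expo p l) \<le> p * X" using assms by simp_all
  then show "p * real (expo p l) - real (2 * l) * (p - 1) > -1"
    "p * (real (expo p l) - 1 - real (2 * l)) \<le> - real (2 * l + 1)"
    using pX by (simp_all add: algebra_simps)
qed

lemma poly_map_poly_of_real: "poly (map_poly complex_of_real p) (of_real x) = complex_of_real (poly p x)"
  by (induction p) (auto simp: map_poly_pCons)

lemma prod_split_at:
  fixes f :: "nat \<Rightarrow> 'b::comm_monoid_mult"
  assumes "k < n" shows "(\<Prod>j<n. f j) = (\<Prod>j\<le>k. f j) * (\<Prod>j\<in>{k<..<n}. f j)"
proof -
  have eq: "{..<n} = {..k} \<union> {k<..<n}" using assms by auto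
  show ?thesis unfolding eq by (rule prod.union_disjoint) auto
qed

context proper_setting
begin

abbreviation Pr :: "real \<Rightarrow> real \<Rightarrow> complex" where
  "Pr x y \<equiv> P (of_real x) (of_real y)"

abbreviation Fr :: "nat \<Rightarrow> real \<Rightarrow> real \<Rightarrow> complex" where
  "Fr k x y \<equiv> F k (of_real x) (of_real y)"

abbreviation ur :: "real \<Rightarrow> real \<Rightarrow> complex" where
  "ur x y \<equiv> u (of_real x) (of_real y)"

definition ar :: "nat \<Rightarrow> real \<Rightarrow> real" where "ar j x = Re (a j (of_real x))"

definition fac :: "nat \<Rightarrow> real \<Rightarrow> real \<Rightarrow> complex" where
  "fac j x y = complex_of_real y + poly (map_poly complex_of_real (q j)) (of_real x) + \<i> * complex_of_real x ^ (2 * L j)"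

text \<open>A stand-in for the modulus of the j-th factor of P. It measures y from the real branch
  instead of from -q_j, which differs from the branch only by O(|x|^(2L_j)).\<close>

definition dst :: "nat \<Rightarrow> real \<Rightarrow> real \<Rightarrow> real" where
  "dst j x y = \<bar>y - ar j x\<bar> + \<bar>x\<bar> ^ (2 * L j)"

lemma dst_nonneg: "dst j x y \<ge> 0"
  unfolding dst_def by simp

lemma Pfun_fac: "Pr x y = (\<Prod>j<M. fac j x y)"
  unfolding Pfun_def fac_def ..

text \<open>Collects all local estimates under one constant and one radius, so that later arguments
  are explicit inequalities without further shrinking. The comparison of \<open>dst\<close> with
  \<open>fac\<close> is uniform in y; only the bounds on the unit need y small.\<close>

definition branch_bounds :: "real \<Rightarrow> real \<Rightarrow> bool" where
  "branch_bounds K r \<longleftrightarrow> K \<ge> 1 \<and> 0 < r \<and> r \<le> 1 \<and> (\<forall>x. \<bar>x\<bar> < r \<longrightarrow>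
     (\<forall>j<M. a j (of_real x) = complex_of_real (ar j x) \<and> \<bar>ar j x\<bar> < 1) \<and>
     (\<forall>i<M. \<forall>j<M. i \<noteq> j \<longrightarrow> \<bar>x\<bar> ^ Ord i j \<le> K * \<bar>ar i x - ar j x\<bar> \<and> \<bar>ar i x - ar j x\<bar> \<le> K * \<bar>x\<bar> ^ Ord i j) \<and>
     (\<forall>j<M. \<forall>y. dst j x y \<le> K * norm (fac j x y) \<and> norm (fac j x y) \<le> K * dst j x y) \<and>
     (\<forall>y. \<bar>y\<bar> < r \<longrightarrow> 1 \<le> K * norm (ur x y) \<and>
         norm (ur x y) \<le> K))"

lemma a_real: "j < M \<Longrightarrow> \<forall>\<^sub>F x in nhds (0::real). a j (of_real x) = complex_of_real (ar j x)"
proof -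
  assume "j < M"
  have "has_ps (\<lambda>n. complex_of_real (coeff (q j) n + shift_coeffs (2 * L j) (\<psi> j) n)) (\<lambda>x. - a j x)"
    using minus_a_has_ps[OF \<open>j < M\<close>] by simp
  from has_ps_real_valued[OF this] show ?thesis
    by (rule eventually_mono) (auto simp: ar_def complex_is_Real_iff complex_eq_iff)
qed

lemma a_small: 
  assumes "j < M" "\<epsilon> > 0" shows "\<forall>\<^sub>F x in nhds (0::real). \<bar>ar j x\<bar> < \<epsilon>"
proof -
  have "\<forall>\<^sub>F (x,y) in nhds (0::complex,0::complex). norm (a j x) < \<epsilon>"
    using conv_ps2_near[OF conv_a[OF assms(1)] assms(2)] a_0[OF assms(1)] by simp
  from eventually_nhds_of_real[OF eventually_restrict_fst[OF this]] show ?thesis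
    by (rule eventually_mono) (auto simp: ar_def intro: le_less_trans[OF abs_Re_le_cmod])
qed

text \<open>With w = y + q_j(x) and X = x^(2L_j), the factor is w + iX while y - a_j = w + X psi_j.
  For real x and y both |w| and X are at most |w + iX|, and psi_j is bounded.\<close>

lemma fac_bounds:
  assumes j: "j < M"
  shows "\<exists>K\<ge>1. \<forall>\<^sub>F x in nhds (0::real). \<forall>y. dst j x y \<le> K * norm (fac j x y) \<and> norm (fac j x y) \<le> K * dst j x y"
proof -
  have "conv_ps2 (\<lambda>x y. eval_ps1 (\<psi> j) x)" by (rule has_ps_conv_ps2[OF has_ps_eval_ps1[OF conv_psi[OF j]]])
  then obtain K1 where K1: "K1 > 0" "\<forall>\<^sub>F (x,y) in nhds (0::complex,0::complex). norm (eval_ps1 (\<psi> j) x) \<le> K1"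
    using conv_ps2_bounded by blast
  have "\<forall>\<^sub>F x in nhds (0::real). \<forall>y. dst j x y \<le> (2 + K1) * norm (fac j x y) \<and> norm (fac j x y) \<le> (2 + K1) * dst j x y"
    using eventually_nhds_of_real[OF eventually_restrict_fst[OF K1(2)]] a_real[OF j]
  proof eventually_elim
    case (elim x)
    show ?case
    proof
      fix y :: real
      define X where "X = \<bar>x\<bar> ^ (2 * L j)"
      have X0: "X \<ge> 0" and X: "x ^ (2 * L j) = X" by (simp_all add: X_def power_even_abs)
      define w where "w = y + poly (q j) x"
      have fac: "fac j x y = complex_of_real w + \<i> * complex_of_real X"
        unfolding fac_def w_def X[symmetric] by (simp add: poly_map_poly_of_real)
      have "complex_of_real (y - ar j x) = complex_of_real y - a j (of_real x)" by (simp add: elim)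
      also have "\<dots> = complex_of_real w + complex_of_real X * eval_ps1 (\<psi> j) (of_real x)"
        unfolding a_def w_def X[symmetric] by (simp add: poly_map_poly_of_real)
      finally have yw: "complex_of_real (y - ar j x) = complex_of_real w + complex_of_real X * eval_ps1 (\<psi> j) (of_real x)" .
      have Xe: "norm (complex_of_real X * eval_ps1 (\<psi> j) (of_real x)) \<le> K1 * X"
        using mult_left_mono[OF elim(1) X0] X0 by (simp add: norm_mult mult.commute)
      have 1: "\<bar>y - ar j x\<bar> \<le> \<bar>w\<bar> + K1 * X"
        using norm_triangle_ineq[of "complex_of_real w" "complex_of_real X * eval_ps1 (\<psi> j) (of_real x)"] Xe
        unfolding yw[symmetric] by (simp del: of_real_diff)
      have "complex_of_real w = complex_of_real (y - ar j x) - complex_of_real X * eval_ps1 (\<psi> j) (of_real x)"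
        using yw by simp
      then have "\<bar>w\<bar> = norm (complex_of_real (y - ar j x) - complex_of_real X * eval_ps1 (\<psi> j) (of_real x))"
        by (metis norm_of_real)
      also have "\<dots> \<le> \<bar>y - ar j x\<bar> + K1 * X"
        using norm_triangle_ineq4[of "complex_of_real (y - ar j x)" "complex_of_real X * eval_ps1 (\<psi> j) (of_real x)"] Xe
        by (simp del: of_real_diff)
      finally have 2: "\<bar>w\<bar> \<le> \<bar>y - ar j x\<bar> + K1 * X" .
      have 3: "\<bar>w\<bar> \<le> norm (fac j x y)" using abs_Re_le_cmod[of "fac j x y"] by (simp add: fac)
      have 4: "X \<le> norm (fac j x y)" using abs_Im_le_cmod[of "fac j x y"] X0 by (simp add: fac)
      have 5: "norm (fac j x y) \<le> \<bar>w\<bar> + X"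
        unfolding fac using norm_triangle_ineq[of "complex_of_real w" "\<i> * complex_of_real X"] X0 by (simp add: norm_mult)
      have 6: "K1 * X \<le> K1 * norm (fac j x y)" using 4 K1(1) by simp
      have 7: "K1 * \<bar>y - ar j x\<bar> \<ge> 0" using K1(1) by simp
      have 8: "dst j x y = \<bar>y - ar j x\<bar> + X" by (simp add: dst_def X_def)
      define Y where "Y = \<bar>y - ar j x\<bar>"
      have "dst j x y \<le> 2 * norm (fac j x y) + K1 * norm (fac j x y)" using 1 3 4 6 unfolding 8 by linarith
      moreover have "norm (fac j x y) \<le> 2 * dst j x y + K1 * dst j x y"
        using 2 5 7 X0 abs_ge_zero[of "y - ar j x"] unfolding 8 distrib_left Y_def[symmetric] by linarith
      ultimately show "dst j x y \<le> (2 + K1) * norm (fac j x y) \<and> norm (fac j x y) \<le> (2 + K1) * dst j x y"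
        by (simp add: distrib_right)
    qed
  qed
  then show ?thesis using K1(1) by (intro exI[of _ "2 + K1"]) auto
qed

lemma ar_separation:
  assumes ij: "i < M" "j < M" "i \<noteq> j"
  shows "\<exists>K\<ge>1. \<forall>\<^sub>F x in nhds (0::real). \<bar>x\<bar> ^ Ord i j \<le> K * \<bar>ar i x - ar j x\<bar> \<and> \<bar>ar i x - ar j x\<bar> \<le> K * \<bar>x\<bar> ^ Ord i j"
proof -
  obtain c C where c: "c > 0" "\<forall>\<^sub>F x in nhds 0. c * norm x ^ Ord i j \<le> norm (a i x - a j x) \<and> norm (a i x - a j x) \<le> C * norm x ^ Ord i j"
    using branch_separation[OF ij] by blast
  define K where "K = max 1 (max (1 / c) C)"
  have K: "K \<ge> 1" "K \<ge> 1 / c" "K \<ge> C" by (auto simp: K_def)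
  have "\<forall>\<^sub>F x in nhds (0::real). \<bar>x\<bar> ^ Ord i j \<le> K * \<bar>ar i x - ar j x\<bar> \<and> \<bar>ar i x - ar j x\<bar> \<le> K * \<bar>x\<bar> ^ Ord i j"
    using eventually_nhds_of_real[OF c(2)] a_real[OF ij(1)] a_real[OF ij(2)]
  proof eventually_elim
    case (elim x)
    have n: "norm (a i (of_real x) - a j (of_real x)) = \<bar>ar i x - ar j x\<bar>"
      unfolding elim(2,3) of_real_diff[symmetric] norm_of_real ..
    have "\<bar>x\<bar> ^ Ord i j = 1 / c * (c * \<bar>x\<bar> ^ Ord i j)" using c by simp
    also have "\<dots> \<le> 1 / c * \<bar>ar i x - ar j x\<bar>" using elim(1) c by (intro mult_left_mono) (auto simp: n)
    also have "\<dots> \<le> K * \<bar>ar i x - ar j x\<bar>" using K by (intro mult_right_mono) auto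
    finally have 1: "\<bar>x\<bar> ^ Ord i j \<le> K * \<bar>ar i x - ar j x\<bar>" .
    have "\<bar>ar i x - ar j x\<bar> \<le> C * \<bar>x\<bar> ^ Ord i j" using elim(1) by (simp add: n)
    also have "\<dots> \<le> K * \<bar>x\<bar> ^ Ord i j" using K by (intro mult_right_mono) auto
    finally show ?case using 1 by blast
  qed
  then show ?thesis using K by blast
qed

lemma branch_bounds_exist: "\<exists>K r. branch_bounds K r"
proof -
  define I where "I = {(i,j). i < M \<and> j < M \<and> i \<noteq> j}"
  have "finite I" by (rule finite_subset[of _ "{..<M} \<times> {..<M}"]) (auto simp: I_def)
  then have "\<exists>K\<ge>1. \<forall>\<^sub>F x in nhds (0::real). \<forall>ij\<in>I. \<bar>x\<bar> ^ Ord (fst ij) (snd ij) \<le> K * \<bar>ar (fst ij) x - ar (snd ij) x\<bar> \<and>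
      \<bar>ar (fst ij) x - ar (snd ij) x\<bar> \<le> K * \<bar>x\<bar> ^ Ord (fst ij) (snd ij)"
    by (rule uniform_constant)
       (auto simp: I_def intro: ar_separation order_trans[OF _ mult_right_mono])
  then obtain K1 where K1: "K1 \<ge> 1" "\<forall>\<^sub>F x in nhds (0::real). \<forall>ij\<in>I. \<bar>x\<bar> ^ Ord (fst ij) (snd ij) \<le> K1 * \<bar>ar (fst ij) x - ar (snd ij) x\<bar> \<and>
      \<bar>ar (fst ij) x - ar (snd ij) x\<bar> \<le> K1 * \<bar>x\<bar> ^ Ord (fst ij) (snd ij)" by blast
  have "\<exists>K\<ge>1. \<forall>\<^sub>F x in nhds (0::real). \<forall>j\<in>{..<M}. \<forall>y. dst j x y \<le> K * norm (fac j x y) \<and> norm (fac j x y) \<le> K * dst j x y"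
    by (rule uniform_constant)
       (auto intro!: fac_bounds intro: order_trans[OF _ mult_right_mono] dst_nonneg)
  then obtain K2 where K2: "K2 \<ge> 1" "\<forall>\<^sub>F x in nhds (0::real). \<forall>j\<in>{..<M}. \<forall>y. dst j x y \<le> K2 * norm (fac j x y) \<and> norm (fac j x y) \<le> K2 * dst j x y" by blast
  have e1: "\<forall>\<^sub>F x in nhds (0::real). \<forall>j\<in>{..<M}. a j (of_real x) = complex_of_real (ar j x) \<and> \<bar>ar j x\<bar> < 1"
    by (rule eventually_ball_finite) (simp_all add: eventually_conj a_real a_small)
  define U where "U = norm (u 0 0)"
  have U: "U > 0" using u_nz by (simp add: U_def)
  obtain r1 where r1: "r1 > 0" "\<And>x y. \<bar>x\<bar> < r1 \<Longrightarrow> \<bar>y\<bar> < r1 \<Longrightarrow> norm (ur x y - u 0 0) < U / 2"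
    using eventually_bidisc_real[OF conv_ps2_near[OF conv_u, of "U / 2"]] U by auto
  \<comment> \<open>The last two entries serve the unit, whose modulus lies between U/2 and 2U near
    the origin.\<close>
  define K where "K = max (max K1 K2) (max (2 * U) (2 / U))"
  have K: "K \<ge> K1" "K \<ge> K2" "K \<ge> 2 * U" "K \<ge> 2 / U" by (auto simp: K_def)
  obtain r2 where r2: "r2 > 0" "\<And>x. \<bar>x\<bar> < r2 \<Longrightarrow>
     (\<forall>j\<in>{..<M}. a j (of_real x) = complex_of_real (ar j x) \<and> \<bar>ar j x\<bar> < 1) \<and>
     (\<forall>ij\<in>I. \<bar>x\<bar> ^ Ord (fst ij) (snd ij) \<le> K1 * \<bar>ar (fst ij) x - ar (snd ij) x\<bar> \<and>
      \<bar>ar (fst ij) x - ar (snd ij) x\<bar> \<le> K1 * \<bar>x\<bar> ^ Ord (fst ij) (snd ij)) \<and>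
     (\<forall>j\<in>{..<M}. \<forall>y. dst j x y \<le> K2 * norm (fac j x y) \<and> norm (fac j x y) \<le> K2 * dst j x y)"
    using eventually_conj[OF e1 eventually_conj[OF K1(2) K2(2)]] unfolding eventually_nhds_metric by auto
  define r where "r = min 1 (min r1 r2)"
  have r: "r > 0" "r \<le> 1" "r \<le> r1" "r \<le> r2" using r1(1) r2(1) by (auto simp: r_def)
  have "branch_bounds K r" unfolding branch_bounds_def
  proof (intro conjI allI impI)
    show "1 \<le> K" "0 < r" "r \<le> 1" using K K1 r by auto
    fix x assume x: "\<bar>x\<bar> < r"
    then have x2: "\<bar>x\<bar> < r2" using r by simp
    note R = r2(2)[OF x2]
    show "a j (of_real x) = complex_of_real (ar j x)" "\<bar>ar j x\<bar> < 1" if "j < M" for j using R that by auto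
    show "\<bar>x\<bar> ^ Ord i j \<le> K * \<bar>ar i x - ar j x\<bar>" "\<bar>ar i x - ar j x\<bar> \<le> K * \<bar>x\<bar> ^ Ord i j" if "i < M" "j < M" "i \<noteq> j" for i j
    proof -
      have ij: "\<bar>x\<bar> ^ Ord i j \<le> K1 * \<bar>ar i x - ar j x\<bar>" "\<bar>ar i x - ar j x\<bar> \<le> K1 * \<bar>x\<bar> ^ Ord i j"
        using R that by (force simp: I_def)+
      show "\<bar>x\<bar> ^ Ord i j \<le> K * \<bar>ar i x - ar j x\<bar>" by (rule order_trans[OF ij(1) mult_right_mono[OF K(1)]]) simp
      show "\<bar>ar i x - ar j x\<bar> \<le> K * \<bar>x\<bar> ^ Ord i j" by (rule order_trans[OF ij(2) mult_right_mono[OF K(1)]]) simp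
    qed
    show "dst j x y \<le> K * norm (fac j x y)" "norm (fac j x y) \<le> K * dst j x y" if "j < M" for j y
    proof -
      have j: "dst j x y \<le> K2 * norm (fac j x y)" "norm (fac j x y) \<le> K2 * dst j x y" using R that by auto
      show "dst j x y \<le> K * norm (fac j x y)" by (rule order_trans[OF j(1) mult_right_mono[OF K(2)]]) simp
      show "norm (fac j x y) \<le> K * dst j x y" by (rule order_trans[OF j(2) mult_right_mono[OF K(2)]]) (simp add: dst_def)
    qed
    fix y assume y: "\<bar>y\<bar> < r"
    define v where "v = norm (ur x y)"
    have "norm (ur x y - u 0 0) < U / 2" using r1(2)[of x y] x y r by auto
    then have v: "U / 2 \<le> v" "v \<le> 2 * U"
      using norm_triangle_sub[of "u 0 0" "ur x y"]
        norm_triangle_sub[of "ur x y" "u 0 0"] U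
      unfolding v_def U_def by (auto simp: norm_minus_commute)
    have "1 = 2 / U * (U / 2)" using U by simp
    also have "\<dots> \<le> K * v" using K v U by (intro mult_mono) auto
    finally show "1 \<le> K * norm (ur x y)" unfolding v_def .
    show "norm (ur x y) \<le> K" using v K unfolding v_def by linarith
  qed
  then show ?thesis by blast
qed

lemma branch_bounds_mono: "branch_bounds K r \<Longrightarrow> 0 < s \<Longrightarrow> s \<le> r \<Longrightarrow> branch_bounds K s"
  unfolding branch_bounds_def by auto

context
  fixes K r :: real
  assumes branch_bounds: "branch_bounds K r"
begin

lemma K_ge_1: "K \<ge> 1" and radius_bounds: "0 < r" "r \<le> 1" using branch_bounds unfolding branch_bounds_def by auto

lemma branch_bounds_a: "\<bar>x\<bar> < r \<Longrightarrow> j < M \<Longrightarrow> a j (of_real x) = complex_of_real (ar j x)"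
  and branch_bounds_ar: "\<bar>x\<bar> < r \<Longrightarrow> j < M \<Longrightarrow> \<bar>ar j x\<bar> < 1"
  and branch_bounds_sep: "\<bar>x\<bar> < r \<Longrightarrow> i < M \<Longrightarrow> j < M \<Longrightarrow> i \<noteq> j \<Longrightarrow> \<bar>x\<bar> ^ Ord i j \<le> K * \<bar>ar i x - ar j x\<bar>"
     "\<bar>x\<bar> < r \<Longrightarrow> i < M \<Longrightarrow> j < M \<Longrightarrow> i \<noteq> j \<Longrightarrow> \<bar>ar i x - ar j x\<bar> \<le> K * \<bar>x\<bar> ^ Ord i j"
  and branch_bounds_fac: "\<bar>x\<bar> < r \<Longrightarrow> j < M \<Longrightarrow> dst j x y \<le> K * norm (fac j x y)"
     "\<bar>x\<bar> < r \<Longrightarrow> j < M \<Longrightarrow> norm (fac j x y) \<le> K * dst j x y"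
  and branch_bounds_u: "\<bar>x\<bar> < r \<Longrightarrow> \<bar>y\<bar> < r \<Longrightarrow> 1 \<le> K * norm (ur x y)"
     "\<bar>x\<bar> < r \<Longrightarrow> \<bar>y\<bar> < r \<Longrightarrow> norm (ur x y) \<le> K"
  using branch_bounds unfolding branch_bounds_def by auto

lemma dst_pos: "x \<noteq> 0 \<Longrightarrow> dst j x y > 0"
  unfolding dst_def by (simp add: add_nonneg_pos)

lemma P_lower:
  assumes "\<bar>x\<bar> < r"
  shows "(\<Prod>j<M. dst j x y) \<le> K ^ M * norm (Pr x y)"
proof -
  have "(\<Prod>j<M. dst j x y) \<le> (\<Prod>j<M. K * norm (fac j x y))"
    using branch_bounds_fac(1) assms by (intro prod_mono) (auto simp: dst_nonneg)
  then show ?thesis by (simp add: Pfun_fac prod.distrib prod_norm)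
qed

lemma P_upper:
  assumes "\<bar>x\<bar> < r"
  shows "norm (Pr x y) \<le> K ^ M * (\<Prod>j<M. dst j x y)"
proof -
  have "(\<Prod>j<M. norm (fac j x y)) \<le> (\<Prod>j<M. K * dst j x y)"
    using branch_bounds_fac(2) assms by (intro prod_mono) auto
  then show ?thesis by (simp add: Pfun_fac prod.distrib prod_norm[symmetric])
qed

text \<open>The index \<open>j\<close> minimises the distance to \<open>(x, y)\<close>; every other factor is then bounded below by half
  the separation of the two branches.\<close>

lemma nearest_branch_bound:
  assumes x: "\<bar>x\<bar> < r" and k: "k < M"
  shows "\<exists>j\<le>k. dst j x y * \<bar>x\<bar> ^ (\<Sum>i\<in>{..k} - {j}. Ord i j) \<le> (2 * K) ^ k * (\<Prod>i\<le>k. dst i x y)"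
proof -
  have "Min ((\<lambda>j. dst j x y) ` {..k}) \<in> (\<lambda>j. dst j x y) ` {..k}" by (rule Min_in) auto
  then obtain j where j: "j \<le> k" "dst j x y = Min ((\<lambda>j. dst j x y) ` {..k})" by (rule imageE) auto
  have min: "dst j x y \<le> dst i x y" if "i \<le> k" for i unfolding j(2) using that by (intro Min_le) auto
  have "(\<Prod>i\<in>{..k} - {j}. \<bar>x\<bar> ^ Ord i j) \<le> (\<Prod>i\<in>{..k} - {j}. 2 * K * dst i x y)"
  proof (rule prod_mono, intro conjI)
    fix i assume i: "i \<in> {..k} - {j}"
    have "\<bar>x\<bar> ^ Ord i j \<le> K * \<bar>ar i x - ar j x\<bar>" using branch_bounds_sep(1)[OF x, of i j] i j k by auto
    also have "\<dots> \<le> K * (2 * dst i x y)"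
    proof (rule mult_left_mono)
      have "0 \<le> \<bar>x\<bar> ^ (2 * L i)" "0 \<le> \<bar>x\<bar> ^ (2 * L j)" by simp_all
      then have "\<bar>ar i x - ar j x\<bar> \<le> dst i x y + dst j x y" unfolding dst_def by linarith
      then show "\<bar>ar i x - ar j x\<bar> \<le> 2 * dst i x y" using min[of i] i by auto
    qed (use K_ge_1 in simp)
    finally show "\<bar>x\<bar> ^ Ord i j \<le> 2 * K * dst i x y" by simp
  qed auto
  also have "\<dots> = (2 * K) ^ k * (\<Prod>i\<in>{..k} - {j}. dst i x y)"
    using j by (simp add: prod.distrib)
  finally have "dst j x y * \<bar>x\<bar> ^ (\<Sum>i\<in>{..k} - {j}. Ord i j) \<le> dst j x y * ((2 * K) ^ k * (\<Prod>i\<in>{..k} - {j}. dst i x y))"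
    by (intro mult_left_mono) (auto simp: power_sum dst_nonneg)
  also have "\<dots> = (2 * K) ^ k * (\<Prod>i\<le>k. dst i x y)" using j by (simp add: prod.remove[of "{..k}" j])
  finally show ?thesis using j(1) by blast
qed

lemma F_upper:
  assumes x: "\<bar>x\<bar> < r" and y: "\<bar>y\<bar> < r"
  shows "norm (Fr k x y) \<le> K * (\<Prod>j\<in>{k<..<M}. dst j x y)"
proof -
  have "norm (complex_of_real y - a j (of_real x)) \<le> dst j x y" if "j \<in> {k<..<M}" for j
    using branch_bounds_a[OF x, of j] that by (simp add: dst_def flip: of_real_diff)
  then have "(\<Prod>j\<in>{k<..<M}. norm (complex_of_real y - a j (of_real x))) \<le> (\<Prod>j\<in>{k<..<M}. dst j x y)"
    by (intro prod_mono) auto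
  then have "norm (ur x y) * (\<Prod>j\<in>{k<..<M}. norm (complex_of_real y - a j (of_real x))) \<le> K * (\<Prod>j\<in>{k<..<M}. dst j x y)"
    using branch_bounds_u(2)[OF x y] K_ge_1 by (intro mult_mono) (auto intro!: prod_nonneg)
  then show ?thesis by (simp add: F_def norm_mult prod_norm[symmetric])
qed

end

section \<open>Sufficiency for a single term\<close>

lemma conv_F: "conv_ps2 (F k)"
  unfolding F_def by (intro conv_ps2_intros conv_u conv_a) auto

text \<open>The nearest branch j varies with the point (x, y), and each j gives its own bound |x|^(m
  - \<sigma>_j) / d_j. All exponents m - \<sigma>_j with j \<le> k must therefore reach
  \<open>expo p (L j)\<close> at once, which is the content of the hypothesis
  \<open>greedy\<close>.\<close>

lemma term_Lp:
  assumes p: "p \<ge> 1" and k: "k < M"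
    and greedy: "\<And>j. j \<le> k \<Longrightarrow> expo p (L j) + (\<Sum>i\<in>{..k} - {j}. Ord i j) \<le> m"
    and c: "\<forall>n<m. coeff c n = 0"
  shows "Lp_loc p (\<lambda>(x,y). poly c (of_real x) * Fr k x y /
      Pr x y)"
proof -
  obtain K r0 where good0: "branch_bounds K r0" using branch_bounds_exist by blast
  obtain C where C: "C \<ge> 0" "\<forall>\<^sub>F x in nhds 0. norm (poly c x) \<le> C * norm x ^ m" using poly_order_bound[OF c] by blast
  obtain r1 where r1: "r1 > 0" "\<And>x. \<bar>x\<bar> < r1 \<Longrightarrow> norm (poly c (of_real x)) \<le> C * \<bar>x\<bar> ^ m"
    using eventually_nhds_of_real[OF C(2)] unfolding eventually_nhds_metric by auto
  have "conv_ps2 (\<lambda>x y. poly c x * F k x y)" by (intro conv_ps2_intros conv_F)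
  then obtain r2 where r2: "r2 > 0" "\<And>s. s \<le> r2 \<Longrightarrow> set_borel_measurable lborel (sq_box s)
     (\<lambda>(x,y). poly c (of_real x) * Fr k x y / Pr x y)"
    using conv_ps2_quotient_measurable[OF _ conv_ps2_Pfun] by blast
  define r where "r = min r0 (min r1 r2)"
  have r: "r > 0" "r \<le> r0" "r \<le> r1" "r \<le> r2" using good0 r1 r2 by (auto simp: r_def branch_bounds_def)
  have branch_bounds: "branch_bounds K r" using branch_bounds_mono[OF good0 r(1,2)] .
  define \<sigma> where "\<sigma> = (\<lambda>j. \<Sum>i\<in>{..k} - {j}. Ord i j)"
  \<comment> \<open>C bounds the polynomial, K comes from \<open>F_upper\<close>, K^M from
    \<open>P_lower\<close> and (2K)^k from \<open>nearest_branch_bound\<close>.\<close>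
  define K' where "K' = C * (K * K ^ M * (2 * K) ^ k)"
  have K0: "K \<ge> 1" using K_ge_1[OF branch_bounds] .
  have "Lp_box p r (\<lambda>(x,y). poly c (of_real x) * Fr k x y / Pr x y)"
  proof (rule Lp_box_if_branch_bounds[where S = "{..k}" and \<alpha> = ar and l = "\<lambda>j. 2 * L j" and e = "\<lambda>j. real m - real (\<sigma> j)" and K = K'])
    show "1 \<le> p" "0 < r" "r \<le> 1" "finite {..k}" using p radius_bounds[OF branch_bounds] by auto
    show "0 \<le> K'" using C K0 by (simp add: K'_def)
    show "set_borel_measurable lborel (sq_box r) (\<lambda>(x,y). poly c (of_real x) * Fr k x y / Pr x y)"
      by (rule r2(2)[OF r(4)])
    fix j assume j: "j \<in> {..k}"
    show "\<bar>ar j x\<bar> < 1" if "\<bar>x\<bar> < r" for x using branch_bounds_ar[OF branch_bounds that] j k by simp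
    show "1 \<le> 2 * L j" using L_pos[of j] j k by simp
    have "expo p (L j) + \<sigma> j \<le> m" using greedy[of j] j unfolding \<sigma>_def by simp
    then have "real (expo p (L j)) \<le> real m - real (\<sigma> j)" by linarith
    then have "p * real (expo p (L j)) \<le> p * (real m - real (\<sigma> j))" using p by (intro mult_left_mono) auto
    then show "- 1 < p * (real m - real (\<sigma> j)) - real (2 * L j) * (p - 1)" using expo_bounds(1)[OF p, of "L j"] by linarith
  next
    fix x y assume x: "\<bar>x\<bar> < r" and y: "\<bar>y\<bar> < r" and x0: "x \<noteq> 0"
    let ?P = "Pr x y"
    define D1 where "D1 = (\<Prod>i\<le>k. dst i x y)"
    define D2 where "D2 = (\<Prod>j\<in>{k<..<M}. dst j x y)"
    have D: "D1 > 0" "D2 > 0" unfolding D1_def D2_def by (auto intro!: prod_pos dst_pos[OF branch_bounds x0])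
    have PD: "D1 * D2 \<le> K ^ M * norm ?P" using P_lower[OF branch_bounds x, of y] unfolding prod_split_at[OF k] D1_def D2_def .
    then have P0: "norm ?P > 0" using D K0 by (metis mult_pos_pos norm_ge_zero order_less_le norm_zero mult_zero_right not_less)
    obtain j where j: "j \<le> k" "dst j x y * \<bar>x\<bar> ^ \<sigma> j \<le> (2 * K) ^ k * D1"
      using nearest_branch_bound[OF branch_bounds x k, of y] unfolding \<sigma>_def D1_def by blast
    have num: "norm (poly c (of_real x) * Fr k x y) \<le> C * \<bar>x\<bar> ^ m * (K * D2)"
      unfolding norm_mult D2_def using r1(2)[of x] x r C F_upper[OF branch_bounds x y, of k] by (intro mult_mono) auto
    have dp: "dst j x y * \<bar>x\<bar> ^ \<sigma> j > 0" using dst_pos[OF branch_bounds x0] x0 by simp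
    have "norm (poly c (of_real x) * Fr k x y / ?P)
        \<le> C * \<bar>x\<bar> ^ m * (K * D2) / norm ?P"
      unfolding norm_divide using num P0 by (intro divide_right_mono) auto
    also have "\<dots> \<le> K' * \<bar>x\<bar> ^ m / (dst j x y * \<bar>x\<bar> ^ \<sigma> j)"
    proof -
      have "(dst j x y * \<bar>x\<bar> ^ \<sigma> j) * D2 \<le> (2 * K) ^ k * D1 * D2" using j(2) D by (intro mult_right_mono) auto
      also have "\<dots> = (2 * K) ^ k * (D1 * D2)" by simp
      also have "\<dots> \<le> (2 * K) ^ k * (K ^ M * norm ?P)" using PD K0 by (intro mult_left_mono) auto
      finally have "(C * \<bar>x\<bar> ^ m * K) * ((dst j x y * \<bar>x\<bar> ^ \<sigma> j) * D2) \<le> (C * \<bar>x\<bar> ^ m * K) * ((2 * K) ^ k * (K ^ M * norm ?P))"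
        using C K0 by (intro mult_left_mono) auto
      then show ?thesis using P0 dp by (simp add: K'_def divide_le_eq le_divide_eq mult_ac)
    qed
    also have "\<dots> = K' * (\<bar>x\<bar> ^ m / \<bar>x\<bar> ^ \<sigma> j) / dst j x y" by simp
    also have "\<bar>x\<bar> ^ m / \<bar>x\<bar> ^ \<sigma> j = \<bar>x\<bar> powr (real m - real (\<sigma> j))"
      using x0 by (simp add: powr_diff powr_realpow)
    finally show "\<exists>j\<in>{..k}. norm (case (x, y) of (x,y) \<Rightarrow> poly c (of_real x) * Fr k x y / Pr x y)
       \<le> K' * \<bar>x\<bar> powr (real m - real (\<sigma> j)) / (\<bar>y - ar j x\<bar> + \<bar>x\<bar> ^ (2 * L j))"
      using j(1) unfolding dst_def by auto
  qed
  then show ?thesis unfolding Lp_loc_iff_Lp_box using r(1) by blast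
qed

section \<open>Necessity: the coefficient of largest index\<close>

abbreviation thr :: "real \<Rightarrow> nat \<Rightarrow> nat" where "thr p k \<equiv> expo p (L k) + (\<Sum>j<k. Ord j k)"

text \<open>The sum of the terms c_i F_i with i \<le> k, divided by their common factor, the unit
  times the y - a_j with j > k. It is a polynomial in y of degree at most k whose value on the
  branch a_k is c_k.\<close>

definition T :: "(nat \<Rightarrow> complex poly) \<Rightarrow> nat \<Rightarrow> complex \<Rightarrow> complex \<Rightarrow> complex" where
  "T c k x y = (\<Sum>i\<le>k. poly (c i) x * (\<Prod>j\<in>{i<..k}. y - a j x))"

lemma partial_sum_F:
  assumes "k < M"
  shows "(\<Sum>i\<le>k. poly (c i) x * F i x y) = u x y * (\<Prod>j\<in>{k<..<M}. y - a j x) * T c k x y"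
proof -
  have split: "(\<Prod>j\<in>{i<..<M}. y - a j x) = (\<Prod>j\<in>{i<..k}. y - a j x) * (\<Prod>j\<in>{k<..<M}. y - a j x)" if "i \<le> k" for i
  proof -
    have eq: "{i<..<M} = {i<..k} \<union> {k<..<M}" using that assms by auto
    show ?thesis unfolding eq by (rule prod.union_disjoint) auto
  qed
  show ?thesis unfolding T_def F_def sum_distrib_left
  proof (rule sum.cong)
    fix i assume "i \<in> {..k}"
    then show "poly (c i) x * (u x y * (\<Prod>j\<in>{i<..<M}. y - a j x)) =
       u x y * (\<Prod>j\<in>{k<..<M}. y - a j x) * (poly (c i) x * (\<Prod>j\<in>{i<..k}. y - a j x))"
      by (subst split) (simp_all add: mult_ac)
  qed simp
qed

lemma T_poly:
  "\<exists>\<tau>. degree \<tau> < Suc k \<and> poly \<tau> 0 = poly (c k) x \<and> (\<forall>h. T c k x (a k x + h) = poly \<tau> h)"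
proof -
  define \<tau> where "\<tau> = (\<Sum>i\<le>k. smult (poly (c i) x) (\<Prod>j\<in>{i<..k}. [:a k x - a j x, 1:]))"
  have ev: "T c k x (a k x + h) = poly \<tau> h" for h
    unfolding T_def \<tau>_def by (simp add: poly_sum poly_prod algebra_simps)
  have "degree (smult (poly (c i) x) (\<Prod>j\<in>{i<..k}. [:a k x - a j x, 1:])) < Suc k" for i
  proof -
    have "degree (\<Prod>j\<in>{i<..k}. [:a k x - a j x, 1:]) \<le> (\<Sum>j\<in>{i<..k}. degree [:a k x - a j x, 1:])"
      by (rule degree_prod_sum_le[unfolded o_def]) simp
    then show ?thesis using degree_smult_le[of "poly (c i) x" "\<Prod>j\<in>{i<..k}. [:a k x - a j x, 1:]"] by simp
  qed
  then have "degree \<tau> < Suc k" unfolding \<tau>_def by (intro degree_sum_less) auto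
  moreover have "poly \<tau> 0 = poly (c k) x"
  proof -
    have "poly \<tau> 0 = (\<Sum>i\<le>k. poly (c i) x * (\<Prod>j\<in>{i<..k}. a k x - a j x))"
      unfolding \<tau>_def by (simp add: poly_sum poly_prod)
    also have "\<dots> = (\<Sum>i\<le>k. if i = k then poly (c k) x else 0)"
      by (rule sum.cong) (auto intro!: prod_zero)
    finally show ?thesis by simp
  qed
  ultimately show ?thesis using ev by blast
qed

lemma N_split: "k < M \<Longrightarrow> N k = (2 * L k + (\<Sum>j<k. Ord j k)) + (\<Sum>j\<in>{k<..<M}. Ord j k)"
proof -
  assume "k < M"
  then have eq: "{..<M} - {k} = {..<k} \<union> {k<..<M}" by auto
  have "(\<Sum>j\<in>{..<M} - {k}. Ord j k) = (\<Sum>j<k. Ord j k) + (\<Sum>j\<in>{k<..<M}. Ord j k)"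
    unfolding eq by (rule sum.union_disjoint) auto
  then show ?thesis by (simp add: N_def)
qed

text \<open>Within this distance of a_k the factors of P have, up to constants, no larger size than
  on the branch itself. The denominator 2K is tuned to the separation x^O \<le> K (|y - a_j| + |y -
  a_k|) with O = \<open>Ord j k\<close>: since O \<le> 2L_k and x \<le> 1, the second summand
  contributes at most x^O / 2 and can be absorbed.\<close>

context
  fixes K r :: real and k :: nat and x y :: real
  assumes branch_bounds: "branch_bounds K r" and k: "k < M" and x: "0 < x" "x < r" and y: "\<bar>y\<bar> < r"
    and near: "\<bar>y - ar k x\<bar> \<le> x ^ (2 * L k) / (2 * K)"
begin

lemma x_bounds: "\<bar>x\<bar> < r" "0 \<le> x" "x \<le> 1" using x radius_bounds[OF branch_bounds] by auto

lemma near_half: "\<bar>y - ar k x\<bar> \<le> x ^ (2 * L k)" "2 * K * \<bar>y - ar k x\<bar> \<le> x ^ (2 * L k)"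
proof -
  show 1: "2 * K * \<bar>y - ar k x\<bar> \<le> x ^ (2 * L k)" using near K_ge_1[OF branch_bounds] by (simp add: field_simps)
  have "1 * \<bar>y - ar k x\<bar> \<le> 2 * K * \<bar>y - ar k x\<bar>" using K_ge_1[OF branch_bounds] by (intro mult_right_mono) auto
  with 1 show "\<bar>y - ar k x\<bar> \<le> x ^ (2 * L k)" by simp
qed

lemma near_dst:
  assumes j: "j < M"
  shows "dst j x y \<le> 3 * K * x ^ (if j = k then 2 * L k else Ord j k)"
proof -
  have K: "K \<ge> 1" using K_ge_1[OF branch_bounds] .
  have ax: "\<bar>x\<bar> = x" using x by simp
  show ?thesis
  proof (cases "j = k")
    case True
    have "2 * x ^ (2 * L k) \<le> 3 * K * x ^ (2 * L k)" using K x by (intro mult_right_mono) auto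
    then show ?thesis using True near_half(1) by (simp add: dst_def ax)
  next
    case False
    have O: "x ^ (2 * L k) \<le> x ^ Ord j k" "x ^ (2 * L j) \<le> x ^ Ord j k"
      using Oij_le[of L q j k] x_bounds by (auto intro!: power_decreasing)
    have "\<bar>ar j x - ar k x\<bar> \<le> K * x ^ Ord j k" using branch_bounds_sep(2)[OF branch_bounds x_bounds(1) j k False] by (simp add: ax)
    then have "dst j x y \<le> x ^ Ord j k + K * x ^ Ord j k + x ^ Ord j k"
      using near_half(1) O unfolding dst_def ax by linarith
    moreover have "1 * x ^ Ord j k \<le> K * x ^ Ord j k" using K x by (intro mult_right_mono) auto
    ultimately show ?thesis using False by simp
  qed
qed

lemma near_P_upper: "norm (Pr x y) \<le> K ^ M * ((3 * K) ^ M * x ^ N k)"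
proof -
  have K: "K \<ge> 1" using K_ge_1[OF branch_bounds] .
  have "(\<Prod>j<M. dst j x y) \<le> (\<Prod>j<M. 3 * K * x ^ (if j = k then 2 * L k else Ord j k))"
    by (intro prod_mono) (auto simp: dst_nonneg near_dst[simplified])
  also have "\<dots> = (3 * K) ^ M * x ^ N k" unfolding N_eq[OF k] power_sum by (simp add: prod.distrib)
  finally have "K ^ M * (\<Prod>j<M. dst j x y) \<le> K ^ M * ((3 * K) ^ M * x ^ N k)" using K by (intro mult_left_mono) auto
  with P_upper[OF branch_bounds x_bounds(1), of y] show ?thesis by linarith
qed

lemma near_P_nonzero: "Pr x y \<noteq> 0"
proof
  assume "Pr x y = 0"
  then have "(\<Prod>j<M. dst j x y) \<le> 0" using P_lower[OF branch_bounds x_bounds(1), of y] by simp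
  moreover have "(\<Prod>j<M. dst j x y) > 0" using x by (intro prod_pos) (auto intro!: dst_pos[OF branch_bounds])
  ultimately show False by simp
qed

lemma near_prod_lower: "x ^ (\<Sum>j\<in>{k<..<M}. Ord j k) \<le> (2 * K) ^ M * (\<Prod>j\<in>{k<..<M}. \<bar>y - ar j x\<bar>)"
proof -
  have K: "K \<ge> 1" using K_ge_1[OF branch_bounds] .
  have ax: "\<bar>x\<bar> = x" using x by simp
  have "(\<Prod>j\<in>{k<..<M}. x ^ Ord j k) \<le> (\<Prod>j\<in>{k<..<M}. 2 * K * \<bar>y - ar j x\<bar>)"
  proof (intro prod_mono conjI)
    fix j assume j: "j \<in> {k<..<M}"
    show "0 \<le> x ^ Ord j k" using x by simp
    have O: "x ^ (2 * L k) \<le> x ^ Ord j k"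
      using Oij_le[of L q j k] x_bounds by (auto intro!: power_decreasing)
    have "x ^ Ord j k \<le> K * \<bar>ar j x - ar k x\<bar>" using branch_bounds_sep(1)[OF branch_bounds x_bounds(1), of j k] j k by (simp add: ax)
    also have "\<dots> \<le> K * (\<bar>y - ar j x\<bar> + \<bar>y - ar k x\<bar>)" using K by (intro mult_left_mono) auto
    also have "\<dots> = K * \<bar>y - ar j x\<bar> + K * \<bar>y - ar k x\<bar>" by (rule distrib_left)
    finally have "2 * x ^ Ord j k \<le> 2 * K * \<bar>y - ar j x\<bar> + 2 * K * \<bar>y - ar k x\<bar>" by simp
    then show "x ^ Ord j k \<le> 2 * K * \<bar>y - ar j x\<bar>" using near_half(2) O by linarith
  qed
  also have "\<dots> = (2 * K) ^ card {k<..<M} * (\<Prod>j\<in>{k<..<M}. \<bar>y - ar j x\<bar>)" by (simp add: prod.distrib)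
  also have "\<dots> \<le> (2 * K) ^ M * (\<Prod>j\<in>{k<..<M}. \<bar>y - ar j x\<bar>)"
    using K by (intro mult_right_mono power_increasing prod_nonneg) auto
  finally show ?thesis by (simp add: power_sum)
qed

text \<open>Passing from the quotient by P to the numerator gains x^(N k); removing the common
  factor of the terms costs x to the sum of \<open>Ord j k\<close> over j > k. What remains is the
  exponent 2L_k plus the sum over j < k.\<close>

lemma near_T_bound:
  "norm (T c k (of_real x) (of_real y)) \<le>
    ((2 * K) ^ M * K * K ^ M * (3 * K) ^ M) * x ^ (2 * L k + (\<Sum>j<k. Ord j k)) *
    norm ((\<Sum>i\<le>k. poly (c i) (of_real x) * Fr i x y) /
      Pr x y)"
proof -
  let ?x = "complex_of_real x" and ?y = "complex_of_real y"
  have K: "K \<ge> 1" using K_ge_1[OF branch_bounds] .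
  define R where "R = (\<Sum>i\<le>k. poly (c i) ?x * F i ?x ?y)"
  define S where "S = (\<Sum>j\<in>{k<..<M}. Ord j k)"
  define E where "E = 2 * L k + (\<Sum>j<k. Ord j k)"
  define V where "V = (\<Prod>j\<in>{k<..<M}. \<bar>y - ar j x\<bar>)"
  have V0: "V \<ge> 0" unfolding V_def by (intro prod_nonneg) auto
  have "norm (\<Prod>j\<in>{k<..<M}. ?y - a j ?x) = (\<Prod>j\<in>{k<..<M}. norm (?y - a j ?x))" by (rule prod_norm[symmetric])
  also have "\<dots> = V" unfolding V_def
  proof (rule prod.cong)
    fix j assume "j \<in> {k<..<M}"
    then show "norm (?y - a j ?x) = \<bar>y - ar j x\<bar>" using branch_bounds_a[OF branch_bounds x_bounds(1), of j] by (simp flip: of_real_diff)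
  qed simp
  finally have nR: "norm R = norm (u ?x ?y) * V * norm (T c k ?x ?y)"
    unfolding R_def partial_sum_F[OF k] by (simp add: norm_mult)
  have Rf: "norm R = norm (R / P ?x ?y) * norm (P ?x ?y)"
    using near_P_nonzero by (simp add: norm_divide)
  have "x ^ S * norm (T c k ?x ?y) \<le> (2 * K) ^ M * V * norm (T c k ?x ?y)"
    using near_prod_lower unfolding S_def V_def by (intro mult_right_mono) auto
  also have "\<dots> = (2 * K) ^ M * (1 * (V * norm (T c k ?x ?y)))" by simp
  also have "\<dots> \<le> (2 * K) ^ M * ((K * norm (u ?x ?y)) * (V * norm (T c k ?x ?y)))"
    using branch_bounds_u(1)[OF branch_bounds x_bounds(1) y] K V0 by (intro mult_left_mono mult_right_mono) auto
  also have "\<dots> = (2 * K) ^ M * K * norm R" unfolding nR by simp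
  also have "\<dots> = (2 * K) ^ M * K * norm (R / P ?x ?y) * norm (P ?x ?y)" unfolding Rf by (simp add: mult.assoc)
  also have "\<dots> \<le> (2 * K) ^ M * K * norm (R / P ?x ?y) * (K ^ M * ((3 * K) ^ M * x ^ N k))"
    using K by (intro mult_left_mono near_P_upper) auto
  also have "\<dots> = x ^ S * (((2 * K) ^ M * K * K ^ M * (3 * K) ^ M) * x ^ E * norm (R / P ?x ?y))"
    unfolding N_split[OF k] S_def E_def power_add by (simp add: mult_ac)
  finally have "x ^ S * norm (T c k ?x ?y) \<le> x ^ S * (((2 * K) ^ M * K * K ^ M * (3 * K) ^ M) * x ^ E * norm (R / P ?x ?y))" .
  then show ?thesis using x unfolding E_def R_def by simp
qed

end

text \<open>If c_k had order m below the threshold, then |c_k(x)| \<ge> c1 x^m and interpolation of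
  T towards the branch would make the sum of |f| over the nodes at least a constant times x^(m - E),
  with E the exponent of \<open>near_T_bound\<close>. The p-th power is then at least a constant
  over x^(l + 1), and a neighbourhood of width about x^l turns this into the divergent integral of
  1/x.\<close>

lemma leading_coeff_vanishes:
  assumes p: "p \<ge> 1" and k: "k < M"
    and Lp: "Lp_loc p (\<lambda>(x,y). (\<Sum>i\<le>k. poly (c i) (of_real x) * Fr i x y) /
      Pr x y)"
  shows "\<forall>n < thr p k. coeff (c k) n = 0"
proof (rule ccontr)
  assume "\<not> ?thesis"
  then obtain n0 where n0: "n0 < thr p k" "coeff (c k) n0 \<noteq> 0" by blast
  define m where "m = (LEAST n. coeff (c k) n \<noteq> 0)"
  have m: "coeff (c k) m \<noteq> 0" unfolding m_def using n0(2) by (rule LeastI)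
  have mn: "m \<le> n0" unfolding m_def using n0(2) by (rule Least_le)
  have m0: "\<forall>n<m. coeff (c k) n = 0" unfolding m_def using not_less_Least by blast
  define f where "f = (\<lambda>(x,y). (\<Sum>i\<le>k. poly (c i) (of_real x) * Fr i x y) /
      Pr x y)"
  obtain r0 where r0: "r0 > 0" "Lp_box p r0 f" using Lp unfolding Lp_loc_iff_Lp_box f_def by blast
  obtain K r1 where good1: "branch_bounds K r1" using branch_bounds_exist by blast
  obtain c1 where c1: "c1 > 0" "\<forall>\<^sub>F x in nhds 0. c1 * norm x ^ m \<le> norm (poly (c k) x)"
    using poly_order_lower_bound[OF m0 m] by blast
  obtain r2 where r2: "r2 > 0" "\<And>x. \<bar>x\<bar> < r2 \<Longrightarrow> c1 * \<bar>x\<bar> ^ m \<le> norm (poly (c k) (of_real x))"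
    using eventually_nhds_of_real[OF c1(2)] unfolding eventually_nhds_metric by auto
  define r where "r = min r0 r1"
  have r: "r > 0" "r \<le> r0" "r \<le> r1" using r0 good1 by (auto simp: r_def branch_bounds_def)
  have branch_bounds: "branch_bounds K r" using branch_bounds_mono[OF good1 r(1,3)] .
  have K: "K \<ge> 1" using K_ge_1[OF branch_bounds] .
  have Lpr: "Lp_box p r f" using Lp_box_mono[OF r0(2) r(2)] .
  obtain r3 where r3: "r3 > 0" "\<And>x. \<bar>x\<bar> < r3 \<Longrightarrow> \<bar>ar k x\<bar> < r / 2"
    using a_small[OF k, of "r / 2"] r(1) unfolding eventually_nhds_metric by auto
  define \<epsilon> where "\<epsilon> = min r (min r2 r3)"
  have \<epsilon>: "0 < \<epsilon>" "\<epsilon> \<le> r" "\<epsilon> \<le> r2" "\<epsilon> \<le> r3" using r r2 r3 by (auto simp: \<epsilon>_def)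
  \<comment> \<open>T has degree at most k in y, so k + 1 nodes determine it.\<close>
  define n where "n = Suc k"
  have npos: "real n > 0" by (simp add: n_def)
  obtain W where W: "W \<ge> 1" "\<And>(\<tau> :: complex poly) h. degree \<tau> < n \<Longrightarrow> norm (poly \<tau> 0) \<le> W * (\<Sum>i\<in>{1..n}. norm (poly \<tau> (of_nat i * h)))"
    using interpolation_at_zero[of n] by blast
  \<comment> \<open>Keeps even the outermost node, i = n, within distance x^l / (2K) of the
    branch.\<close>
  define \<delta> where "\<delta> = 1 / (2 * K * real n)"
  have \<delta>: "\<delta> > 0" using K by (simp add: \<delta>_def n_def)
  define l where "l = 2 * L k"
  have l: "l \<ge> 1" using L_pos[OF k] by (simp add: l_def)
  define E where "E = l + (\<Sum>j<k. Ord j k)"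
  define C where "C = (2 * K) ^ M * K * K ^ M * (3 * K) ^ M"
  have C: "C > 0" using K by (simp add: C_def)
  have pts: "\<bar>ar k x + \<delta> * real i * x ^ l * s\<bar> < r" "\<bar>(ar k x + \<delta> * real i * x ^ l * s) - ar k x\<bar> \<le> x ^ l / (2 * K)"
    if "0 < x" "x < \<epsilon>" "0 < s" "s < 1" "i \<in> {1..n}" for x s i
  proof -
    have x1: "x \<le> 1" using that \<epsilon> radius_bounds[OF branch_bounds] by auto
    have "\<delta> * real i * x ^ l * s \<le> \<delta> * real n * x ^ l * 1"
      using that \<delta> by (intro mult_mono) auto
    also have "\<dots> = x ^ l / (2 * K)" using K npos by (simp add: \<delta>_def)
    finally have 1: "\<delta> * real i * x ^ l * s \<le> x ^ l / (2 * K)" .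
    have 2: "0 \<le> \<delta> * real i * x ^ l * s" using that \<delta> by simp
    show "\<bar>(ar k x + \<delta> * real i * x ^ l * s) - ar k x\<bar> \<le> x ^ l / (2 * K)" using 1 2 by simp
    have "x ^ l \<le> x" using power_decreasing[OF l, of x] that x1 by simp
    moreover have "x ^ l / (2 * K) \<le> x ^ l / 2" using K that by (intro divide_left_mono) auto
    ultimately have "x ^ l / (2 * K) < r / 2" using that \<epsilon> by linarith
    moreover have "\<bar>ar k x\<bar> < r / 2" using r3(2)[of x] that \<epsilon> by auto
    ultimately show "\<bar>ar k x + \<delta> * real i * x ^ l * s\<bar> < r" using 1 2 by linarith
  qed
  \<comment> \<open>W is lost in the interpolation, C in \<open>near_T_bound\<close> and n in
    passing from the power of a sum to a sum of powers.\<close>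
  define \<kappa> where "\<kappa> = (c1 / (W * C * real n)) powr p"
  have \<kappa>: "\<kappa> > 0" using c1 W C by (simp add: \<kappa>_def n_def)
  show False
  proof (rule not_Lp_box_if_lower_bound[OF Lpr \<epsilon>(1,2) \<delta> \<kappa>, where n = n and l = l and \<alpha> = "ar k"])
    show "\<bar>ar k x + \<delta> * real i * x ^ l * s\<bar> < r" if "0 < x" "x < \<epsilon>" "0 < s" "s < 1" "i \<in> {1..n}" for x s i
      using pts(1)[OF that] .
  next
    fix x s :: real assume x: "0 < x" "x < \<epsilon>" and s: "0 < s" "s < 1"
    let ?y = "\<lambda>i. ar k x + \<delta> * real i * x ^ l * s"
    define h where "h = complex_of_real (\<delta> * x ^ l * s)"
    have xr: "x < r" "\<bar>x\<bar> < r" "x \<le> 1" using x \<epsilon> radius_bounds[OF branch_bounds] by auto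
    obtain \<tau> where \<tau>: "degree \<tau> < n" "poly \<tau> 0 = poly (c k) (of_real x)"
      "\<And>h. T c k (of_real x) (a k (of_real x) + h) = poly \<tau> h"
      using T_poly[of k c "complex_of_real x"] unfolding n_def by blast
    have yi: "complex_of_real (?y i) = a k (of_real x) + of_nat i * h" for i
      using branch_bounds_a[OF branch_bounds xr(2) k] by (simp add: h_def mult_ac)
    have Tb: "norm (poly \<tau> (of_nat i * h)) \<le> C * x ^ E * norm (f (x, ?y i))" if i: "i \<in> {1..n}" for i
    proof -
      have near: "\<bar>?y i - ar k x\<bar> \<le> x ^ (2 * L k) / (2 * K)" using pts(2)[OF x s i] unfolding l_def .
      have "norm (T c k (of_real x) (complex_of_real (?y i))) \<le> C * x ^ E * norm (f (x, ?y i))"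
        using near_T_bound[OF branch_bounds k x(1) xr(1) pts(1)[OF x s i] near, of c]
        unfolding f_def C_def E_def l_def prod.case .
      then show ?thesis unfolding yi \<tau>(3) .
    qed
    define Bx where "Bx = W * (C * x ^ E)"
    have Bx: "Bx > 0" using W C x by (simp add: Bx_def)
    have "c1 * x ^ m \<le> norm (poly \<tau> 0)" using r2(2)[of x] x \<epsilon> unfolding \<tau>(2) by auto
    also have "\<dots> \<le> W * (\<Sum>i\<in>{1..n}. norm (poly \<tau> (of_nat i * h)))" using W(2)[OF \<tau>(1)] .
    also have "\<dots> \<le> W * (\<Sum>i\<in>{1..n}. C * x ^ E * norm (f (x, ?y i)))"
      using W Tb by (intro mult_left_mono sum_mono) auto
    also have "\<dots> = Bx * (\<Sum>i\<in>{1..n}. norm (f (x, ?y i)))" by (simp add: sum_distrib_left Bx_def mult_ac)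
    finally have "c1 * x ^ m / Bx \<le> (\<Sum>i\<in>{1..n}. norm (f (x, ?y i)))" using Bx by (simp add: field_simps)
    then have "(c1 * x ^ m / Bx) powr p \<le> (\<Sum>i\<in>{1..n}. norm (f (x, ?y i))) powr p"
      using p c1 x Bx by (intro powr_mono2) auto
    also have "\<dots> \<le> real (card {1..n}) powr p * (\<Sum>i\<in>{1..n}. norm (f (x, ?y i)) powr p)"
      using p by (intro sum_powr_le) auto
    finally have main: "(c1 * x ^ m / Bx) powr p \<le> real n powr p * (\<Sum>i\<in>{1..n}. norm (f (x, ?y i)) powr p)" by simp
    have "c1 * x ^ m / Bx = (c1 / (W * C)) * x powr (real m - real E)"
      using x W C by (simp add: Bx_def powr_diff powr_realpow)
    then have eq: "(c1 * x ^ m / Bx) powr p = (c1 / (W * C)) powr p * x powr ((real m - real E) * p)"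
      using x c1 W C by (simp only: powr_mult powr_powr)
    have \<kappa>eq: "(c1 / (W * C)) powr p = \<kappa> * real n powr p"
    proof -
      have "c1 / (W * C) = c1 / (W * C * real n) * real n" by (simp add: n_def)
      then show ?thesis unfolding \<kappa>_def using c1 W C by (metis powr_mult)
    qed
    have np: "real n powr p > 0" by (simp add: n_def)
    have low: "\<kappa> * x powr ((real m - real E) * p) \<le> (\<Sum>i\<in>{1..n}. norm (f (x, ?y i)) powr p)"
    proof -
      have "real n powr p * (\<kappa> * x powr ((real m - real E) * p)) \<le> real n powr p * (\<Sum>i\<in>{1..n}. norm (f (x, ?y i)) powr p)"
        using main unfolding eq \<kappa>eq by (simp add: mult_ac)
      then show ?thesis using np by simp
    qed
    \<comment> \<open>Since m is strictly below the threshold there is a full unit to spare, as the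
      second inequality of \<open>expo_bounds\<close> demands.\<close>
    have "real m + 1 \<le> real (expo p (L k)) + real (\<Sum>j<k. Ord j k)" using mn n0(1) by linarith
    then have "real m - real E \<le> real (expo p (L k)) - 1 - real (2 * L k)" unfolding E_def l_def by simp
    then have "p * (real m - real E) \<le> p * (real (expo p (L k)) - 1 - real (2 * L k))" using p by (intro mult_left_mono) auto
    also have "\<dots> \<le> - real (Suc l)" using expo_bounds(2)[OF p, of "L k"] by (simp add: l_def)
    finally have "x powr (- real (Suc l)) \<le> x powr ((real m - real E) * p)"
      using x xr by (intro powr_mono') (auto simp: mult.commute)
    moreover have "x powr (- real (Suc l)) = 1 / x ^ Suc l"
      using x by (simp only: powr_minus_divide powr_realpow)
    ultimately have "\<kappa> * (1 / x ^ Suc l) \<le> \<kappa> * x powr ((real m - real E) * p)" using \<kappa> by (intro mult_left_mono) auto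
    then show "\<kappa> / x ^ Suc l \<le> (\<Sum>i\<in>{1..n}. norm (f (x, ?y i)) powr p)" using low by simp
  qed
qed

text \<open>For necessity the sum is shortened from the top: \<open>leading_coeff_vanishes\<close>
  gives the order of the last coefficient, \<open>term_Lp\<close> then puts its term into L^p, and
  removing it leaves an integrable sum with one term less. Thus the ordering condition serves both
  directions.\<close>

lemma Lp_iff_vanishing:
  assumes p: "p \<ge> 1"
    and greedy: "\<And>k j. k < M \<Longrightarrow> j \<le> k \<Longrightarrow> expo p (L j) + (\<Sum>i\<in>{..k} - {j}. Ord i j) \<le> thr p k"
  shows "Lp_loc p (\<lambda>(x,y). (\<Sum>i<M. poly (c i) (of_real x) * Fr i x y) /
        Pr x y) \<longleftrightarrow>
     (\<forall>k<M. \<forall>n < thr p k. coeff (c k) n = 0)"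
proof -
  define f where "f = (\<lambda>c k (x,y). poly (c k) (of_real x) * Fr k x y /
        Pr x y)"
  define R where "R = (\<lambda>n (x,y). (\<Sum>i<n. poly (c i) (of_real x) * Fr i x y) /
        Pr x y)"
  have R_Suc: "R (Suc n) = (\<lambda>z. R n z + f c n z)" for n
    unfolding R_def f_def by (auto simp: fun_eq_iff add_divide_distrib)
  \<comment> \<open>Subtraction is expressed as addition of the term with negated coefficients, to
    which \<open>term_Lp\<close> applies as well.\<close>
  have R_n: "R n = (\<lambda>z. R (Suc n) z + f (\<lambda>i. - c i) n z)" for n
    unfolding R_def f_def by (auto simp: fun_eq_iff add_divide_distrib)
  have p0: "p > 0" using p by simp
  have "Lp_loc p (R M) \<longleftrightarrow> (\<forall>k<M. \<forall>n < thr p k. coeff (c k) n = 0)"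
  proof
    assume van: "\<forall>k<M. \<forall>n < thr p k. coeff (c k) n = 0"
    have "Lp_loc p (R n)" if "n \<le> M" for n using that
    proof (induction n)
      case 0
      have "Lp_loc p (\<lambda>z. 0)"
        by (rule Lp_loc_bounded[where r = 1 and K = 0]) (auto simp: set_borel_measurable_def p0)
      moreover have "R 0 = (\<lambda>z. 0)" unfolding R_def by (auto simp: fun_eq_iff)
      ultimately show ?case by simp
    next
      case (Suc n)
      have "Lp_loc p (f c n)" unfolding f_def
        by (rule term_Lp[OF p, where m = "thr p n"]) (use Suc.prems van greedy in auto)
      then show ?case unfolding R_Suc using Suc by (intro Lp_loc_add p0) auto
    qed
    then show "Lp_loc p (R M)" by simp
  next
    assume LM: "Lp_loc p (R M)"
    have "Lp_loc p (R i) \<and> (\<forall>k\<in>{i..<M}. \<forall>n < thr p k. coeff (c k) n = 0)" if "i \<le> M" for i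
      using that
    proof (induction rule: inc_induct)
      case base
      show ?case using LM by auto
    next
      case (step n)
      have "R (Suc n) = (\<lambda>(x,y). (\<Sum>i\<le>n. poly (c i) (of_real x) * Fr i x y) /
          Pr x y)"
        unfolding R_def lessThan_Suc_atMost ..
      with step have van: "\<forall>m < thr p n. coeff (c n) m = 0"
        by (intro leading_coeff_vanishes[OF p]) auto
      have "Lp_loc p (f (\<lambda>i. - c i) n)" unfolding f_def
        by (rule term_Lp[OF p, where m = "thr p n"]) (use step van greedy in auto)
      then have "Lp_loc p (\<lambda>z. R (Suc n) z + f (\<lambda>i. - c i) n z)" using step by (intro Lp_loc_add p0) auto
      then have "Lp_loc p (R n)" using R_n[of n] by simp
      moreover have "{n..<M} = insert n {Suc n..<M}" using step by auto
      ultimately show ?case using step van by auto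
    qed
    from this[of 0] show "\<forall>k<M. \<forall>n < thr p k. coeff (c k) n = 0" by auto
  qed
  then show ?thesis unfolding R_def .
qed

lemma Rep_Lp_iff:
  assumes p: "p \<ge> 1"
    and greedy: "\<And>k j. k < M \<Longrightarrow> j \<le> k \<Longrightarrow> expo p (L j) + (\<Sum>i\<in>{..k} - {j}. Ord i j) \<le> thr p k"
    and Rep: "Rep Q c"
  shows "Lp_loc p (\<lambda>(a,b). Q (of_real a) (of_real b) / Pr a b) \<longleftrightarrow>
     (\<forall>k<M. \<forall>n < thr p k. coeff (c k) n = 0)"
proof -
  define R where "R = (\<lambda>x y. \<Sum>k<M. poly (c k) x * F k x y)"
  obtain G H where GH: "conv_ps2 G" "conv_ps2 H" and
    eq: "\<forall>\<^sub>F (x,y) in nhds (0,0). Q x y - R x y = G x y * P x y + H x y * Pbar P x y"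
    using Rep unfolding Rep_def cong_ideal2_def germ_eq_iff R_def by blast
  have eq': "\<forall>\<^sub>F (x,y) in nhds (0,0). R x y - Q x y = - G x y * P x y + - H x y * Pbar P x y"
    using eq by (rule eventually_mono) (auto simp: algebra_simps)
  have p0: "p > 0" using p by simp
  have "Lp_loc p (\<lambda>(a,b). Q (of_real a) (of_real b) / Pr a b) \<longleftrightarrow>
     Lp_loc p (\<lambda>(a,b). R (of_real a) (of_real b) / Pr a b)"
    using Lp_loc_mod_ideal[OF conv_ps2_Pfun conv_ps2_Pbar_Pfun GH p0 eq]
      Lp_loc_mod_ideal[OF conv_ps2_Pfun conv_ps2_Pbar_Pfun conv_ps2_minus[OF GH(1)] conv_ps2_minus[OF GH(2)] p0 eq'] by blast
  from trans[OF this[unfolded R_def] Lp_iff_vanishing[OF p greedy, of c]] show ?thesis .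
qed

end

text \<open>The weight of an index depends on the whole set of indices placed up to a given
  position, so sorting by a fixed key does not suffice. Filling the last position with a maximiser
  over the full set and recursing does: ordering the remaining indices never changes the set over
  which that maximum was taken.\<close>

lemma greedy_ordering:
  fixes f :: "nat set \<Rightarrow> nat \<Rightarrow> nat"
  assumes "finite S" "card S = M"
  shows "\<exists>\<sigma>. bij_betw \<sigma> {..<M} S \<and> (\<forall>k<M. \<forall>j\<le>k. f (\<sigma> ` {..k}) (\<sigma> j) \<le> f (\<sigma> ` {..k}) (\<sigma> k))"
  using assms
proof (induction M arbitrary: S)
  case 0
  then show ?case by (auto simp: bij_betw_def)
next
  case (Suc M)
  have "S \<noteq> {}" using Suc.prems(2) by auto
  have "Max (f S ` S) \<in> f S ` S" using Suc.prems \<open>S \<noteq> {}\<close> by (intro Max_in) auto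
  then obtain s where s: "s \<in> S" "f S s = Max (f S ` S)" by (metis imageE)
  have max: "f S t \<le> f S s" if "t \<in> S" for t unfolding s(2) using that Suc.prems by (intro Max_ge) auto
  have "finite (S - {s})" "card (S - {s}) = M" using Suc.prems s by auto
  from Suc.IH[OF this] obtain \<sigma> where \<sigma>: "bij_betw \<sigma> {..<M} (S - {s})"
    "\<And>k j. k < M \<Longrightarrow> j \<le> k \<Longrightarrow> f (\<sigma> ` {..k}) (\<sigma> j) \<le> f (\<sigma> ` {..k}) (\<sigma> k)" by blast
  define \<rho> where "\<rho> = \<sigma>(M := s)"
  have im: "\<rho> ` {..k} = \<sigma> ` {..k}" if "k < M" for k using that by (intro image_cong) (auto simp: \<rho>_def)
  have "bij_betw \<rho> {..<M} (S - {s})" using \<sigma>(1) by (subst bij_betw_cong[of _ _ \<sigma>]) (auto simp: \<rho>_def)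
  then have "bij_betw \<rho> ({..<M} \<union> {M}) ((S - {s}) \<union> {s})"
    by (rule bij_betw_combine) (auto simp: \<rho>_def)
  moreover have "{..<M} \<union> {M} = {..<Suc M}" "(S - {s}) \<union> {s} = S" using s by auto
  ultimately have bij: "bij_betw \<rho> {..<Suc M} S" by simp
  have "f (\<rho> ` {..k}) (\<rho> j) \<le> f (\<rho> ` {..k}) (\<rho> k)" if kj: "k < Suc M" "j \<le> k" for k j
  proof (cases "k = M")
    case True
    have "\<rho> ` {..M} = S" using bij by (simp add: bij_betw_def lessThan_Suc_atMost)
    moreover have "\<rho> j \<in> S" using bij kj by (auto simp: bij_betw_def)
    ultimately show ?thesis using max True by (simp add: \<rho>_def)
  next
    case False
    then have "k < M" using kj by simp
    then show ?thesis using \<sigma>(2)[of k j] kj im[of k] by (simp add: \<rho>_def)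
  qed
  with bij show ?case by blast
qed

section \<open>Invariance under relabeling, and the conclusion\<close>

lemma Pfun_permute:
  assumes "bij_betw \<sigma> {..<M} {..<M}"
  shows "Pfun M (\<lambda>j. L (\<sigma> j)) (\<lambda>j. q (\<sigma> j)) = Pfun M L q"
  unfolding Pfun_def fun_eq_iff
  by (intro allI prod.reindex_bij_betw[OF assms])

lemma Oij_permute: "Oij (\<lambda>j. L (\<sigma> j)) (\<lambda>j. q (\<sigma> j)) i j = Oij L q (\<sigma> i) (\<sigma> j)"
  unfolding Oij_def ..

lemma branch_factor_permute:
  "branch_factor (\<lambda>j. L (\<sigma> j)) (\<lambda>j. q (\<sigma> j)) (\<lambda>j. \<psi> (\<sigma> j)) j = branch_factor L q \<psi> (\<sigma> j)"
  unfolding branch_factor_def fun_eq_iff by simp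

lemma proper_factorization_permute:
  assumes \<sigma>: "bij_betw \<sigma> {..<M} {..<M}" and fact: "proper_factorization M L q t u \<psi>"
  shows "proper_factorization M (\<lambda>j. L (\<sigma> j)) (\<lambda>j. q (\<sigma> j)) t u (\<lambda>j. \<psi> (\<sigma> j))"
proof -
  have lt: "\<sigma> j < M" if "j < M" for j using \<sigma> that by (auto simp: bij_betw_def)
  have ne: "\<sigma> i \<noteq> \<sigma> j" if "i < M" "j < M" "i \<noteq> j" for i j
    using \<sigma> that by (auto simp: bij_betw_def inj_on_def)
  have "(\<Prod>j<M. branch_factor L q \<psi> (\<sigma> j) x y) = (\<Prod>j<M. branch_factor L q \<psi> j x y)" for x y
    by (rule prod.reindex_bij_betw[OF \<sigma>])
  with fact lt ne show ?thesis
    unfolding proper_factorization_def Pfun_permute[OF \<sigma>] branch_factor_permute Oij_permute by auto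
qed

theorem theorem8p1:
  fixes M :: nat and L :: "nat \<Rightarrow> nat" and q :: "nat \<Rightarrow> real poly"
    and p t :: real and u :: "complex \<Rightarrow> complex \<Rightarrow> complex" and \<psi> :: "nat \<Rightarrow> nat \<Rightarrow> real"
  assumes L_pos: "\<forall>j<M. 1 \<le> L j"
    and q_deg: "\<forall>j<M. degree (q j) < 2 * L j"
    and q_zero: "\<forall>j<M. poly (q j) 0 = 0"
    and p_ge: "1 \<le> p"
    and fact: "proper_factorization M L q t u \<psi>"
  shows "\<exists>\<sigma>. bij_betw \<sigma> {..<M} {..<M} \<and>
    (let F = (\<lambda>k x y. u x y * (\<Prod>j\<in>{k<..<M}. branch_factor L q \<psi> (\<sigma> j) x y));
         O' = (\<lambda>j k. Oij L q (\<sigma> j) (\<sigma> k));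
         Rep = (\<lambda>Q c. (\<forall>k\<ge>M. c k = 0) \<and>
                  (\<forall>k<M. degree (c k) < 2 * L (\<sigma> k) + (\<Sum>j\<in>{..<M} - {k}. O' j k)) \<and>
                  cong_ideal2 (Pfun M L q) (Pbar (Pfun M L q)) Q
                     (\<lambda>x y. \<Sum>k<M. poly (c k) x * F k x y))
     in \<forall>Q. conv_ps2 Q \<longrightarrow>
          (\<exists>!c :: nat \<Rightarrow> complex poly. Rep Q c) \<and>
          (\<forall>c. Rep Q c \<longrightarrow>
             (Lp_loc p (\<lambda>(a,b). Q (complex_of_real a) (complex_of_real b)
                                / Pfun M L q (complex_of_real a) (complex_of_real b))
              \<longleftrightarrow> (\<forall>k<M. \<forall>n < nat \<lfloor>(2 * real (L (\<sigma> k)) + 1) * (1 - 1 / p)\<rfloor> + (\<Sum>j<k. O' j k).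
                     coeff (c k) n = 0))))"
proof -
  \<comment> \<open>The order that integrability requires of a coefficient near branch j when the
    branches in S remain in the denominator. At the last index of an initial segment, the set S
    without that index consists of the preceding ones, and W becomes the threshold of the
    theorem.\<close>
  define W where "W = (\<lambda>S j. expo p (L j) + (\<Sum>i\<in>S - {j}. Oij L q i j))"
  obtain \<sigma> where \<sigma>: "bij_betw \<sigma> {..<M} {..<M}"
    and gr: "\<And>k j. k < M \<Longrightarrow> j \<le> k \<Longrightarrow> W (\<sigma> ` {..k}) (\<sigma> j) \<le> W (\<sigma> ` {..k}) (\<sigma> k)"
    using greedy_ordering[of "{..<M}" M W] by auto
  have lt: "\<sigma> j < M" if "j < M" for j using \<sigma> that by (auto simp: bij_betw_def)
  interpret proper_setting M "\<lambda>j. L (\<sigma> j)" "\<lambda>j. q (\<sigma> j)" t u "\<lambda>j. \<psi> (\<sigma> j)"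
    by unfold_locales (use L_pos q_zero lt proper_factorization_permute[OF \<sigma> fact] in auto)
  have W_eq: "W (\<sigma> ` {..k}) (\<sigma> j) = expo p (L (\<sigma> j)) + (\<Sum>i\<in>{..k} - {j}. Oij L q (\<sigma> i) (\<sigma> j))" if "k < M" "j \<le> k" for k j
  proof -
    have inj: "inj_on \<sigma> {..k}" using \<sigma> that by (auto simp: bij_betw_def intro: inj_on_subset)
    then have "\<sigma> ` {..k} - {\<sigma> j} = \<sigma> ` ({..k} - {j})" using that by (auto simp: inj_on_def)
    moreover have "inj_on \<sigma> ({..k} - {j})" using inj by (rule inj_on_subset) auto
    ultimately show ?thesis unfolding W_def by (simp add: sum.reindex)
  qed
  have greedy: "expo p (L (\<sigma> j)) + (\<Sum>i\<in>{..k} - {j}. Oij L q (\<sigma> i) (\<sigma> j)) \<le> expo p (L (\<sigma> k)) + (\<Sum>j<k. Oij L q (\<sigma> j) (\<sigma> k))"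
    if "k < M" "j \<le> k" for k j
  proof -
    have "{..k} - {k} = {..<k}" by auto
    then show ?thesis using gr[OF that] W_eq[OF that] W_eq[OF that(1) order_refl] by simp
  qed
  have Rep_eq: "Rep Q c \<longleftrightarrow> (\<forall>k\<ge>M. c k = 0) \<and>
       (\<forall>k<M. degree (c k) < 2 * L (\<sigma> k) + (\<Sum>j\<in>{..<M} - {k}. Oij L q (\<sigma> j) (\<sigma> k))) \<and>
       cong_ideal2 (Pfun M L q) (Pbar (Pfun M L q)) Q
         (\<lambda>x y. \<Sum>k<M. poly (c k) x * (u x y * (\<Prod>j\<in>{k<..<M}. branch_factor L q \<psi> (\<sigma> j) x y)))" for Q c
    unfolding Rep_def N_def F_def Pfun_permute[OF \<sigma>] Oij_permute branch_factor_eq[symmetric] branch_factor_permute ..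
  have main: "(\<exists>!c. Rep Q c) \<and> (\<forall>c. Rep Q c \<longrightarrow>
     (Lp_loc p (\<lambda>(a,b). Q (complex_of_real a) (complex_of_real b) / Pfun M L q (complex_of_real a) (complex_of_real b))
       \<longleftrightarrow> (\<forall>k<M. \<forall>n < nat \<lfloor>(2 * real (L (\<sigma> k)) + 1) * (1 - 1 / p)\<rfloor> + (\<Sum>j<k. Oij L q (\<sigma> j) (\<sigma> k)). coeff (c k) n = 0)))"
    if "conv_ps2 Q" for Q
    using Rep_exists[OF that] Rep_unique[of Q] Rep_Lp_iff[OF p_ge, of Q]
    unfolding Oij_permute Pfun_permute[OF \<sigma>] expo_def[symmetric] using greedy by blast
  show ?thesis unfolding Let_def
    by (rule exI[of _ \<sigma>]) (use \<sigma> main[unfolded Rep_eq] in blast)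
qed

end
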